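(* Assume the setting in the context, $F\in H^1(0,T;\Psi')$, $\Delta t\,|u|_{C(W^{1,\infty})}\le 1/8$ and $\Delta t\in(0,1)$. For a given $\phi_h^0\in\Psi_h$ let $\{\phi_h^n\}_{n=1}^{N_T}\subset\Psi_h$ be the solution of the scheme (S1)–(S2). Then: (i) there is $c_\ddagger>0$ depending only on $\|u\|_{C(W^{1,\infty})}$, $T$, $1/\nu$ (independent of $h$ and $\Delta t$) with $$\|\phi_h\|_{\ell^\infty(L^2)}+\sqrt\nu\,\|\nabla\phi_h\|_{\ell^2(L^2)}\le c_\ddagger\big(\|\phi_h^0\|+\|F\|_{\ell^2(\Psi_h')}\big);$$ (ii) if additionally $F\in H^1(0,T;L^2(\Omega))$, there is $\bar c_\ddagger>0$ depending only on $\|u\|_{C(W^{1,\infty})}$, $T$, $1/\nu$ with $$\sqrt\nu\,\|\nabla\phi_h\|_{\ell^\infty(L^2)}+\|\bar D_{\Delta t}\phi_h\|_{\ell^2(L^2)}\le\bar c_\ddagger\big(\|\phi_h^0\|_{H^1(\Omega)}+\|F\|_{\ell^2(L^2)}\big).$$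
   Context: Setting: $d\in\{1,2,3\}$, $\Omega\subset\mathbb R^d$ a bounded polyhedral domain with boundary $\Gamma$, $T>0$, $\nu\in(0,1]$. $(\cdot,\cdot)$ and $\|\cdot\|$ denote the $L^2(\Omega)$ inner product and norm; $\Psi:=H^1(\Omega)$ and $a_0(\phi,\psi):=\nu(\nabla\phi,\nabla\psi)$. The velocity satisfies $u\in C([0,T];W^{1,\infty}_0(\Omega)^d)$; $|u|_{C(W^{1,\infty})}:=\max_{t\in[0,T]}|u(t)|_{W^{1,\infty}(\Omega)}$ (first-derivative seminorm) and $\|u\|_{C(W^{1,\infty})}$ the corresponding full norm. For $\Delta t>0$ let $t^n=n\Delta t$, $N_T=\lfloor T/\Delta t\rfloor$, and $\rho^n=\rho(\cdot,t^n)$ for a time-dependent function $\rho$. Define $X_1^n(x)=x-u^n(x)\Delta t$, $\tilde X_1^n(x)=x-2u^n(x)\Delta t$, and their Jacobians $\gamma^n=\det(\partial X_1^n/\partial x)$, $\tilde\gamma^n=\det(\partial\tilde X_1^n/\partial x)$. Let $\mathcal T_h$ be a triangulation of $\Omega$ with $\mathrm{int}(\bigcup_{K\in\mathcal T_h}K)=\Omega$, $h=\max_K\mathrm{diam}(K)$, $k\in\mathbb N$, and $\Psi_h=\{\psi_h\in C(\bar\Omega):\psi_h|_K\in P_k(K)\ \forall K\in\mathcal T_h\}$. Given $F\in H^1(0,T;\Psi')$ and $\phi_h^0\in\Psi_h$, the scheme is: find $\phi_h^n\in\Psi_h$, $n=1,\dots,N_T$, such that for all $\psi_h\in\Psi_h$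 (S1) $n=1$: $\big(\frac{\phi_h^1-\phi_h^0\circ X_1^1\,\gamma^1}{\Delta t},\psi_h\big)+a_0(\phi_h^1,\psi_h)=\langle F^1,\psi_h\rangle$; (S2) $n\ge2$: $\big(\frac{3\phi_h^n-4\phi_h^{n-1}\circ X_1^n\,\gamma^n+\phi_h^{n-2}\circ\tilde X_1^n\,\tilde\gamma^n}{2\Delta t},\psi_h\big)+a_0(\phi_h^n,\psi_h)=\langle F^n,\psi_h\rangle$. Discrete norms and operators: $\bar D_{\Delta t}\rho^1:=(\rho^1-\rho^0)/\Delta t$ and $\bar D_{\Delta t}\rho^n:=(3\rho^n-4\rho^{n-1}+\rho^{n-2})/(2\Delta t)$ for $n\ge2$. For a normed space $Y$ and $m\in\{0,\dots,N_T\}$, $\|\rho\|_{\ell^\infty_m(Y)}:=\max_{m\le n\le N_T}\|\rho^n\|_Y$, $\|\rho\|_{\ell^2_m(Y)}:=(\Delta t\sum_{n=m}^{N_T}\|\rho^n\|_Y^2)^{1/2}$, $\ell^\infty(Y):=\ell^\infty_1(Y)$, $\ell^2(Y):=\ell^2_1(Y)$ (the same notation is used for vector-valued sequences such as $\nabla\rho$). $\Psi_h'$ is the dual of $\Psi_h$ equipped with the $H^1(\Omega)$ norm. *)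

theory Defs
  imports "HOL-Analysis.Analysis" "HOL-Probability.Essential_Supremum"
begin

definition d_simplex :: "(real^'d) set \<Rightarrow> bool" where
  "d_simplex K \<longleftrightarrow> (\<exists>V. finite V \<and> card V = CARD('d) + 1 \<and> \<not> affine_dependent V \<and> K = convex hull V)"

definition simplex_vertices :: "(real^'d) set \<Rightarrow> (real^'d) set" where
  "simplex_vertices K = {x. x extreme_point_of K}"

text \<open>Conforming triangulation: finite set of d-simplices, two of which meet in a common
  (possibly empty) face, i.e. the convex hull of their common vertices.\<close>
definition triangulation :: "(real^'d) set set \<Rightarrow> bool" where
  "triangulation Th \<longleftrightarrow> finite Th \<and> (\<forall>K\<in>Th. d_simplex K) \<and>
     (\<forall>K\<in>Th. \<forall>K'\<in>Th. K \<inter> K' = convex hull (simplex_vertices K \<inter> simplex_vertices K'))"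

definition poly_domain_triang :: "(real^'d) set \<Rightarrow> (real^'d) set set \<Rightarrow> bool" where
  "poly_domain_triang \<Omega> Th \<longleftrightarrow> open \<Omega> \<and> connected \<Omega> \<and> \<Omega> \<noteq> {} \<and> bounded \<Omega> \<and>
     triangulation Th \<and> interior (\<Union>Th) = \<Omega>"

definition mesh_size :: "(real^'d) set set \<Rightarrow> real" where
  "mesh_size Th = Max (diameter ` Th)"

definition poly_le :: "nat \<Rightarrow> (real^'d \<Rightarrow> real) \<Rightarrow> bool" where
  "poly_le k p \<longleftrightarrow> (\<exists>c :: ('d \<Rightarrow> nat) \<Rightarrow> real.
      p = (\<lambda>x. \<Sum>\<alpha>\<in>{\<alpha>::'d\<Rightarrow>nat. (\<Sum>i\<in>UNIV. \<alpha> i) \<le> k}. c \<alpha> * (\<Prod>i\<in>UNIV. (x$i) ^ (\<alpha> i))))"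

text \<open>Psi_h: continuous on closure \<Omega>, P_k on every element; functions are normalised
  to vanish outside closure \<Omega> (only their values on closure \<Omega> matter).\<close>
definition Psi_h :: "(real^'d) set \<Rightarrow> (real^'d) set set \<Rightarrow> nat \<Rightarrow> (real^'d \<Rightarrow> real) set" where
  "Psi_h \<Omega> Th k = {\<psi>. continuous_on (closure \<Omega>) \<psi> \<and> (\<forall>x. x \<notin> closure \<Omega> \<longrightarrow> \<psi> x = 0) \<and>
      (\<forall>K\<in>Th. \<exists>p. poly_le k p \<and> (\<forall>x\<in>K. \<psi> x = p x))}"

definition jac :: "(real^'d \<Rightarrow> real^'d) \<Rightarrow> real^'d \<Rightarrow> real^'d^'d" where
  "jac f x = matrix (frechet_derivative f (at x))"

definition grad :: "(real^'d \<Rightarrow> real) \<Rightarrow> real^'d \<Rightarrow> real^'d" where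
  "grad f x = (\<chi> j. frechet_derivative f (at x) (axis j 1))"

definition L2ip :: "(real^'d) set \<Rightarrow> (real^'d \<Rightarrow> real) \<Rightarrow> (real^'d \<Rightarrow> real) \<Rightarrow> real" where
  "L2ip \<Omega> f g = set_lebesgue_integral lebesgue \<Omega> (\<lambda>x. f x * g x)"

definition L2norm :: "(real^'d) set \<Rightarrow> (real^'d \<Rightarrow> real) \<Rightarrow> real" where
  "L2norm \<Omega> f = sqrt (set_lebesgue_integral lebesgue \<Omega> (\<lambda>x. (f x)\<^sup>2))"

definition grad_L2norm :: "(real^'d) set \<Rightarrow> (real^'d \<Rightarrow> real) \<Rightarrow> real" where
  "grad_L2norm \<Omega> f = sqrt (set_lebesgue_integral lebesgue \<Omega> (\<lambda>x. (norm (grad f x))\<^sup>2))"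

definition H1norm :: "(real^'d) set \<Rightarrow> (real^'d \<Rightarrow> real) \<Rightarrow> real" where
  "H1norm \<Omega> f = sqrt ((L2norm \<Omega> f)\<^sup>2 + (grad_L2norm \<Omega> f)\<^sup>2)"

definition a0 :: "real \<Rightarrow> (real^'d) set \<Rightarrow> (real^'d \<Rightarrow> real) \<Rightarrow> (real^'d \<Rightarrow> real) \<Rightarrow> real" where
  "a0 \<nu> \<Omega> f g = \<nu> * set_lebesgue_integral lebesgue \<Omega> (\<lambda>x. grad f x \<bullet> grad g x)"

definition dual_norm_h :: "(real^'d) set \<Rightarrow> (real^'d \<Rightarrow> real) set \<Rightarrow> ((real^'d \<Rightarrow> real) \<Rightarrow> real) \<Rightarrow> real" where
  "dual_norm_h \<Omega> V G = Sup (insert 0 {\<bar>G \<psi>\<bar> / H1norm \<Omega> \<psi> | \<psi>. \<psi> \<in> V \<and> \<psi> \<noteq> (\<lambda>x. 0)})"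

definition linear_on :: "(real^'d \<Rightarrow> real) set \<Rightarrow> ((real^'d \<Rightarrow> real) \<Rightarrow> real) \<Rightarrow> bool" where
  "linear_on V G \<longleftrightarrow> (\<forall>\<phi>\<in>V. \<forall>\<psi>\<in>V. \<forall>a b. G (\<lambda>x. a * \<phi> x + b * \<psi> x) = a * G \<phi> + b * G \<psi>)"

definition W1inf_semi :: "(real^'d) set \<Rightarrow> (real^'d \<Rightarrow> real^'d) \<Rightarrow> ereal" where
  "W1inf_semi \<Omega> v = (SUP p\<in>(UNIV::('d\<times>'d) set).
       esssup (restrict_space lebesgue \<Omega>) (\<lambda>x. ereal \<bar>jac v x $ fst p $ snd p\<bar>))"

definition W1inf_norm :: "(real^'d) set \<Rightarrow> (real^'d \<Rightarrow> real^'d) \<Rightarrow> ereal" where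
  "W1inf_norm \<Omega> v = max (SUP i\<in>(UNIV::'d set).
       esssup (restrict_space lebesgue \<Omega>) (\<lambda>x. ereal \<bar>v x $ i\<bar>)) (W1inf_semi \<Omega> v)"

definition C_W1inf_semi :: "(real^'d) set \<Rightarrow> real \<Rightarrow> (real \<Rightarrow> real^'d \<Rightarrow> real^'d) \<Rightarrow> ereal" where
  "C_W1inf_semi \<Omega> T u = (SUP t\<in>{0..T}. W1inf_semi \<Omega> (u t))"

definition C_W1inf_norm :: "(real^'d) set \<Rightarrow> real \<Rightarrow> (real \<Rightarrow> real^'d \<Rightarrow> real^'d) \<Rightarrow> ereal" where
  "C_W1inf_norm \<Omega> T u = (SUP t\<in>{0..T}. W1inf_norm \<Omega> (u t))"

text \<open>u \<in> C([0,T]; W^{1,\<infinity>}_0(\<Omega>)^d): for each t, u(t) is Lipschitz, vanishes outside \<Omega>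
  (zero boundary values), and t \<mapsto> u(t) is continuous in the W^{1,\<infinity>} norm.\<close>
definition velocity_field :: "(real^'d) set \<Rightarrow> real \<Rightarrow> (real \<Rightarrow> real^'d \<Rightarrow> real^'d) \<Rightarrow> bool" where
  "velocity_field \<Omega> T u \<longleftrightarrow>
     (\<forall>t\<in>{0..T}. (\<exists>L. L-lipschitz_on UNIV (u t)) \<and> (\<forall>x. x \<notin> \<Omega> \<longrightarrow> u t x = 0)) \<and>
     (\<forall>t\<in>{0..T}. \<forall>\<epsilon>>0. \<exists>\<delta>>0. \<forall>s\<in>{0..T}. \<bar>s - t\<bar> < \<delta> \<longrightarrow>
         W1inf_norm \<Omega> (\<lambda>x. u s x - u t x) < ereal \<epsilon>)"

definition X1 :: "(real \<Rightarrow> real^'d \<Rightarrow> real^'d) \<Rightarrow> real \<Rightarrow> nat \<Rightarrow> real^'d \<Rightarrow> real^'d" where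
  "X1 u dt n x = x - dt *\<^sub>R u (real n * dt) x"

definition X1t :: "(real \<Rightarrow> real^'d \<Rightarrow> real^'d) \<Rightarrow> real \<Rightarrow> nat \<Rightarrow> real^'d \<Rightarrow> real^'d" where
  "X1t u dt n x = x - (2 * dt) *\<^sub>R u (real n * dt) x"

definition gam :: "(real \<Rightarrow> real^'d \<Rightarrow> real^'d) \<Rightarrow> real \<Rightarrow> nat \<Rightarrow> real^'d \<Rightarrow> real" where
  "gam u dt n x = det (jac (X1 u dt n) x)"

definition gamt :: "(real \<Rightarrow> real^'d \<Rightarrow> real^'d) \<Rightarrow> real \<Rightarrow> nat \<Rightarrow> real^'d \<Rightarrow> real" where
  "gamt u dt n x = det (jac (X1t u dt n) x)"

definition N_T :: "real \<Rightarrow> real \<Rightarrow> nat" where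
  "N_T T dt = nat \<lfloor>T / dt\<rfloor>"

definition solves_scheme ::
  "(real^'d) set \<Rightarrow> (real^'d \<Rightarrow> real) set \<Rightarrow> real \<Rightarrow> (real \<Rightarrow> real^'d \<Rightarrow> real^'d) \<Rightarrow> real \<Rightarrow> nat
   \<Rightarrow> (nat \<Rightarrow> (real^'d \<Rightarrow> real) \<Rightarrow> real) \<Rightarrow> (nat \<Rightarrow> real^'d \<Rightarrow> real) \<Rightarrow> bool" where
  "solves_scheme \<Omega> V \<nu> u dt N Fn \<phi> \<longleftrightarrow>
     (\<forall>n\<in>{1..N}. \<phi> n \<in> V) \<and>
     (1 \<le> N \<longrightarrow> (\<forall>\<psi>\<in>V.
        L2ip \<Omega> (\<lambda>x. (\<phi> 1 x - \<phi> 0 (X1 u dt 1 x) * gam u dt 1 x) / dt) \<psi> + a0 \<nu> \<Omega> (\<phi> 1) \<psi>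
          = Fn 1 \<psi>)) \<and>
     (\<forall>n\<in>{2..N}. \<forall>\<psi>\<in>V.
        L2ip \<Omega> (\<lambda>x. (3 * \<phi> n x - 4 * \<phi> (n-1) (X1 u dt n x) * gam u dt n x
                       + \<phi> (n-2) (X1t u dt n x) * gamt u dt n x) / (2 * dt)) \<psi>
          + a0 \<nu> \<Omega> (\<phi> n) \<psi> = Fn n \<psi>)"

definition Dbar :: "real \<Rightarrow> (nat \<Rightarrow> real^'d \<Rightarrow> real) \<Rightarrow> nat \<Rightarrow> real^'d \<Rightarrow> real" where
  "Dbar dt \<rho> n x = (if n = 1 then (\<rho> 1 x - \<rho> 0 x) / dt
                     else (3 * \<rho> n x - 4 * \<rho> (n-1) x + \<rho> (n-2) x) / (2 * dt))"

text \<open>l^infty_1(Y) and l^2_1(Y) norms of a sequence of nonnegative Y-norms a n, n=1..N.\<close>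
definition linf1 :: "nat \<Rightarrow> (nat \<Rightarrow> real) \<Rightarrow> real" where
  "linf1 N a = Max (insert 0 (a ` {1..N}))"

definition l21 :: "real \<Rightarrow> nat \<Rightarrow> (nat \<Rightarrow> real) \<Rightarrow> real" where
  "l21 dt N a = sqrt (dt * (\<Sum>n=1..N. (a n)\<^sup>2))"

end

theory Submission
  imports Defs
begin

text \<open>
  The characteristics \<open>x - s u(x)\<close> with \<open>s \<le> 2 dt\<close> expand distances at least by \<open>1/4\<close> and stay in \<open>\<Omega>\<close>, so
  composition with them is bounded in \<open>L\<^sup>2\<close> (an expanding map shrinks volumes at most by a constant)
  and, integrating along characteristics, \<open>\<phi> - \<phi> \<circ> X \<gamma>\<close> is \<open>O(dt)\<close> in \<open>L\<^sup>2\<close> for \<open>\<phi> \<in> H\<^sup>1\<close>; no change of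
  variables with a Jacobian is needed. Since \<open>u\<close> is merely Lipschitz, Rademacher's theorem gives a
  meaning to \<open>\<gamma>\<close> and turns the bound on the derivative into a Lipschitz constant.

  The scheme then is BDF2 for the undisplaced functions with a transport error \<open>w\<close> that is both
  \<open>O(dt)\<close> in terms of \<open>H\<^sup>1\<close> norms and \<open>O(1)\<close> in terms of \<open>L\<^sup>2\<close> norms of the two previous steps. In the
  energy estimate (G-stability of BDF2) the new step \<open>\<phi>\<^sup>n\<close> in \<open>(w, \<phi>\<^sup>n)\<close> is replaced by the
  second difference, which the numerical dissipation absorbs, plus older steps; interpolating the two
  bounds on \<open>w\<close> gives \<open>|w|\<^sup>2 = O(dt)\<close>, so Gronwall's inequality applies without any smallness of \<open>dt\<close>
  relative to \<open>\<nu>\<close>. Part (ii) follows by testing with the discrete time derivative and using part (i).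
\<close>

section \<open>Density points and expanding maps\<close>

text \<open>Two obstacles shape the energy estimate, both due to the fact that only
  \<open>dt < 1\<close> is available and \<open>dt\<close> may be large against
  \<open>\<nu>\<close>. Young's inequality applied directly to the product of the transport error
  with the new step leaves \<open>dt * (L + L^2 / \<nu>)\<close> times the squared norm of the new
  step on the right; absorbing it would need \<open>dt\<close> small against \<open>\<nu>\<close>.
  Splitting the new step into second difference and extrapolation leaves only older levels with such
  a factor. The second difference then produces \<open>w^2\<close>, and the bound of order
  \<open>dt\<close> alone would give \<open>dt^2\<close> times a squared gradient, again absorbable
  only for small \<open>dt / \<nu>\<close>. The product of the two bounds on \<open>w\<close>
  contains the gradient to the first power only, so that a weight as small as \<open>\<nu>\<close>
  can be put on its square. On the geometric side, a one-sided density theorem obtained from Vitali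
  coverings serves twice: for differentiating integrals on the line and for passing from partial to
  total derivatives.\<close>

lemma small_density_negligible_bounded:
  fixes A S :: "'a::euclidean_space set"
  assumes A: "A \<in> sets lebesgue" and "S \<subseteq> A" and "bounded S" and c: "0 < c" "c < 1"
    and dens: "\<And>x d. x \<in> S \<Longrightarrow> 0 < d \<Longrightarrow>
      \<exists>r. 0 < r \<and> r < d \<and> measure lebesgue (A \<inter> cball x r) \<le> (1 - c) * measure lebesgue (cball x r)"
  shows "negligible S"
proof -
  let ?\<mu> = "measure lebesgue"
  have Am: "A \<inter> cball x r \<in> lmeasurable" for x r
    using A fmeasurable_Int_fmeasurable[OF lmeasurable_cball, of A x r] by (simp add: Int_commute)
  \<comment> \<open>One contraction of an outer cover. An open \<open>G\<close> around
    \<open>U\<close> has measure at most \<open>(1 + c/2) v\<close>. Disjoint low-density balls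
    inside \<open>G\<close> cover \<open>S\<close> up to a null set, and as \<open>S\<close> lies in
    \<open>A\<close> only their intersections with \<open>A\<close> are kept; these have total
    measure at most \<open>(1 - c) (1 + c/2) v \<le> (1 - c/2) v\<close>. A positive upper bound
    \<open>v\<close> replaces the measure of \<open>U\<close>, which may be 0, to leave room for
    \<open>G\<close>.\<close>
  have step: "\<exists>U'. S \<subseteq> U' \<and> U' \<in> lmeasurable \<and> ?\<mu> U' \<le> (1 - c/2) * v"
    if U: "S \<subseteq> U" "U \<in> lmeasurable" "?\<mu> U \<le> v" "0 < v" for U v
  proof -
    have "0 < v * c / 2" using U c by simp
    then obtain G where G: "open G" "U \<subseteq> G" "G - U \<in> lmeasurable"
        "emeasure lebesgue (G - U) < ennreal (v * c / 2)"
      by (rule sets_lebesgue_outer_open[OF fmeasurableD[OF U(2)]])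
    have GU: "G = U \<union> (G - U)" using G by auto
    have Gm: "G \<in> lmeasurable"
      by (subst GU) (rule fmeasurable.Un[OF U(2) G(3)])
    have "?\<mu> (G - U) < v * c / 2"
      using G(3,4) \<open>0 < v * c / 2\<close> by (simp add: emeasure_eq_measure2 ennreal_less_iff)
    moreover have "?\<mu> G = ?\<mu> U + ?\<mu> (G - U)"
      using measure_Un2[OF U(2) Gm] G(2) by (simp add: sup.absorb2)
    ultimately have Gv: "?\<mu> G \<le> v * (1 + c/2)"
      using U by (simp add: algebra_simps)
    let ?K = "{(x,r). x \<in> S \<and> 0 < r \<and> cball x r \<subseteq> G \<and> ?\<mu> (A \<inter> cball x r) \<le> (1 - c) * ?\<mu> (cball x r)}"
    obtain C where C: "countable C" "C \<subseteq> ?K"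
      and pw: "pairwise (\<lambda>i j. disjnt (cball (fst i) (snd i)) (cball (fst j) (snd j))) C"
      and neg: "negligible (S - (\<Union>i\<in>C. cball (fst i) (snd i)))"
    proof (rule Vitali_covering_theorem_cballs[of ?K snd S fst])
      fix x d assume x: "x \<in> S" and d: "(0::real) < d"
      then obtain e where e: "e > 0" "cball x e \<subseteq> G"
        using G(1,2) U(1) x unfolding open_contains_cball by blast
      obtain r where r: "0 < r" "r < min d e" "?\<mu> (A \<inter> cball x r) \<le> (1 - c) * ?\<mu> (cball x r)"
        using dens[OF x, of "min d e"] d e by auto
      moreover have "cball x r \<subseteq> G"
        using r(2) by (intro order_trans[OF subset_cball e(2)]) auto
      ultimately show "\<exists>i. i \<in> ?K \<and> x \<in> cball (fst i) (snd i) \<and> snd i < d"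
        using x by (intro exI[of _ "(x,r)"]) auto
    next
      fix i assume "i \<in> ?K" then show "0 < snd i" by auto
    qed
    let ?V = "\<lambda>i. A \<inter> cball (fst i) (snd i)"
    have bound: "?\<mu> (\<Union>i\<in>I. ?V i) \<le> (1 - c) * (v * (1 + c/2))" if I: "I \<subseteq> C" "finite I" for I
    proof -
      have "?\<mu> (\<Union>i\<in>I. ?V i) \<le> (\<Sum>i\<in>I. ?\<mu> (?V i))"
        using I Am by (intro measure_UNION_le) (auto intro: fmeasurableD)
      also have "\<dots> \<le> (\<Sum>i\<in>I. (1 - c) * ?\<mu> (cball (fst i) (snd i)))"
        using I C(2) by (intro sum_mono) auto
      also have "\<dots> = (1 - c) * ?\<mu> (\<Union>i\<in>I. cball (fst i) (snd i))"
        using I pw by (subst measure_UNION') (auto simp: sum_distrib_left elim: pairwise_mono)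
      also have "?\<mu> (\<Union>i\<in>I. cball (fst i) (snd i)) \<le> ?\<mu> G"
      proof (intro measure_mono_fmeasurable Gm)
        show "(\<Union>i\<in>I. cball (fst i) (snd i)) \<subseteq> G" using I(1) C(2) by fastforce
      qed (use I in \<open>auto intro!: sets.finite_UN\<close>)
      finally show ?thesis using Gv c by (meson diff_ge_0_iff_ge less_imp_le mult_left_mono order_trans)
    qed
    have W: "(\<Union>i\<in>C. ?V i) \<in> lmeasurable" "?\<mu> (\<Union>i\<in>C. ?V i) \<le> (1 - c) * (v * (1 + c/2))"
      using fmeasurable_UN_bound[OF C(1), of ?V lebesgue, OF Am bound]
        measure_UN_bound[OF C(1), of ?V lebesgue, OF Am bound] by blast+
    have "(1 - c) * (v * (1 + c/2)) \<le> (1 - c/2) * v"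
      using U(4) c by (simp add: algebra_simps)
    let ?U' = "(S - (\<Union>i\<in>C. cball (fst i) (snd i))) \<union> (\<Union>i\<in>C. ?V i)"
    have "?\<mu> ?U' = ?\<mu> (\<Union>i\<in>C. ?V i)"
      by (rule measure_negligible_symdiff[OF W(1)]) (force intro!: negligible_subset[OF neg])
    moreover have "?U' \<in> lmeasurable"
      using neg W by (simp add: fmeasurable.Un negligible_imp_measurable)
    moreover have "S \<subseteq> ?U'" using \<open>S \<subseteq> A\<close> by auto
    moreover have "?\<mu> (\<Union>i\<in>C. ?V i) \<le> (1 - c/2) * v"
      by (rule order_trans[OF W(2)]) fact
    ultimately show ?thesis by (intro exI[of _ ?U'] conjI) simp_all
  qed
  obtain B where B: "S \<subseteq> cball 0 B" using \<open>bounded S\<close> by (auto simp: bounded_iff subset_iff)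
  define v where "v = ?\<mu> (cball (0::'a) B) + 1"
  have v: "0 < v" unfolding v_def by (simp add: add_nonneg_pos)
  have "\<exists>U. S \<subseteq> U \<and> U \<in> lmeasurable \<and> ?\<mu> U \<le> (1 - c/2)^n * v" for n
  proof (induction n)
    case 0
    show ?case using B by (intro exI[of _ "cball 0 B"]) (auto simp: v_def)
  next
    case (Suc n)
    then obtain U where U: "S \<subseteq> U" "U \<in> lmeasurable" "?\<mu> U \<le> (1 - c/2)^n * v" by blast
    have "0 < (1 - c/2)^n * v" using v c by simp
    from step[OF U this] show ?case by (simp add: mult.assoc)
  qed
  moreover have "(\<lambda>n. (1 - c/2)^n * v) \<longlonglongrightarrow> 0"
    using c by (intro tendsto_mult_left_zero LIMSEQ_realpow_zero) auto
  ultimately show ?thesis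
    unfolding negligible_outer_le
  proof (intro allI impI)
    fix e :: real assume "0 < e"
    from order_tendstoD(2)[OF \<open>(\<lambda>n. (1 - c/2)^n * v) \<longlonglongrightarrow> 0\<close> this]
    obtain n where n: "(1 - c/2)^n * v < e" unfolding eventually_sequentially by blast
    obtain U where "S \<subseteq> U" "U \<in> lmeasurable" "?\<mu> U \<le> (1 - c/2)^n * v"
      using \<open>\<And>n. \<exists>U. S \<subseteq> U \<and> U \<in> lmeasurable \<and> ?\<mu> U \<le> (1 - c/2)^n * v\<close> by blast
    with n show "\<exists>T. S \<subseteq> T \<and> T \<in> lmeasurable \<and> ?\<mu> T \<le> e" by (intro exI[of _ U]) auto
  qed
qed

text \<open>One half of Lebesgue's density theorem: almost every point of \<open>A\<close> has
  density above \<open>1 - c\<close> in all small balls. Lowering \<open>c\<close> below 1 only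
  enlarges the exceptional set, and balls of integer radius reduce the claim to bounded
  pieces.\<close>

lemma small_density_negligible:
  fixes A :: "'a::euclidean_space set"
  assumes A: "A \<in> sets lebesgue" and c: "0 < c"
  shows "negligible {x \<in> A. \<forall>d>0. \<exists>r. 0 < r \<and> r < d \<and>
      measure lebesgue (A \<inter> cball x r) \<le> (1 - c) * measure lebesgue (cball x r)}" (is "negligible ?S")
proof -
  define c' where "c' = min c (1/2)"
  have c': "0 < c'" "c' < 1" "c' \<le> c" using c by (auto simp: c'_def)
  have "negligible (?S \<inter> ball 0 (real n))" for n
  proof (rule small_density_negligible_bounded[OF A _ _ c'(1,2)])
    fix x d assume "x \<in> ?S \<inter> ball 0 (real n)" "0 < (d::real)"
    then obtain r where r: "0 < r" "r < d" "measure lebesgue (A \<inter> cball x r) \<le> (1 - c) * measure lebesgue (cball x r)"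
      by blast
    have "(1 - c) * measure lebesgue (cball x r) \<le> (1 - c') * measure lebesgue (cball x r)"
      using c' by (intro mult_right_mono) auto
    with r show "\<exists>r. 0 < r \<and> r < d \<and> measure lebesgue (A \<inter> cball x r) \<le> (1 - c') * measure lebesgue (cball x r)"
      using order_trans by blast
  qed auto
  then have "negligible (\<Union>n. ?S \<inter> ball 0 (real n))"
    by (intro negligible_countable_Union) auto
  moreover have "(\<Union>n. ?S \<inter> ball 0 (real n)) = ?S"
    by (auto simp: reals_Archimedean2)
  ultimately show ?thesis by simp
qed

section \<open>Volume distortion under expanding maps\<close>

text \<open>The preimage of a ball of radius \<open>r\<close> has diameter at most
  \<open>2 * r / c\<close>, hence lies in a ball of that radius about one of its own points. The
  factor 2 arises because the centre of the given ball may lie outside the range of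
  \<open>X\<close>. Vitali's theorem leads from balls to open sets, outer regularity to Borel
  sets.\<close>

lemma emeasure_vimage_expanding_le:
  fixes X :: "'a::euclidean_space \<Rightarrow> 'a"
  assumes X[measurable]: "X \<in> borel_measurable borel" and c: "0 < c"
    and ex: "\<And>x y. c * dist x y \<le> dist (X x) (X y)"
    and E[measurable]: "E \<in> sets borel"
  shows "emeasure lborel (X -` E) \<le> ennreal ((2/c) ^ DIM('a)) * emeasure lborel E"
proof -
  have Xm: "X -` B \<in> sets borel" if "B \<in> sets borel" for B
    using measurable_sets[OF X that] by simp
  have inj: "inj X"
  proof (rule injI)
    fix x y assume "X x = X y"
    with ex[of x y] c show "x = y" by (auto simp: mult_le_0_iff)
  qed
  let ?C = "ennreal ((2/c) ^ DIM('a))"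
  \<comment> \<open>Vitali's theorem covers only up to a null set, so preimages of null sets must be
    null: on the range of \<open>X\<close> the inverse is Lipschitz with constant
    \<open>1/c\<close>.\<close>
  have null: "emeasure lborel (X -` N) = 0" if N: "N \<in> sets borel" "negligible N" for N
  proof -
    have "X -` N = inv X ` (N \<inter> range X)" using inj by (force simp: image_iff)
    moreover have "negligible (inv X ` (N \<inter> range X))"
    proof (rule negligible_locally_Lipschitz_image)
      show "negligible (N \<inter> range X)" using N by (simp add: negligible_Int)
      fix x assume "x \<in> N \<inter> range X"
      then obtain x' where x': "x = X x'" by auto
      have "norm (inv X y - inv X x) \<le> (1/c) * norm (y - x)" if "y \<in> N \<inter> range X" for y
      proof -
        obtain y' where "y = X y'" using \<open>y \<in> N \<inter> range X\<close> by blast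
        then show ?thesis using ex[of y' x'] c inj x' by (simp add: dist_norm field_simps)
      qed
      then show "\<exists>T B. open T \<and> x \<in> T \<and> (\<forall>y\<in>N \<inter> range X \<inter> T. norm (inv X y - inv X x) \<le> B * norm (y - x))"
        by (intro exI[of _ UNIV] exI[of _ "1/c"]) auto
    qed simp
    ultimately have "negligible (X -` N)" by simp
    then have "emeasure lebesgue (X -` N) = 0"
      by (simp add: negligible_iff_null_sets null_setsD1)
    then show ?thesis using Xm[OF N(1)] by simp
  qed
  have ball: "emeasure lborel (X -` cball a r) \<le> ?C * emeasure lborel (cball a r)" if "r > 0" for a r
  proof (cases "X -` cball a r = {}")
    case False
    then obtain b where b: "X b \<in> cball a r" by auto
    have "X -` cball a r \<subseteq> cball b (2*r/c)"
    proof
      fix x assume "x \<in> X -` cball a r"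
      then have "dist (X b) (X x) \<le> 2*r" using b dist_triangle3[of "X b" "X x" a] by (auto simp: dist_commute)
      with ex[of b x] c show "x \<in> cball b (2*r/c)" by (simp add: field_simps)
    qed
    then have "emeasure lborel (X -` cball a r) \<le> emeasure lborel (cball b (2*r/c))"
      by (intro emeasure_mono) auto
    also have "\<dots> = ?C * emeasure lborel (cball a r)"
      using that c by (simp add: emeasure_cball power_mult_distrib power_divide mult_ac flip: ennreal_mult)
    finally show ?thesis .
  qed simp
  have opn: "emeasure lborel (X -` U) \<le> ?C * emeasure lborel U" if U: "open U" for U
  proof -
    let ?K = "{(x,r). 0 < r \<and> cball x r \<subseteq> U}"
    obtain C where C: "countable C" "C \<subseteq> ?K"
      and pw: "pairwise (\<lambda>i j. disjnt (cball (fst i) (snd i)) (cball (fst j) (snd j))) C"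
      and neg: "negligible (U - (\<Union>i\<in>C. cball (fst i) (snd i)))"
    proof (rule Vitali_covering_theorem_cballs[of ?K snd U fst])
      fix x d assume x: "x \<in> U" and d: "(0::real) < d"
      then obtain e where e: "e > 0" "cball x e \<subseteq> U"
        using U unfolding open_contains_cball by blast
      have "cball x (min e (d/2)) \<subseteq> U" by (intro order_trans[OF subset_cball e(2)]) auto
      then show "\<exists>i. i \<in> ?K \<and> x \<in> cball (fst i) (snd i) \<and> snd i < d"
        using e d by (intro exI[of _ "(x, min e (d/2))"]) auto
    next
      fix i assume "i \<in> ?K" then show "0 < snd i" by auto
    qed
    let ?B = "\<lambda>i. cball (fst i) (snd i)"
    have Um[measurable]: "U \<in> sets borel" using U by simp
    have BU[measurable]: "(\<Union>i\<in>C. ?B i) \<in> sets borel" using C(1) by (intro sets.countable_UN') auto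
    have dis: "disjoint_family_on ?B C"
      using pw by (auto simp: disjoint_family_on_def pairwise_def disjnt_def)
    have disX: "disjoint_family_on (\<lambda>i. X -` ?B i) C"
      using dis unfolding disjoint_family_on_def by blast
    have "emeasure lborel (X -` U) \<le> emeasure lborel (X -` (U - (\<Union>i\<in>C. ?B i)) \<union> X -` (\<Union>i\<in>C. ?B i))"
      by (intro emeasure_mono) (auto intro!: Xm sets.Un)
    also have "\<dots> \<le> emeasure lborel (X -` (U - (\<Union>i\<in>C. ?B i))) + emeasure lborel (X -` (\<Union>i\<in>C. ?B i))"
      by (intro emeasure_subadditive) (auto intro!: Xm)
    also have "emeasure lborel (X -` (U - (\<Union>i\<in>C. ?B i))) = 0"
      using neg by (intro null) auto
    also have "X -` (\<Union>i\<in>C. ?B i) = (\<Union>i\<in>C. X -` ?B i)" by auto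
    also have "0 + emeasure lborel (\<Union>i\<in>C. X -` ?B i) = (\<integral>\<^sup>+i. emeasure lborel (X -` ?B i) \<partial>count_space C)"
      using C(1) disX by (simp, intro emeasure_UN_countable) (auto intro!: Xm)
    also have "\<dots> \<le> (\<integral>\<^sup>+i. ?C * emeasure lborel (?B i) \<partial>count_space C)"
      using C(2) by (intro nn_integral_mono ball) auto
    also have "\<dots> = ?C * (\<integral>\<^sup>+i. emeasure lborel (?B i) \<partial>count_space C)"
      by (intro nn_integral_cmult) auto
    also have "(\<integral>\<^sup>+i. emeasure lborel (?B i) \<partial>count_space C) = emeasure lborel (\<Union>i\<in>C. ?B i)"
      using C(1) dis by (intro emeasure_UN_countable[symmetric]) auto
    also have "?C * \<dots> \<le> ?C * emeasure lborel U"
    proof (intro mult_left_mono emeasure_mono)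
      show "(\<Union>i\<in>C. ?B i) \<subseteq> U" using C(2) by fastforce
    qed auto
    finally show ?thesis .
  qed
  show ?thesis
  proof (cases "emeasure lborel E = \<infinity>")
    case True
    \<comment> \<open>The factor must be nonzero here, since 0 times infinity is 0.\<close>
    have "0 < (2/c) ^ DIM('a)" using c by simp
    then have "?C \<noteq> 0" by (simp add: ennreal_eq_0_iff not_le)
    then show ?thesis using True by (simp add: ennreal_mult_top)
  next
    case False
    show ?thesis
    proof (rule ennreal_le_epsilon)
      fix e :: real assume e: "0 < e"
      define e' where "e' = e / (2/c) ^ DIM('a)"
      have e': "0 < e'" using e c by (simp add: e'_def)
      obtain U where U: "open U" "E \<subseteq> U" "emeasure lborel (U - E) < ennreal e'"
        using outer_regular_lborel[of E e'] e' by auto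
      have "emeasure lborel (X -` E) \<le> emeasure lborel (X -` U)"
        using U by (intro emeasure_mono) (auto intro!: Xm)
      also have "\<dots> \<le> ?C * emeasure lborel U" by (rule opn[OF U(1)])
      also have "emeasure lborel U = emeasure lborel (E \<union> (U - E))"
        using U(2) by (simp add: Un_absorb1)
      also have "\<dots> \<le> emeasure lborel E + emeasure lborel (U - E)"
        using U(1) by (intro emeasure_subadditive) auto
      also have "\<dots> \<le> emeasure lborel E + ennreal e'"
        using U(3) by (intro add_left_mono) auto
      finally have "emeasure lborel (X -` E) \<le> ?C * (emeasure lborel E + ennreal e')"
        by (simp add: mult_left_mono)
      also have "\<dots> = ?C * emeasure lborel E + ennreal e"
        using c e e' by (simp add: distrib_left e'_def flip: ennreal_mult)
      finally show "emeasure lborel (X -` E) \<le> ?C * emeasure lborel E + ennreal e" .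
    qed
  qed
qed

text \<open>The set estimate says that the image of \<open>lborel\<close> under \<open>X\<close> is
  dominated by a multiple of \<open>lborel\<close>; integrating against both measures gives the
  claim.\<close>

lemma nn_integral_expanding_le:
  fixes X :: "'a::euclidean_space \<Rightarrow> 'a"
  assumes X[measurable]: "X \<in> borel_measurable borel" and c: "0 < c"
    and ex: "\<And>x y. c * dist x y \<le> dist (X x) (X y)"
    and f[measurable]: "f \<in> borel_measurable borel"
  shows "(\<integral>\<^sup>+x. f (X x) \<partial>lborel) \<le> ennreal ((2/c) ^ DIM('a)) * (\<integral>\<^sup>+x. f x \<partial>lborel)"
proof -
  let ?C = "ennreal ((2/c) ^ DIM('a))"
  have "(\<integral>\<^sup>+x. f (X x) \<partial>lborel) = (\<integral>\<^sup>+x. f x \<partial>distr lborel borel X)"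
    by (subst nn_integral_distr) auto
  also have "\<dots> \<le> (\<integral>\<^sup>+x. f x \<partial>scale_measure ?C lborel)"
  proof (rule nn_integral_mono_measure)
    show "distr lborel borel X \<le> scale_measure ?C lborel"
      using emeasure_vimage_expanding_le[OF X c ex]
      by (subst le_measure) (auto simp: emeasure_distr)
  qed auto
  also have "\<dots> = ?C * (\<integral>\<^sup>+x. f x \<partial>lborel)" by (rule nn_integral_scale_measure) auto
  finally show ?thesis .
qed

section \<open>Lipschitz functions and Rademacher's theorem\<close>

text \<open>Almost every \<open>x\<close> is a density point of some \<open>{q \<le> h \<le> q + 1/(k+1)}\<close> with \<open>q\<close> rational, for every \<open>k\<close>.\<close>

lemma AE_has_derivative_indefinite_integral:
  fixes h H :: "real \<Rightarrow> real"
  assumes h[measurable]: "h \<in> borel_measurable borel" and B: "\<And>x. \<bar>h x\<bar> \<le> B"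
    and H: "\<And>a b. a \<le> b \<Longrightarrow> H b - H a = (LINT x:{a..b}|lborel. h x)"
  shows "AE x in lebesgue. (H has_real_derivative h x) (at x)"
proof -
  define A where "A q k = {x. q \<le> h x \<and> h x \<le> q + 1 / Suc k}" for q :: real and k :: nat
  have Am[measurable]: "A q k \<in> sets borel" for q k unfolding A_def by measurable
  define bad where "bad q k j = {x \<in> A q k. \<forall>d>0. \<exists>r. 0 < r \<and> r < d \<and>
      measure lebesgue (A q k \<inter> cball x r) \<le> (1 - 1 / Suc j) * measure lebesgue (cball x r)}"
    for q :: real and k j :: nat
  have "negligible (bad q k j)" for q k j
    unfolding bad_def by (rule small_density_negligible) auto
  then have "AE x in lebesgue. x \<notin> bad q k j" for q k j
    by (simp add: AE_not_in negligible_iff_null_sets)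
  then have "AE x in lebesgue. \<forall>q\<in>\<rat>. \<forall>k j. x \<notin> bad q k j"
    by (simp add: AE_ball_countable countable_rat AE_all_countable)
  then show ?thesis
  proof eventually_elim
    case (elim x)
    have B0: "0 \<le> B" using B[of x] by simp
    have "\<exists>d>0. \<forall>t. t \<noteq> 0 \<and> \<bar>t\<bar> < d \<longrightarrow> \<bar>(H (x + t) - H x) / t - h x\<bar> < e" if "0 < e" for e
    proof -
      obtain k where k: "1 / Suc k < e / 2" using \<open>0 < e\<close>
        by (metis half_gt_zero inverse_eq_divide reals_Archimedean)
      \<comment> \<open>Over an interval of length \<open>l\<close> near \<open>x\<close>, points of
        \<open>A q k\<close> contribute at most \<open>l / (k+1)\<close> to the error. The other
        points have measure at most \<open>2 * l / (j+1)\<close> and contribute at most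
        \<open>2 * B\<close> each. The choice of \<open>\<eta>\<close> makes
        \<open>4 * B / (j+1)\<close> at most \<open>e / 2\<close>; the summand 1 covers
        \<open>B = 0\<close>.\<close>
      define \<eta> where "\<eta> = e / (2 * (4 * B + 1))"
      have "0 < \<eta>" using \<open>0 < e\<close> B0 by (simp add: \<eta>_def)
      then obtain j where j: "1 / Suc j < \<eta>" by (metis inverse_eq_divide reals_Archimedean)
      obtain q where q: "q \<in> \<rat>" "h x - 1 / Suc k < q" "q < h x"
        using Rats_dense_in_real[of "h x - 1 / Suc k" "h x"] by auto
      have "x \<in> A q k" using q by (simp add: A_def)
      moreover have "x \<notin> bad q k j" using elim q by blast
      ultimately obtain d where d: "0 < d"
        and dens: "\<And>r. 0 < r \<Longrightarrow> r < d \<Longrightarrow>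
          (1 - 1 / Suc j) * measure lebesgue (cball x r) < measure lebesgue (A q k \<inter> cball x r)"
        unfolding bad_def by (auto simp: not_le)
      \<comment> \<open>Requiring only that \<open>{a..b}\<close> lie in the ball of radius
        \<open>b - a\<close> about \<open>x\<close> treats right and left difference quotients
        together, with \<open>a = x\<close> or \<open>b = x\<close>.\<close>
      have main: "\<bar>H b - H a - h x * (b - a)\<bar> < e * (b - a)"
        if ab: "a < b" "{a..b} \<subseteq> cball x (b - a)" "b - a < d" for a b
      proof -
        let ?D = "cball x (b - a) - A q k"
        have "measure lebesgue (cball x (b - a)) = 2 * (b - a)"
          using ab by (simp add: cball_eq_atLeastAtMost)
        moreover have "measure lebesgue ?D = measure lebesgue (cball x (b - a)) - measure lebesgue (A q k \<inter> cball x (b - a))"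
          
        proof -
          have "measure lebesgue (cball x (b - a) - A q k \<inter> cball x (b - a)) =
              measure lebesgue (cball x (b - a)) - measure lebesgue (A q k \<inter> cball x (b - a))"
            by (rule measurable_measure_Diff) auto
          moreover have "cball x (b - a) - A q k \<inter> cball x (b - a) = ?D" by blast
          ultimately show ?thesis by simp
        qed
        moreover have "(1 - 1 / Suc j) * measure lebesgue (cball x (b - a)) < measure lebesgue (A q k \<inter> cball x (b - a))"
          using dens[of "b - a"] ab by auto
        ultimately have "measure lebesgue ?D \<le> 2 * (b - a) * (1 / Suc j)"
          by (simp only: left_diff_distrib) (simp add: mult.commute)
        then have D: "measure lborel ?D \<le> 2 * (b - a) / Suc j" by simp
        have Df: "emeasure lborel ?D < \<infinity>"
          by (rule le_less_trans[OF emeasure_mono[of _ "cball x (b - a)"]])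
            (use emeasure_bounded_finite[of "cball x (b - a)"] in auto)
        have intD: "integrable lborel (indicator ?D :: real \<Rightarrow> real)"
          using Df by (intro integrable_real_indicator) auto
        have int1: "set_integrable lborel {a..b} h"
          unfolding set_integrable_def
          by (rule integrableI_bounded_set_indicator[where B=B]) (use B in \<open>auto simp: emeasure_lborel_Icc_eq\<close>)
        have indab: "integrable lborel (indicat_real {a..b})"
          by (intro integrable_real_indicator) (auto simp: emeasure_lborel_Icc_eq)
        have int2: "set_integrable lborel {a..b} (\<lambda>y. h x)"
          unfolding set_integrable_def using indab by simp
        have int3: "set_integrable lborel {a..b} (\<lambda>y. 1 / Suc k)"
          unfolding set_integrable_def using indab by simp
        have "H b - H a - h x * (b - a) = (LINT y:{a..b}|lborel. h y) - (LINT y:{a..b}|lborel. h x)"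
          using ab by (simp add: H set_lebesgue_integral_def)
        also have "\<dots> = (LINT y:{a..b}|lborel. h y - h x)"
          by (rule set_integral_diff(2)[symmetric, OF int1 int2])
        also have "\<bar>\<dots>\<bar> \<le> (LINT y|lborel. indicator {a..b} y * (1 / Suc k) + 2 * B * indicator ?D y)"
          unfolding set_lebesgue_integral_def
        proof (rule integral_abs_bound[THEN order_trans], rule integral_mono)
          show "integrable lborel (\<lambda>y. \<bar>indicator {a..b} y *\<^sub>R (h y - h x)\<bar>)"
            using set_integral_diff(1)[OF int1 int2] unfolding set_integrable_def
            by (intro integrable_abs) auto
          show "integrable lborel (\<lambda>y. indicator {a..b} y * (1 / Suc k) + 2 * B * indicator ?D y)"
            using int3 intD unfolding set_integrable_def by auto
          fix y
          show "\<bar>indicator {a..b} y *\<^sub>R (h y - h x)\<bar> \<le> indicator {a..b} y * (1 / Suc k) + 2 * B * indicator ?D y"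
          proof (cases "y \<in> {a..b}")
            case True
            then have yc: "y \<in> cball x (b - a)" using ab by blast
            show ?thesis
            proof (cases "y \<in> A q k")
              case True
              then show ?thesis using q \<open>y \<in> {a..b}\<close> \<open>x \<in> A q k\<close> B0 by (auto simp: A_def indicator_def abs_le_iff)
            next
              case False
              have "\<bar>h y - h x\<bar> \<le> 2 * B" using B[of x] B[of y] by linarith
              then show ?thesis using False yc \<open>y \<in> {a..b}\<close> by (simp add: add_increasing)
            qed
          qed (use B0 in simp)
        qed
        also have "\<dots> = (LINT y|lborel. indicator {a..b} y * (1 / Suc k)) + (LINT y|lborel. 2 * B * indicator ?D y)"
          using int3 intD unfolding set_integrable_def by (intro Bochner_Integration.integral_add) auto
        also have "\<dots> = (b - a) / Suc k + 2 * B * measure lborel ?D"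
          using ab by simp
        also have "\<dots> \<le> (b - a) * (1 / Suc k) + (b - a) * (4 * B * (1 / Suc j))"
          using mult_left_mono[OF D, of "2 * B"] B0 by (simp add: algebra_simps)
        also have "\<dots> < (b - a) * (e / 2) + (b - a) * (e / 2)"
        proof (rule add_less_le_mono)
          show "(b - a) * (1 / Suc k) < (b - a) * (e / 2)" using k ab by (intro mult_strict_left_mono) auto
          have "4 * B * (1 / Suc j) \<le> 4 * B * \<eta>" using j B0 by (intro mult_left_mono) auto
          also have "\<dots> \<le> e / 2" using B0 \<open>0 < e\<close> by (simp add: \<eta>_def field_simps)
          finally show "(b - a) * (4 * B * (1 / Suc j)) \<le> (b - a) * (e / 2)"
            using ab by (intro mult_left_mono) auto
        qed
        finally show ?thesis by (simp add: algebra_simps)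
      qed
      have "\<bar>(H (x + t) - H x) / t - h x\<bar> < e" if t: "t \<noteq> 0" "\<bar>t\<bar> < d" for t
      proof (cases "t > 0")
        case True
        have "\<bar>H (x + t) - H x - h x * (x + t - x)\<bar> < e * (x + t - x)"
          using True t by (intro main) (auto simp: cball_eq_atLeastAtMost)
        moreover have "(H (x + t) - H x) / t - h x = (H (x + t) - H x - h x * t) / t"
          using True by (simp add: field_simps)
        ultimately show ?thesis using True by (simp add: abs_divide pos_divide_less_eq)
      next
        case False
        with t have t0: "t < 0" by simp
        have "\<bar>H x - H (x + t) - h x * (x - (x + t))\<bar> < e * (x - (x + t))"
          using t0 t by (intro main) (auto simp: cball_eq_atLeastAtMost)
        moreover have "(H (x + t) - H x) / t - h x = (H x - H (x + t) - h x * (- t)) / (- t)"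
          using t0 by (simp add: field_simps)
        moreover have "\<bar>(H x - H (x + t) - h x * (- t)) / (- t)\<bar> = \<bar>H x - H (x + t) - h x * (- t)\<bar> / (- t)"
          using t0 by simp
        ultimately show ?thesis using t0 by (simp only: pos_divide_less_eq neg_0_less_iff_less) simp
      qed
      then show ?thesis using d by blast
    qed
    then show ?case
      unfolding DERIV_def LIM_def by (simp add: dist_norm)
  qed
qed

text \<open>The function \<open>f(x) + (L+1) x\<close> has an expanding inverse, so the image of Lebesgue measure under
  that inverse has a bounded Radon-Nikodym density.\<close>

lemma lipschitz_real_indefinite_integral:
  fixes f :: "real \<Rightarrow> real"
  assumes f: "L-lipschitz_on UNIV f"
  obtains h B where "h \<in> borel_measurable borel" "\<And>x. \<bar>h x\<bar> \<le> B"
    "\<And>a b. a \<le> b \<Longrightarrow> f b - f a = (LINT x:{a..b}|lborel. h x)"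
proof -
  have L: "0 \<le> L" using f lipschitz_on_nonneg by auto
  have fL: "\<bar>f x - f y\<bar> \<le> L * \<bar>x - y\<bar>" for x y
    using lipschitz_onD[OF f, of x y] by (simp add: dist_real_def)
  \<comment> \<open>The slopes of \<open>g\<close> lie between 1 and \<open>2 * L + 1\<close>, so
    its inverse is 1-Lipschitz and shrinks distances at most by the factor
    \<open>2 * L + 1\<close>.\<close>
  define g where "g x = f x + (L + 1) * x" for x
  have g1: "y - x \<le> g y - g x" and g2: "g y - g x \<le> (2 * L + 1) * (y - x)" if "x \<le> y" for x y
    using fL[of y x] that by (auto simp: g_def algebra_simps abs_le_iff)
  have g1': "\<bar>x - y\<bar> \<le> \<bar>g x - g y\<bar>" for x y
    using g1[of x y] g1[of y x] by linarith
  have g2': "\<bar>g x - g y\<bar> \<le> (2 * L + 1) * \<bar>x - y\<bar>" for x y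
    using g1[of x y] g1[of y x] g2[of x y] g2[of y x] by (cases "x \<le> y") (auto simp: abs_if)
  have cont: "continuous_on S g" for S
    unfolding g_def by (intro continuous_intros) (use lipschitz_on_continuous_on[OF f] in \<open>auto intro: continuous_on_subset\<close>)
  have "inj g" 
  proof (rule injI)
    fix x y assume "g x = g y"
    with g1'[of x y] show "x = y" by simp
  qed
  have "surj g"
    unfolding surj_def
  proof
    fix y
    define b where "b = \<bar>y - g 0\<bar>"
    have "g (- b) \<le> y" "y \<le> g b" using g1[of "-b" 0] g1[of 0 b] by (auto simp: b_def)
    then show "\<exists>x. y = g x" using IVT'[of g "-b" y b] cont by (auto simp: b_def)
  qed
  define k where "k = inv g"
  have gk: "g (k y) = y" and kg: "k (g x) = x" for x y
    using \<open>surj g\<close> \<open>inj g\<close> by (auto simp: k_def surj_f_inv_f)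
  have k1: "\<bar>k x - k y\<bar> \<le> \<bar>x - y\<bar>" for x y using g1'[of "k x" "k y"] by (simp add: gk)
  have k2: "(1 / (2 * L + 1)) * dist x y \<le> dist (k x) (k y)" for x y
    using g2'[of "k x" "k y"] L by (simp add: gk dist_real_def field_simps)
  have km[measurable]: "k \<in> borel_measurable borel"
  proof (rule borel_measurable_continuous_onI)
    have "1-lipschitz_on UNIV k" using k1 by (intro lipschitz_onI) (auto simp: dist_real_def)
    then show "continuous_on UNIV k" by (rule lipschitz_on_continuous_on)
  qed
  define C where "C = 2 * (2 * L + 1)"
  have C: "0 < C" using L by (simp add: C_def)
  \<comment> \<open>This is the Stieltjes measure of \<open>g\<close>: the interval
    \<open>{a..b}\<close> receives the mass \<open>g b - g a\<close>.\<close>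
  define N where "N = distr lborel borel k"
  have N_eq: "emeasure N E = emeasure lborel (k -` E)" if "E \<in> sets borel" for E
    using that by (simp add: N_def emeasure_distr)
  have N_le: "emeasure N E \<le> ennreal C * emeasure lborel E" if "E \<in> sets borel" for E
    using emeasure_vimage_expanding_le[OF km _ k2 that] L N_eq[OF that] by (simp add: C_def)
  have "absolutely_continuous lborel N"
    unfolding absolutely_continuous_def
  proof
    fix E :: "real set" assume "E \<in> null_sets lborel"
    then have "E \<in> sets borel" "emeasure lborel E = 0" by auto
    then show "E \<in> null_sets N" using N_le[of E] by (auto simp: N_def null_sets_def)
  qed
  then obtain \<rho> where \<rho>[measurable]: "\<rho> \<in> borel_measurable borel" and N_dens: "density lborel \<rho> = N"
    using sigma_finite_measure.Radon_Nikodym[OF sigma_finite_lborel, of N] by (auto simp: N_def)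
  have N_int: "emeasure N E = (\<integral>\<^sup>+x. \<rho> x * indicator E x \<partial>lborel)" if "E \<in> sets borel" for E
    using that unfolding N_dens[symmetric] by (simp add: emeasure_density)
  have \<rho>_le: "AE x in lborel. \<rho> x \<le> ennreal C"
  proof -
    \<comment> \<open>On \<open>E n\<close> the density is at least \<open>C + 1/(n+1)\<close>,
      while \<open>N\<close> is at most \<open>C\<close> times Lebesgue measure; both hold only if
      \<open>E n\<close> is null. The cut to a bounded interval keeps the measures finite, so that
      they can be compared as reals.\<close>
    define E where "E n = {x \<in> {- real n..real n}. ennreal (C + 1 / Suc n) \<le> \<rho> x}" for n
    have Em[measurable]: "E n \<in> sets borel" for n unfolding E_def by measurable
    have Efin: "emeasure lborel (E n) < \<infinity>" for n
      by (rule le_less_trans[OF emeasure_mono[of _ "{- real n..real n}"]]) (auto simp: E_def)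
    have "emeasure lborel (E n) = 0" for n
    proof -
      have "ennreal (C + 1 / Suc n) * emeasure lborel (E n) = (\<integral>\<^sup>+x. ennreal (C + 1 / Suc n) * indicator (E n) x \<partial>lborel)"
        by (simp add: nn_integral_cmult_indicator)
      also have "\<dots> \<le> (\<integral>\<^sup>+x. \<rho> x * indicator (E n) x \<partial>lborel)"
        by (intro nn_integral_mono) (auto simp: E_def indicator_def)
      also have "\<dots> \<le> ennreal C * emeasure lborel (E n)"
        using N_le[of "E n"] N_int[of "E n"] by simp
      finally have "ennreal ((C + 1 / Suc n) * measure lborel (E n)) \<le> ennreal (C * measure lborel (E n))"
        using Efin[of n] C by (simp add: emeasure_eq_ennreal_measure less_top ennreal_mult del: ennreal_plus)
      then have "(C + 1 / Suc n) * measure lborel (E n) \<le> C * measure lborel (E n)"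
        using C by (subst (asm) ennreal_le_iff) auto
      then have "measure lborel (E n) \<le> 0" by (simp add: algebra_simps divide_le_0_iff)
      then show ?thesis using Efin[of n] by (simp add: emeasure_eq_ennreal_measure less_top ennreal_neg)
    qed
    then have "AE x in lborel. x \<notin> E n" for n by (intro AE_not_in) (auto simp: null_sets_def)
    then have "AE x in lborel. \<forall>n. x \<notin> E n" by (simp add: AE_all_countable)
    then show ?thesis
    proof eventually_elim
      case (elim x)
      show ?case
      proof (rule ennreal_le_epsilon)
        fix e :: real assume "0 < e"
        obtain n1 where n1: "\<bar>x\<bar> \<le> real n1" using real_arch_simple by blast
        obtain n2 where n2: "1 / Suc n2 < e" using \<open>0 < e\<close> by (metis inverse_eq_divide reals_Archimedean)
        define n where "n = max n1 n2"
        have "1 / Suc n \<le> 1 / Suc n2" by (simp add: n_def frac_le)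
        with n2 have "1 / Suc n \<le> e" by simp
        have "x \<in> {- real n..real n}" using n1 by (auto simp: n_def)
        with elim[rule_format, of n] have "\<rho> x < ennreal (C + 1 / Suc n)" by (simp add: E_def not_le)
        also have "\<dots> \<le> ennreal (C + e)" using \<open>1 / Suc n \<le> e\<close> by (intro ennreal_leI) auto
        also have "\<dots> = ennreal C + ennreal e" using C \<open>0 < e\<close> by simp
        finally show "\<rho> x \<le> ennreal C + ennreal e" by simp
      qed
    qed
  qed
  \<comment> \<open>Truncation turns the almost everywhere bound into one valid at every
    point.\<close>
  define h' where "h' x = enn2real (min (\<rho> x) (ennreal C))" for x
  have h'm[measurable]: "h' \<in> borel_measurable borel" unfolding h'_def by measurable
  have h'_bd: "0 \<le> h' x" "h' x \<le> C" for x
    using C by (auto simp: h'_def enn2real_leI)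
  have h'_eq: "AE x in lborel. ennreal (h' x) = \<rho> x"
    using \<rho>_le 
  proof eventually_elim
    case (elim x)
    then have "\<rho> x < top" by (rule le_less_trans) simp
    with elim show ?case by (simp add: h'_def min_absorb1)
  qed
  have int_h': "set_integrable lborel {a..b} h'" for a b
    unfolding set_integrable_def
    by (rule integrableI_bounded_set_indicator[where B=C]) (use h'_bd in \<open>auto simp: emeasure_lborel_Icc_eq\<close>)
  have g_int: "g b - g a = (LINT x:{a..b}|lborel. h' x)" if "a \<le> b" for a b
  proof -
    have mono: "g x \<le> g y" if "x \<le> y" for x y using g1[OF that] that by simp
    have kmono: "k x \<le> k y" if "x \<le> y" for x y
      using mono[of "k y" "k x"] that by (metis gk linear order_antisym)
    have "k -` {a..b} = {g a..g b}"
      using mono kmono by (auto) (metis gk kg)+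
    then have "ennreal (g b - g a) = emeasure N {a..b}"
      using mono[OF \<open>a \<le> b\<close>] by (simp add: N_eq)
    also have "\<dots> = (\<integral>\<^sup>+x. ennreal (indicator {a..b} x *\<^sub>R h' x) \<partial>lborel)"
      unfolding N_int[OF atLeastAtMost_borel] using h'_eq
      by (intro nn_integral_cong_AE) (auto simp: indicator_def)
    also have "\<dots> = ennreal (LINT x:{a..b}|lborel. h' x)"
      unfolding set_lebesgue_integral_def
      by (rule nn_integral_eq_integral) (use int_h' h'_bd in \<open>auto simp: set_integrable_def\<close>)
    finally show ?thesis
      using mono[OF \<open>a \<le> b\<close>] h'_bd
      by (subst (asm) ennreal_inj) (auto simp: set_lebesgue_integral_def intro!: integral_nonneg_AE)
  qed
  show thesis
  proof (rule that[of "\<lambda>x. h' x - (L + 1)" "C + (L + 1)"])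
    show "\<bar>h' x - (L + 1)\<bar> \<le> C + (L + 1)" for x using h'_bd[of x] L by auto
    fix a b :: real assume ab: "a \<le> b"
    have "integrable lborel (indicat_real {a..b})"
      by (intro integrable_real_indicator) (auto simp: emeasure_lborel_Icc_eq)
    then have "set_integrable lborel {a..b} (\<lambda>y. L + 1)" unfolding set_integrable_def by simp
    then have "(LINT x:{a..b}|lborel. h' x - (L + 1)) = (LINT x:{a..b}|lborel. h' x) - (LINT x:{a..b}|lborel. L + 1)"
      using int_h' by (intro set_integral_diff)
    also have "(LINT x:{a..b}|lborel. L + 1) = (L + 1) * (b - a)" using ab by (simp add: set_lebesgue_integral_def)
    also have "(LINT x:{a..b}|lborel. h' x) - (L + 1) * (b - a) = f b - f a"
      unfolding g_int[OF ab, symmetric] by (simp add: g_def algebra_simps)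
    finally show "f b - f a = (LINT x:{a..b}|lborel. h' x - (L + 1))" by simp
  qed simp
qed

lemma AE_differentiable_lipschitz_real:
  fixes f :: "real \<Rightarrow> real"
  assumes "L-lipschitz_on UNIV f"
  shows "AE x in lebesgue. \<exists>D. (f has_real_derivative D) (at x)"
proof -
  obtain h B where "h \<in> borel_measurable borel" "\<And>x. \<bar>h x\<bar> \<le> B"
    "\<And>a b. a \<le> b \<Longrightarrow> f b - f a = (LINT x:{a..b}|lborel. h x)"
    by (rule lipschitz_real_indefinite_integral[OF assms]) blast
  then have "AE x in lebesgue. (f has_real_derivative h x) (at x)"
    by (rule AE_has_derivative_indefinite_integral)
  then show ?thesis by eventually_elim blast
qed

text \<open>An almost everywhere bound on the derivative integrates because \<open>f\<close> is the
  integral of a bounded function that is its derivative almost everywhere. Quantifying over all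
  \<open>D\<close> makes the hypothesis vacuous where \<open>f\<close> has no derivative.\<close>

lemma lipschitz_real_deriv_bound:
  fixes f :: "real \<Rightarrow> real"
  assumes f: "L-lipschitz_on UNIV f" and "0 \<le> m"
    and m: "AE x in lebesgue. \<forall>D. (f has_real_derivative D) (at x) \<longrightarrow> \<bar>D\<bar> \<le> m"
  shows "\<bar>f b - f a\<bar> \<le> m * \<bar>b - a\<bar>"
proof -
  obtain h B where h[measurable]: "h \<in> borel_measurable borel" and B: "\<And>x. \<bar>h x\<bar> \<le> B"
    and fh: "\<And>a b. a \<le> b \<Longrightarrow> f b - f a = (LINT x:{a..b}|lborel. h x)"
    by (rule lipschitz_real_indefinite_integral[OF f]) blast
  have "AE x in lebesgue. (f has_real_derivative h x) (at x)"
    by (rule AE_has_derivative_indefinite_integral[OF h B fh])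
  with m have "AE x in lebesgue. \<bar>h x\<bar> \<le> m" by eventually_elim auto
  then have hm: "AE x in lborel. \<bar>h x\<bar> \<le> m" by (simp add: AE_completion_iff)
  have main: "\<bar>f b - f a\<bar> \<le> m * (b - a)" if "a \<le> b" for a b
  proof -
    have int: "integrable lborel (\<lambda>x. indicator {a..b} x *\<^sub>R h x)"
      by (rule integrableI_bounded_set_indicator[where B=B]) (use B in \<open>auto simp: emeasure_lborel_Icc_eq\<close>)
    have "\<bar>f b - f a\<bar> \<le> (LINT x|lborel. \<bar>indicator {a..b} x *\<^sub>R h x\<bar>)"
      unfolding fh[OF that] set_lebesgue_integral_def by (rule integral_abs_bound)
    also have "\<dots> \<le> (LINT x|lborel. m * indicator {a..b} x)"
    proof (rule integral_mono_AE)
      show "integrable lborel (\<lambda>x. m * indicator {a..b} x)"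
        by (intro integrable_mult_right integrable_real_indicator) (auto simp: emeasure_lborel_Icc_eq)
    qed (use int hm in \<open>auto simp: indicator_def elim!: eventually_mono\<close>)
    also have "\<dots> = m * (b - a)" using that by simp
    finally show ?thesis .
  qed
  show ?thesis using main[of a b] main[of b a] by (cases "a \<le> b") (auto simp: abs_minus_commute)
qed

section \<open>Null sets and lines in a fixed direction\<close>

text \<open>Tonelli and translation invariance. The right-hand side is 0 or infinite according to
  whether \<open>N\<close> is null or not, so both directions of Fubini's theorem for lines parallel
  to \<open>e\<close> follow without splitting the space into a line and a hyperplane.\<close>

lemma nn_integral_lines:
  fixes N :: "'a::euclidean_space set"
  assumes [measurable]: "N \<in> sets borel"
  shows "(\<integral>\<^sup>+x. (\<integral>\<^sup>+s. indicator N (x + s *\<^sub>R e) \<partial>lborel) \<partial>lborel) = (\<integral>\<^sup>+(s::real). emeasure lborel N \<partial>lborel)"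
proof -
  have "(\<integral>\<^sup>+x. (\<integral>\<^sup>+s. indicator N (x + s *\<^sub>R e) \<partial>lborel) \<partial>lborel) =
      (\<integral>\<^sup>+s. (\<integral>\<^sup>+x. indicator N (x + s *\<^sub>R e) \<partial>lborel) \<partial>lborel)"
    by (rule lborel_pair.Fubini') measurable
  also have "\<dots> = (\<integral>\<^sup>+(s::real). emeasure lborel N \<partial>lborel)"
  proof (intro nn_integral_cong)
    fix s :: real
    have "emeasure lborel N = (\<integral>\<^sup>+x. indicator N x \<partial>distr lborel borel ((+) (s *\<^sub>R e)))"
      by (simp add: lborel_distr_plus)
    also have "\<dots> = (\<integral>\<^sup>+x. indicator N (x + s *\<^sub>R e) \<partial>lborel)"
      by (subst nn_integral_distr) (auto simp: add.commute)
    finally show "(\<integral>\<^sup>+x. indicator N (x + s *\<^sub>R e) \<partial>lborel) = emeasure lborel N" by simp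
  qed
  finally show ?thesis .
qed

lemma null_sets_if_lines_null:
  fixes N :: "'a::euclidean_space set"
  assumes N[measurable]: "N \<in> sets borel" and l: "\<And>x. AE s in lborel. x + s *\<^sub>R e \<notin> N"
  shows "N \<in> null_sets lborel"
proof -
  have "(\<integral>\<^sup>+s. indicator N (x + s *\<^sub>R e) \<partial>lborel) = 0" for x
    using l[of x] by (subst nn_integral_0_iff_AE) (auto elim!: eventually_mono simp: indicator_def)
  then have "(\<integral>\<^sup>+(s::real). emeasure lborel N \<partial>lborel) = 0"
    using nn_integral_lines[OF N, of e] by simp
  then have "emeasure lborel N = 0"
    by (subst (asm) nn_integral_0_iff_AE) (auto simp: AE_iff_measurable[OF _ refl] split: if_splits)
  then show ?thesis by (auto simp: null_sets_def)
qed

lemma AE_lines_null: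
  fixes N :: "'a::euclidean_space set"
  assumes N: "N \<in> null_sets lborel"
  shows "AE x in lborel. AE s in lborel. x + s *\<^sub>R e \<notin> N"
proof -
  have Nm[measurable]: "N \<in> sets borel" using N by auto
  have "(\<integral>\<^sup>+x. (\<integral>\<^sup>+s. indicator N (x + s *\<^sub>R e) \<partial>lborel) \<partial>lborel) = 0"
    using nn_integral_lines[OF Nm, of e] N by (simp add: null_setsD1)
  then have "AE x in lborel. (\<integral>\<^sup>+s. indicator N (x + s *\<^sub>R e) \<partial>lborel) = 0"
    by (subst (asm) nn_integral_0_iff_AE) measurable
  then show ?thesis
    by eventually_elim (subst (asm) nn_integral_0_iff_AE, auto simp: indicator_def elim!: eventually_mono split: if_splits)
qed

text \<open>The slopes for the tolerances \<open>1/(n+1)\<close> and \<open>1/(m+1)\<close> are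
  compared on a short multiple of their own difference, which bounds that difference by the sum of
  the tolerances. They form a Cauchy sequence, and its limit is the gradient.\<close>

lemma differentiable_if_affine_approximations:
  fixes f :: "'a::euclidean_space \<Rightarrow> real"
  assumes approx: "\<And>\<epsilon>. 0 < \<epsilon> \<Longrightarrow> \<exists>y d. 0 < d \<and> (\<forall>h. norm h < d \<longrightarrow> \<bar>f (x + h) - f x - y \<bullet> h\<bar> \<le> \<epsilon> * norm h)"
  shows "f differentiable (at x)"
proof -
  have "\<forall>n. \<exists>y d. 0 < d \<and> (\<forall>h. norm h < d \<longrightarrow> \<bar>f (x + h) - f x - y \<bullet> h\<bar> \<le> (1 / Suc n) * norm h)"
    by (intro allI approx) auto
  then obtain y d where d: "\<And>n. 0 < d n"
    and yd: "\<And>n h. norm h < d n \<Longrightarrow> \<bar>f (x + h) - f x - y n \<bullet> h\<bar> \<le> (1 / Suc n) * norm h"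
    by metis
  have close: "norm (y n - y m) \<le> 1 / Suc n + 1 / Suc m" for n m
  proof (cases "y n = y m")
    case False
    define z where "z = y n - y m"
    have z: "0 < norm z" using False by (simp add: z_def)
    define s where "s = min (d n) (d m) / (2 * norm z)"
    have s: "0 < s" using d z by (simp add: s_def)
    have sd: "norm (s *\<^sub>R z) < d n" "norm (s *\<^sub>R z) < d m"
      using d[of n] d[of m] z s by (auto simp: s_def min_def)
    have "\<bar>z \<bullet> (s *\<^sub>R z)\<bar> \<le> (1 / Suc n + 1 / Suc m) * norm (s *\<^sub>R z)"
      using yd[OF sd(1)] yd[OF sd(2)] unfolding z_def inner_diff_left distrib_right abs_le_iff by linarith
    then have "(s * norm z) * norm z \<le> (s * norm z) * (1 / Suc n + 1 / Suc m)"
      using s by (simp add: power2_norm_eq_inner[symmetric] power2_eq_square mult_ac)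
    then show ?thesis using s z by (simp only: z_def[symmetric] mult_le_cancel_left_pos mult_pos_pos)
  qed simp
  have "Cauchy y"
  proof (rule CauchyI)
    fix e :: real assume "0 < e"
    obtain M where M: "1 / Suc M < e / 2" using \<open>0 < e\<close>
      by (metis half_gt_zero inverse_eq_divide reals_Archimedean)
    have "norm (y m - y n) < e" if "M \<le> m" "M \<le> n" for m n
    proof -
      have "1 / Suc m \<le> 1 / Suc M" "1 / Suc n \<le> 1 / Suc M" using that by (auto simp: frac_le)
      then show ?thesis using close[of m n] M by linarith
    qed
    then show "\<exists>M. \<forall>m\<ge>M. \<forall>n\<ge>M. norm (y m - y n) < e" by blast
  qed
  then obtain y0 where y0: "y \<longlonglongrightarrow> y0" using Cauchy_convergent_iff convergent_def by blast
  have y0_close: "norm (y n - y0) \<le> 1 / Suc n" for n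
  proof -
    have "(\<lambda>m. norm (y n - y m)) \<longlonglongrightarrow> norm (y n - y0)"
      by (intro tendsto_intros y0)
    moreover have "(\<lambda>m. 1 / Suc n + 1 / Suc m) \<longlonglongrightarrow> 1 / Suc n + 0"
      by (intro tendsto_intros LIMSEQ_Suc lim_1_over_n)
    ultimately have "norm (y n - y0) \<le> 1 / Suc n + 0"
      by (rule LIMSEQ_le) (use close in auto)
    then show ?thesis by simp
  qed
  have "(f has_derivative (\<lambda>h. y0 \<bullet> h)) (at x)"
    unfolding has_derivative_at_alt
  proof (intro conjI allI impI)
    show "bounded_linear ((\<bullet>) y0)" by (rule bounded_linear_inner_right)
    fix e :: real assume "0 < e"
    obtain n where n: "1 / Suc n < e / 2" using \<open>0 < e\<close>
      by (metis half_gt_zero inverse_eq_divide reals_Archimedean)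
    have "norm (f z - f x - y0 \<bullet> (z - x)) \<le> e * norm (z - x)" if "norm (z - x) < d n" for z
    proof -
      have "\<bar>f z - f x - y n \<bullet> (z - x)\<bar> \<le> (1 / Suc n) * norm (z - x)"
        using yd[OF that] by simp
      moreover have "\<bar>(y n - y0) \<bullet> (z - x)\<bar> \<le> (1 / Suc n) * norm (z - x)"
        by (rule order_trans[OF Cauchy_Schwarz_ineq2]) (intro mult_right_mono y0_close, simp)
      ultimately have "\<bar>f z - f x - y0 \<bullet> (z - x)\<bar> \<le> (1 / Suc n) * norm (z - x) + (1 / Suc n) * norm (z - x)"
        unfolding inner_diff_left by linarith
      also have "\<dots> = (2 * (1 / Suc n)) * norm (z - x)" by simp
      also have "\<dots> \<le> e * norm (z - x)" using n by (intro mult_right_mono) auto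
      finally show ?thesis by simp
    qed
    then show "\<exists>da>0. \<forall>y. norm (y - x) < da \<longrightarrow> norm (f y - f x - y0 \<bullet> (y - x)) \<le> e * norm (y - x)"
      using d[of n] by blast
  qed
  then show ?thesis unfolding differentiable_def by blast
qed

text \<open>Otherwise the ball of radius \<open>\<delta> * norm w\<close> about \<open>x + w\<close>
  misses \<open>A\<close>. It lies in the ball of radius \<open>2 * norm w\<close> about
  \<open>x\<close> and fills exactly the fraction \<open>(\<delta>/2) ^ DIM('a)\<close> of it, which
  contradicts the density.\<close>

lemma near_points_if_high_density:
  fixes A :: "'a::euclidean_space set"
  assumes A: "A \<in> sets lebesgue" and xA: "x \<in> A" and \<delta>: "0 < \<delta>" "\<delta> \<le> 1"
    and dens: "\<And>r. 0 < r \<Longrightarrow> r < d \<Longrightarrow>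
      (1 - (\<delta>/2) ^ DIM('a)) * measure lebesgue (cball x r) < measure lebesgue (A \<inter> cball x r)"
    and w: "norm w < d / 2"
  shows "\<exists>a\<in>A. dist a (x + w) \<le> \<delta> * norm w"
proof (cases "w = 0")
  case True
  then show ?thesis using xA by auto
next
  case False
  show ?thesis
  proof (rule ccontr)
    assume no: "\<not> ?thesis"
    define r where "r = 2 * norm w"
    let ?B = "cball (x + w) (\<delta> * norm w)"
    have r: "0 < r" "r < d" using False w by (auto simp: r_def)
    have "\<delta> * norm w \<le> norm w" using \<delta> by (simp add: mult_left_le_one_le)
    then have sub: "?B \<subseteq> cball x r"
      by (intro cball_subset_cball_iff[THEN iffD2]) (simp add: r_def dist_norm)
    have "A \<inter> cball x r \<subseteq> cball x r - ?B" using no by (auto simp: dist_commute)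
    then have "measure lebesgue (A \<inter> cball x r) \<le> measure lebesgue (cball x r - ?B)"
      using A by (intro measure_mono_fmeasurable) (auto intro!: fmeasurable_Diff)
    also have "\<dots> = measure lebesgue (cball x r) - measure lebesgue ?B"
      using sub by (intro measurable_measure_Diff) auto
    also have "measure lebesgue ?B = (\<delta>/2) ^ DIM('a) * measure lebesgue (cball x r)"
      using \<delta> r by (simp add: content_cball r_def power_mult_distrib power_divide)
    finally show False using dens[OF r] by (simp add: algebra_simps)
  qed
qed

text \<open>The argument of Nekvinda and Zajicek: let $A$ be the set of points at which all difference
  quotients in coordinate directions are $\varepsilon$-close to a fixed $y$ up to a fixed scale.
  Near a density point of $A$ every corner of the coordinate path from $x$ to $x + h$ has a
  point of $A$ close to it, hence $f$ is nearly affine with slope $y$ there.\<close>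

lemma nearly_affine_at_density_point:
  fixes f :: "'a::euclidean_space \<Rightarrow> real"
  assumes f: "L-lipschitz_on UNIV f" and \<epsilon>: "0 \<le> \<epsilon>" and \<delta>: "0 < \<delta>"
    and A: "\<And>a b t. a \<in> A \<Longrightarrow> b \<in> Basis \<Longrightarrow> \<bar>t\<bar> < d \<Longrightarrow> \<bar>f (a + t *\<^sub>R b) - f a - t * (y \<bullet> b)\<bar> \<le> \<epsilon> * \<bar>t\<bar>"
    and near: "\<And>w. norm w < d \<Longrightarrow> \<exists>a\<in>A. dist a (x + w) \<le> \<delta> * norm w"
    and h: "norm h < d"
  shows "\<bar>f (x + h) - f x - y \<bullet> h\<bar> \<le> real DIM('a) * (\<epsilon> + 2 * L * \<delta>) * norm h"
proof -
  have L: "0 \<le> L" using f lipschitz_on_nonneg by auto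
  have fL: "\<bar>f x - f y\<bar> \<le> L * dist x y" for x y
    using lipschitz_onD[OF f, of x y] by (simp add: dist_real_def)
  \<comment> \<open>Induction over the coordinates already moved. Each further coordinate costs
    \<open>\<epsilon> * norm h\<close> for a move that starts at a nearby point of \<open>A\<close>,
    and twice \<open>L * \<delta> * norm h\<close> for shifting both ends of the move to that
    neighbour.\<close>
  have "\<bar>f (x + (\<Sum>b\<in>F. (h \<bullet> b) *\<^sub>R b)) - f x - (\<Sum>b\<in>F. (h \<bullet> b) * (y \<bullet> b))\<bar> \<le> real (card F) * (\<epsilon> + 2 * L * \<delta>) * norm h"
    if "finite F" "F \<subseteq> Basis" for F
    using that
  proof (induction F rule: finite_induct)
    case (insert b F)
    define w where "w = (\<Sum>b\<in>F. (h \<bullet> b) *\<^sub>R b)"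
    define t where "t = h \<bullet> b"
    have b: "b \<in> Basis" and F: "F \<subseteq> Basis" using insert.prems by auto
    have "norm w \<le> norm h"
    proof (rule norm_le_componentwise)
      fix i :: 'a assume i: "i \<in> Basis"
      have "w \<bullet> i = (\<Sum>b\<in>F. if b = i then h \<bullet> i else 0)"
        unfolding w_def inner_sum_left using i F
        by (intro sum.cong refl) (auto simp: inner_Basis)
      also have "\<dots> = (if i \<in> F then h \<bullet> i else 0)" using insert.hyps(1) by simp
      finally show "\<bar>w \<bullet> i\<bar> \<le> \<bar>h \<bullet> i\<bar>" by simp
    qed
    then obtain a where a: "a \<in> A" "dist a (x + w) \<le> \<delta> * norm w"
      using near[of w] h by auto
    have "\<delta> * norm w \<le> \<delta> * norm h" using \<open>norm w \<le> norm h\<close> \<delta> by (intro mult_left_mono) auto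
    with a have aw: "dist a (x + w) \<le> \<delta> * norm h" by simp
    have th: "\<bar>t\<bar> \<le> norm h" unfolding t_def using b by (rule Basis_le_norm)
    have 1: "\<bar>f (x + w + t *\<^sub>R b) - f (a + t *\<^sub>R b)\<bar> \<le> L * (\<delta> * norm h)"
      using fL[of "x + w + t *\<^sub>R b" "a + t *\<^sub>R b"] mult_left_mono[OF aw L]
      by (simp add: dist_commute)
    have 2: "\<bar>f a - f (x + w)\<bar> \<le> L * (\<delta> * norm h)"
      using fL[of a "x + w"] mult_left_mono[OF aw L] by simp
    have "\<bar>f (a + t *\<^sub>R b) - f a - t * (y \<bullet> b)\<bar> \<le> \<epsilon> * \<bar>t\<bar>"
      using A[OF a(1) b] th h by simp
    also have "\<dots> \<le> \<epsilon> * norm h" using th \<epsilon> by (intro mult_left_mono)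
    finally have 3: "\<bar>f (a + t *\<^sub>R b) - f a - t * (y \<bullet> b)\<bar> \<le> \<epsilon> * norm h" .
    have IH: "\<bar>f (x + w) - f x - (\<Sum>b\<in>F. (h \<bullet> b) * (y \<bullet> b))\<bar> \<le> real (card F) * (\<epsilon> + 2 * L * \<delta>) * norm h"
      using insert.IH[OF F] by (simp add: w_def)
    have e1: "x + (\<Sum>b\<in>insert b F. (h \<bullet> b) *\<^sub>R b) = x + w + t *\<^sub>R b"
      and e2: "(\<Sum>b\<in>insert b F. (h \<bullet> b) * (y \<bullet> b)) = t * (y \<bullet> b) + (\<Sum>b\<in>F. (h \<bullet> b) * (y \<bullet> b))"
      and e3: "real (card (insert b F)) = real (card F) + 1"
      using insert.hyps by (simp_all add: w_def t_def)
    show ?case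
      unfolding e1 e2 e3 using 1 2 3 IH
      by (simp add: algebra_simps abs_le_iff)
  qed simp
  from this[OF finite_Basis order_refl] show ?thesis
    by (simp add: euclidean_representation euclidean_inner[of y h] mult.commute)
qed

theorem Rademacher:
  fixes f :: "'a::euclidean_space \<Rightarrow> real"
  assumes f: "L-lipschitz_on UNIV f"
  shows "AE x in lebesgue. f differentiable (at x)"
proof -
  have L: "0 \<le> L" using f lipschitz_on_nonneg by auto
  have cont: "continuous_on UNIV f" by (rule lipschitz_on_continuous_on[OF f])
  \<comment> \<open>With rational \<open>q\<close> and integer scales only countably many sets
    occur, so all their exceptional null sets can be discarded at once.\<close>
  define P where "P i q k n = {x. \<forall>t. \<bar>t\<bar> < 1 / Suc n \<longrightarrow> \<bar>f (x + t *\<^sub>R i) - f x - t * q\<bar> \<le> (1 / Suc k) * \<bar>t\<bar>}"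
    for i :: 'a and q :: real and k n :: nat
  have Pclosed: "closed (P i q k n)" for i q k n
  proof -
    have "P i q k n = (\<Inter>t\<in>{t. \<bar>t\<bar> < 1 / Suc n}. {x. \<bar>f (x + t *\<^sub>R i) - f x - t * q\<bar> \<le> (1 / Suc k) * \<bar>t\<bar>})"
      by (auto simp: P_def)
    moreover have "closed {x. \<bar>f (x + t *\<^sub>R i) - f x - t * q\<bar> \<le> (1 / Suc k) * \<bar>t\<bar>}" for t
      by (intro closed_Collect_le continuous_intros continuous_on_compose2[OF cont]) auto
    ultimately show ?thesis by auto
  qed
  have Pmono: "P i q k n \<subseteq> P i q k m" if "n \<le> m" for i q k n m
  proof -
    have "1 / Suc m \<le> 1 / Suc n" using that by (auto simp: frac_le)
    then show ?thesis unfolding P_def by (auto dest: order_less_le_trans)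
  qed
  have partial: "AE x in lebesgue. \<exists>q\<in>\<rat>. \<exists>n. x \<in> P i q k n" for i k
  proof -
    let ?N = "- (\<Union>q\<in>\<rat>. \<Union>n. P i q k n)"
    have Nm: "?N \<in> sets borel"
      using Pclosed by (intro borel_comp sets.countable_UN' countable_rat) (auto intro!: sets.countable_UN)
    \<comment> \<open>On every line parallel to \<open>i\<close> the function is Lipschitz in the
      line parameter, hence differentiable almost everywhere by the one-dimensional case; Fubini
      then makes the exceptional set null.\<close>
    have "?N \<in> null_sets lborel"
    proof (rule null_sets_if_lines_null[OF Nm, of i])
      fix x
      have "(L * norm i)-lipschitz_on UNIV (\<lambda>s. f (x + s *\<^sub>R i))"
      proof (rule lipschitz_onI)
        fix s t :: real
        have "dist (f (x + s *\<^sub>R i)) (f (x + t *\<^sub>R i)) \<le> L * dist (x + s *\<^sub>R i) (x + t *\<^sub>R i)"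
          using f by (rule lipschitz_onD) auto
        also have "dist (x + s *\<^sub>R i) (x + t *\<^sub>R i) = norm i * dist s t"
          by (simp add: dist_norm mult.commute flip: scaleR_left_diff_distrib)
        finally show "dist (f (x + s *\<^sub>R i)) (f (x + t *\<^sub>R i)) \<le> L * norm i * dist s t" by simp
      qed (use L in simp)
      from AE_differentiable_lipschitz_real[OF this]
      have "AE s in lborel. \<exists>D. ((\<lambda>s. f (x + s *\<^sub>R i)) has_real_derivative D) (at s)"
        by (simp add: AE_completion_iff)
      then show "AE s in lborel. x + s *\<^sub>R i \<notin> ?N"
      proof eventually_elim
        case (elim s)
        then obtain D where D: "((\<lambda>s. f (x + s *\<^sub>R i)) has_real_derivative D) (at s)" by blast
        \<comment> \<open>Half of the tolerance is spent on the remainder of the derivative, half on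
          replacing \<open>D\<close> by a rational number.\<close>
        define e where "e = 1 / (2 * Suc k)"
        have e: "0 < e" "2 * e = 1 / Suc k" by (simp_all add: e_def field_simps)
        from D[unfolded has_field_derivative_def has_derivative_at_alt] e
        obtain d where d: "0 < d" "\<And>t. \<bar>t - s\<bar> < d \<Longrightarrow>
            \<bar>f (x + t *\<^sub>R i) - f (x + s *\<^sub>R i) - D * (t - s)\<bar> \<le> e * \<bar>t - s\<bar>"
          by auto
        obtain q where q: "q \<in> \<rat>" "D - e < q" "q < D" using Rats_dense_in_real[of "D - e" D] e by auto
        obtain n where n: "1 / Suc n < d" using d by (metis inverse_eq_divide reals_Archimedean)
        have "x + s *\<^sub>R i \<in> P i q k n"
          unfolding P_def
        proof (intro CollectI allI impI)
          fix t :: real assume t: "\<bar>t\<bar> < 1 / Suc n"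
          have "\<bar>f (x + (s + t) *\<^sub>R i) - f (x + s *\<^sub>R i) - D * t\<bar> \<le> e * \<bar>t\<bar>"
            using d(2)[of "s + t"] t n by simp
          moreover have "\<bar>(D - q) * t\<bar> \<le> e * \<bar>t\<bar>"
            unfolding abs_mult using q by (intro mult_right_mono) auto
          ultimately have "\<bar>f (x + (s + t) *\<^sub>R i) - f (x + s *\<^sub>R i) - t * q\<bar> \<le> 2 * e * \<bar>t\<bar>"
            by (simp add: algebra_simps abs_le_iff)
          then show "\<bar>f (x + s *\<^sub>R i + t *\<^sub>R i) - f (x + s *\<^sub>R i) - t * q\<bar> \<le> 1 / Suc k * \<bar>t\<bar>"
            unfolding e(2) by (simp add: scaleR_add_left add.assoc)
        qed
        then show ?case using q by blast
      qed
    qed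
    then have "AE x in lborel. x \<notin> ?N" by (rule AE_not_in)
    then have "AE x in lborel. \<exists>q\<in>\<rat>. \<exists>n. x \<in> P i q k n" by eventually_elim auto
    then show ?thesis by (simp add: AE_completion_iff)
  qed
  define Y where "Y = (\<lambda>g. \<Sum>b\<in>Basis. g b *\<^sub>R b) ` (PiE (Basis :: 'a set) (\<lambda>_. \<rat> :: real set))"
  have Y: "countable Y" unfolding Y_def by (intro countable_image countable_PiE finite_Basis countable_rat)
  define A where "A y k n = (\<Inter>b\<in>Basis. P b (y \<bullet> b) k n)" for y k n
  have Am: "A y k n \<in> sets lebesgue" for y k n
  proof -
    have "closed (A y k n)" using Pclosed by (auto simp: A_def)
    then show ?thesis by (metis borel_closed sets_completionI_sets sets_lborel)
  qed
  define bad where "bad y k n j = {x \<in> A y k n. \<forall>d>0. \<exists>r. 0 < r \<and> r < d \<and>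
      measure lebesgue (A y k n \<inter> cball x r) \<le> (1 - 1 / Suc j) * measure lebesgue (cball x r)}" for y k n j
  have "AE x in lebesgue. x \<notin> bad y k n j" for y k n j
  proof -
    have "negligible (bad y k n j)" unfolding bad_def by (rule small_density_negligible[OF Am]) auto
    then show ?thesis by (simp add: AE_not_in negligible_iff_null_sets)
  qed
  then have dens: "AE x in lebesgue. \<forall>y\<in>Y. \<forall>k n j. x \<notin> bad y k n j"
    by (simp add: AE_ball_countable Y AE_all_countable)
  have "AE x in lebesgue. \<forall>b\<in>Basis. \<forall>k. \<exists>q\<in>\<rat>. \<exists>n. x \<in> P b q k n"
    using partial by (simp add: AE_ball_countable AE_all_countable countable_finite)
  with dens show ?thesis
  proof eventually_elim
    case (elim x)
    show ?case
    proof (rule differentiable_if_affine_approximations)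
      fix \<epsilon> :: real assume \<epsilon>: "0 < \<epsilon>"
      let ?D = "real DIM('a)"
      have D: "0 < ?D" by simp
      obtain k where k: "1 / Suc k < \<epsilon> / (2 * ?D)" using \<epsilon> D
        by (metis divide_pos_pos inverse_eq_divide mult_pos_pos reals_Archimedean zero_less_numeral)
      \<comment> \<open>The relative error will be
        \<open>?D * (1 / Suc k + 2 * L * \<delta>)\<close>, and \<open>k\<close> and
        \<open>\<delta>\<close> each receive half of \<open>\<epsilon>\<close>. The bound by 1 keeps
        the test ball about \<open>x + w\<close> inside the ball of radius \<open>2 * norm w\<close>
        about \<open>x\<close>.\<close>
      define \<delta> where "\<delta> = min 1 (\<epsilon> / (4 * ?D * (L + 1)))"
      have \<delta>: "0 < \<delta>" "\<delta> \<le> 1" using \<epsilon> L by (auto simp: \<delta>_def)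
      have "\<delta> \<le> \<epsilon> / (4 * ?D * (L + 1))" by (simp add: \<delta>_def)
      then have "\<delta> * (4 * ?D * (L + 1)) \<le> \<epsilon>" using L by (simp add: pos_le_divide_eq)
      then have \<delta>': "?D * (2 * L * \<delta>) \<le> \<epsilon> / 2" using \<delta> D
        by (simp add: algebra_simps) (smt (verit) mult_nonneg_nonneg of_nat_0_le_iff)
      have "\<forall>b\<in>Basis. \<exists>q. q \<in> \<rat> \<and> (\<exists>n. x \<in> P b q k n)" using elim(2) by blast
      then obtain q where q: "\<forall>b\<in>Basis. q b \<in> \<rat> \<and> (\<exists>n. x \<in> P b (q b) k n)" by (rule bchoice[THEN exE])
      then have "\<forall>b\<in>Basis. \<exists>n. x \<in> P b (q b) k n" by blast
      then obtain N where "\<forall>b\<in>Basis. x \<in> P b (q b) k (N b)" by (rule bchoice[THEN exE])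
      with q have qN: "\<And>b. b \<in> Basis \<Longrightarrow> q b \<in> \<rat> \<and> x \<in> P b (q b) k (N b)" by blast
      define y where "y = (\<Sum>b\<in>Basis. q b *\<^sub>R b)"
      have yb: "y \<bullet> b = q b" if "b \<in> Basis" for b using that by (simp add: y_def)
      have "y = (\<Sum>b\<in>Basis. (restrict q Basis) b *\<^sub>R b)" by (simp add: y_def)
      moreover have "restrict q Basis \<in> PiE Basis (\<lambda>_. \<rat>)" using qN by auto
      ultimately have "y \<in> Y" unfolding Y_def by blast
      define n where "n = Max (N ` Basis)"
      have xA: "x \<in> A y k n"
        unfolding A_def
      proof
        fix b :: 'a assume b: "b \<in> Basis"
        then have "N b \<le> n" by (simp add: n_def)
        then show "x \<in> P b (y \<bullet> b) k n" using qN[OF b] Pmono[of "N b" n b "q b" k] yb[OF b] by auto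
      qed
      have "0 < (\<delta>/2) ^ DIM('a)" using \<delta> by simp
      then obtain j where j: "1 / Suc j < (\<delta>/2) ^ DIM('a)" by (metis inverse_eq_divide reals_Archimedean)
      have "x \<notin> bad y k n j" using elim(1) \<open>y \<in> Y\<close> by blast
      then obtain d where d: "0 < d" "\<And>r. 0 < r \<Longrightarrow> r < d \<Longrightarrow>
          (1 - 1 / Suc j) * measure lebesgue (cball x r) < measure lebesgue (A y k n \<inter> cball x r)"
        using xA unfolding bad_def by (auto simp: not_le)
      have d': "(1 - (\<delta>/2) ^ DIM('a)) * measure lebesgue (cball x r) < measure lebesgue (A y k n \<inter> cball x r)"
        if "0 < r" "r < d" for r
        by (rule le_less_trans[OF mult_right_mono d(2)[OF that]]) (use j in auto)
      define d0 where "d0 = min (d / 2) (1 / Suc n)"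
      have d0: "0 < d0" using d by (simp add: d0_def)
      have "\<bar>f (x + h) - f x - y \<bullet> h\<bar> \<le> \<epsilon> * norm h" if h: "norm h < d0" for h
      proof -
        have "\<bar>f (x + h) - f x - y \<bullet> h\<bar> \<le> ?D * (1 / Suc k + 2 * L * \<delta>) * norm h"
        proof (rule nearly_affine_at_density_point[OF f _ \<delta>(1) _ _ h])
          show "\<exists>a\<in>A y k n. dist a (x + w) \<le> \<delta> * norm w" if "norm w < d0" for w
            using near_points_if_high_density[OF Am xA \<delta> d'] that by (simp add: d0_def)
          show "\<bar>f (a + t *\<^sub>R b) - f a - t * (y \<bullet> b)\<bar> \<le> 1 / Suc k * \<bar>t\<bar>"
            if "a \<in> A y k n" "b \<in> Basis" "\<bar>t\<bar> < d0" for a b t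
            using that by (auto simp: A_def P_def d0_def)
        qed simp
        also have "\<dots> \<le> \<epsilon> * norm h"
        proof (intro mult_right_mono norm_ge_zero)
          have "?D * (1 / Suc k) \<le> \<epsilon> / 2" using k D by (simp add: field_simps)
          then show "?D * (1 / Suc k + 2 * L * \<delta>) \<le> \<epsilon>" using \<delta>' unfolding distrib_left by linarith
        qed
        finally show ?thesis .
      qed
      then show "\<exists>y d. 0 < d \<and> (\<forall>h. norm h < d \<longrightarrow> \<bar>f (x + h) - f x - y \<bullet> h\<bar> \<le> \<epsilon> * norm h)"
        using d0 by blast
    qed
  qed
qed

text \<open>By Fubini, for almost every \<open>x\<close> the bound holds almost everywhere on the
  line through \<open>x\<close> in direction \<open>i\<close>, and the one-dimensional result
  applies there. By continuity the inequality defines a closed set of points \<open>x\<close>; its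
  complement is open and null, hence empty.\<close>

lemma lipschitz_directional_bound:
  fixes f :: "'a::euclidean_space \<Rightarrow> real"
  assumes f: "L-lipschitz_on UNIV f" and m: "0 \<le> m"
    and bound: "AE x in lebesgue. \<forall>f'. (f has_derivative f') (at x) \<longrightarrow> \<bar>f' i\<bar> \<le> m"
  shows "\<bar>f (x + t *\<^sub>R i) - f x\<bar> \<le> m * \<bar>t\<bar>"
proof -
  have L: "0 \<le> L" using f lipschitz_on_nonneg by auto
  have cont: "continuous_on UNIV f" by (rule lipschitz_on_continuous_on[OF f])
  have "AE x in lebesgue. \<exists>f'. (f has_derivative f') (at x) \<and> \<bar>f' i\<bar> \<le> m"
    using Rademacher[OF f] bound by eventually_elim (auto simp: differentiable_def)
  then have "AE x in lborel. \<exists>f'. (f has_derivative f') (at x) \<and> \<bar>f' i\<bar> \<le> m"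
    by (simp add: AE_completion_iff)
  then obtain N where N: "N \<in> null_sets lborel"
      "\<And>x. x \<notin> N \<Longrightarrow> \<exists>f'. (f has_derivative f') (at x) \<and> \<bar>f' i\<bar> \<le> m"
    by (auto elim!: AE_E3)
  have "AE x in lborel. AE s in lborel. x + s *\<^sub>R i \<notin> N" by (rule AE_lines_null[OF N(1)])
  then have "AE x in lborel. \<bar>f (x + t *\<^sub>R i) - f x\<bar> \<le> m * \<bar>t\<bar>"
  proof eventually_elim
    case (elim x)
    let ?g = "\<lambda>s. f (x + s *\<^sub>R i)"
    have lip: "(L * norm i)-lipschitz_on UNIV ?g"
    proof (rule lipschitz_onI)
      fix s t :: real
      have "dist (?g s) (?g t) \<le> L * dist (x + s *\<^sub>R i) (x + t *\<^sub>R i)"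
        using f by (rule lipschitz_onD) auto
      also have "dist (x + s *\<^sub>R i) (x + t *\<^sub>R i) = norm i * dist s t"
        by (simp add: dist_norm mult.commute flip: scaleR_left_diff_distrib)
      finally show "dist (?g s) (?g t) \<le> L * norm i * dist s t" by simp
    qed (use L in simp)
    from elim have "AE s in lborel. \<forall>D. (?g has_real_derivative D) (at s) \<longrightarrow> \<bar>D\<bar> \<le> m"
    proof eventually_elim
      case (elim s)
      then obtain f' where f': "(f has_derivative f') (at (x + s *\<^sub>R i))" "\<bar>f' i\<bar> \<le> m" using N(2) by blast
      interpret bounded_linear f' using f'(1) by (rule has_derivative_bounded_linear)
      have "((\<lambda>s. x + s *\<^sub>R i) has_derivative (\<lambda>t. t *\<^sub>R i)) (at s)"
        by (auto intro!: derivative_eq_intros)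
      from diff_chain_at[OF this, of f f'] f'(1)
      have "(?g has_derivative (\<lambda>t. f' (t *\<^sub>R i))) (at s)" by (simp add: o_def)
      then have "(?g has_real_derivative f' i) (at s)"
        unfolding has_field_derivative_def by (rule has_derivative_eq_rhs) (auto simp: scaleR)
      then show ?case using f'(2) DERIV_unique by blast
    qed
    then have "AE s in lebesgue. \<forall>D. (?g has_real_derivative D) (at s) \<longrightarrow> \<bar>D\<bar> \<le> m"
      by (simp add: AE_completion_iff)
    from lipschitz_real_deriv_bound[OF lip m this, of t 0] show ?case by simp
  qed
  moreover have cl: "closed {x. \<bar>f (x + t *\<^sub>R i) - f x\<bar> \<le> m * \<bar>t\<bar>}" (is "closed ?S")
    by (intro closed_Collect_le continuous_intros continuous_on_compose2[OF cont]) auto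
  ultimately have "AE x in lebesgue. x \<in> ?S" by (simp add: AE_completion_iff)
  then have "negligible (- ?S)"
    by (simp add: negligible_iff_null_sets completion.AE_iff_null_sets Compl_eq)
  then have "- ?S = {}" using open_Compl[OF cl] open_not_negligible by blast
  then show ?thesis by blast
qed

section \<open>The domain and the velocity field\<close>

lemma AE_lebesgue_on_iff:
  assumes "S \<in> sets lebesgue"
  shows "(AE x in lebesgue_on S. P x) \<longleftrightarrow> (AE x in lebesgue. x \<in> S \<longrightarrow> P x)"
  using assms by (subst AE_restrict_space_iff) auto

lemma has_derivative_vec_component:
  fixes v :: "real^'n \<Rightarrow> real^'m"
  assumes "v differentiable (at x)"
  shows "((\<lambda>x. v x $ i) has_derivative (\<lambda>h. frechet_derivative v (at x) h $ i)) (at x)"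
  using assms by (intro bounded_linear.has_derivative[OF bounded_linear_vec_nth])
    (simp add: frechet_derivative_works)

lemma lipschitz_on_vec_component:
  fixes v :: "'a::metric_space \<Rightarrow> real^'m"
  assumes "L-lipschitz_on S v"
  shows "L-lipschitz_on S (\<lambda>x. v x $ i)"
proof (rule lipschitz_onI)
  fix x y assume "x \<in> S" "y \<in> S"
  then have "dist (v x) (v y) \<le> L * dist x y" by (rule lipschitz_onD[OF assms])
  then show "dist (v x $ i) (v y $ i) \<le> L * dist x y"
    using dist_vec_nth_le[of "v x" i "v y"] by linarith
qed (use assms lipschitz_on_nonneg in auto)

lemma AE_differentiable_lipschitz_vec:
  fixes v :: "real^'n \<Rightarrow> real^'m"
  assumes "L-lipschitz_on UNIV v"
  shows "AE x in lebesgue. v differentiable (at x)"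
proof -
  have "AE x in lebesgue. \<forall>i. (\<lambda>x. v x $ i) differentiable (at x)"
    using Rademacher[OF lipschitz_on_vec_component[OF assms]] by (simp add: AE_all_countable)
  then show ?thesis
  proof eventually_elim
    case (elim x)
    then show ?case
      by (subst differentiable_componentwise_within) (auto simp: Basis_vec_def inner_axis)
  qed
qed

text \<open>Moving one coordinate at a time bounds every component by \<open>m\<close> times the sum
  norm of \<open>x - y\<close>; Cauchy-Schwarz converts to Euclidean norms. For equal dimensions the
  constant is \<open>CARD('n) * m\<close>.\<close>

lemma lipschitz_vec_of_partial_bounds:
  fixes v :: "real^'n \<Rightarrow> real^'m"
  assumes "0 \<le> m" and part: "\<And>x t i j. \<bar>v (x + t *\<^sub>R axis j 1) $ i - v x $ i\<bar> \<le> m * \<bar>t\<bar>"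
  shows "(sqrt (real CARD('n) * real CARD('m)) * m)-lipschitz_on UNIV v"
proof (rule lipschitz_onI)
  fix x y :: "real^'n"
  define z where "z = x - y"
  have tel: "\<bar>v (y + (\<Sum>j\<in>F. z $ j *\<^sub>R axis j 1)) $ i - v y $ i\<bar> \<le> m * (\<Sum>j\<in>F. \<bar>z $ j\<bar>)"
    if "finite F" for F i
    using that
  proof (induction F rule: finite_induct)
    case (insert j F)
    let ?w = "y + (\<Sum>j\<in>F. z $ j *\<^sub>R axis j 1)"
    have "\<bar>v (?w + z $ j *\<^sub>R axis j 1) $ i - v ?w $ i\<bar> \<le> m * \<bar>z $ j\<bar>" by (rule part)
    moreover have "y + (\<Sum>j\<in>insert j F. z $ j *\<^sub>R axis j 1) = ?w + z $ j *\<^sub>R axis j 1"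
      using insert.hyps by simp
    ultimately show ?case using insert by (simp add: algebra_simps)
  qed simp
  have "(\<Sum>j\<in>UNIV. z $ j *\<^sub>R axis j (1::real)) = z"
    using basis_expansion[of z] by (simp add: scalar_mult_eq_scaleR)
  then have comp: "\<bar>(v x - v y) $ i\<bar> \<le> m * (\<Sum>j\<in>UNIV. \<bar>z $ j\<bar>)" for i
    using tel[of UNIV i] by (simp add: z_def)
  have s1: "(\<Sum>j\<in>UNIV. \<bar>z $ j\<bar>)\<^sup>2 \<le> real CARD('n) * (norm z)\<^sup>2"
    using sum_squared_le_sum_of_squares[of "\<lambda>j. \<bar>z $ j\<bar>" UNIV]
    by (simp add: norm_vec_def L2_set_def sum_nonneg mult.commute)
  have "(norm (v x - v y))\<^sup>2 = (\<Sum>i\<in>UNIV. \<bar>(v x - v y) $ i\<bar>\<^sup>2)"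
    by (simp add: norm_vec_def L2_set_def sum_nonneg)
  also have "\<dots> \<le> (\<Sum>i\<in>(UNIV::'m set). (m * (\<Sum>j\<in>UNIV. \<bar>z $ j\<bar>))\<^sup>2)"
    using comp by (intro sum_mono power_mono) auto
  also have "\<dots> = real CARD('m) * m\<^sup>2 * (\<Sum>j\<in>UNIV. \<bar>z $ j\<bar>)\<^sup>2" by (simp add: power_mult_distrib)
  also have "\<dots> \<le> real CARD('m) * m\<^sup>2 * (real CARD('n) * (norm z)\<^sup>2)"
    using s1 by (intro mult_left_mono) auto
  also have "\<dots> = (sqrt (real CARD('n) * real CARD('m)) * m * norm z)\<^sup>2"
    by (simp add: power_mult_distrib mult_ac)
  finally have "norm (v x - v y) \<le> sqrt (real CARD('n) * real CARD('m)) * m * norm z"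
    by (rule power2_le_imp_le) (use \<open>0 \<le> m\<close> in simp)
  then show "dist (v x) (v y) \<le> sqrt (real CARD('n) * real CARD('m)) * m * dist x y"
    by (simp add: dist_norm z_def)
qed (use assms in simp)

text \<open>A simplex is an intersection of half-spaces, and a point of it off the bounding
  hyperplanes satisfies all inequalities strictly. Whole hyperplanes are recorded rather than faces:
  they are null, and a line not contained in one meets it at most once.\<close>

lemma poly_domain_skeleton:
  fixes \<Omega> :: "(real^'d) set"
  assumes "poly_domain_triang \<Omega> Th"
  obtains HH :: "((real^'d) \<times> real) set" where "finite HH" "\<And>a b. (a, b) \<in> HH \<Longrightarrow> a \<noteq> 0"
    "\<And>x. x \<in> \<Union>Th \<Longrightarrow> (\<And>a b. (a, b) \<in> HH \<Longrightarrow> a \<bullet> x \<noteq> b) \<Longrightarrow> \<exists>K\<in>Th. x \<in> interior K"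
proof -
  have Th: "finite Th" "\<And>K. K \<in> Th \<Longrightarrow> d_simplex K"
    using assms by (auto simp: poly_domain_triang_def triangulation_def)
  have "\<exists>H :: ((real^'d) \<times> real) set. finite H \<and> (\<forall>(a,b)\<in>H. a \<noteq> 0) \<and> K = {x. \<forall>(a,b)\<in>H. a \<bullet> x \<le> b}" if "K \<in> Th" for K
  proof -
    have "polyhedron K"
      using Th(2)[OF that] by (auto simp: d_simplex_def polyhedron_convex_hull)
    then obtain F where F: "finite F" "K = \<Inter>F" "\<forall>h\<in>F. \<exists>a b. a \<noteq> 0 \<and> h = {x. a \<bullet> x \<le> b}"
      unfolding polyhedron_def by blast
    from F(3) have "\<forall>h\<in>F. \<exists>p :: (real^'d) \<times> real. fst p \<noteq> 0 \<and> h = {x. fst p \<bullet> x \<le> snd p}" by auto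
    from bchoice[OF this] obtain p
      where p: "\<And>h. h \<in> F \<Longrightarrow> fst (p h) \<noteq> 0 \<and> h = {x. fst (p h) \<bullet> x \<le> snd (p h)}" by blast
    have "K = {x. \<forall>(a,b)\<in>p ` F. a \<bullet> x \<le> b}"
      unfolding F(2) case_prod_unfold using p by blast
    moreover have "\<forall>(a,b)\<in>p ` F. a \<noteq> 0" unfolding case_prod_unfold using p by blast
    ultimately show ?thesis using F(1) by (intro exI[of _ "p ` F"]) auto
  qed
  then have "\<forall>K\<in>Th. \<exists>H :: ((real^'d) \<times> real) set. finite H \<and> (\<forall>(a,b)\<in>H. a \<noteq> 0) \<and> K = {x. \<forall>(a,b)\<in>H. a \<bullet> x \<le> b}" by blast
  then obtain H :: "(real^'d) set \<Rightarrow> ((real^'d) \<times> real) set"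
    where H0: "\<forall>K\<in>Th. finite (H K) \<and> (\<forall>(a,b)\<in>H K. a \<noteq> 0) \<and> K = {x. \<forall>(a,b)\<in>H K. a \<bullet> x \<le> b}"
    by (rule bchoice[THEN exE])
  have H: "finite (H K)" "\<forall>(a,b)\<in>H K. a \<noteq> 0" "K = {x. \<forall>(a,b)\<in>H K. a \<bullet> x \<le> b}" if "K \<in> Th" for K
    using bspec[OF H0 that] by simp_all
  show thesis
  proof (rule that[of "\<Union>(H ` Th)"])
    show "finite (\<Union>(H ` Th))" using Th H by auto
    show "a \<noteq> 0" if "(a, b) \<in> \<Union>(H ` Th)" for a b using that H(2) by blast
    fix x assume x: "x \<in> \<Union>Th" and ne: "\<And>a b. (a, b) \<in> \<Union>(H ` Th) \<Longrightarrow> a \<bullet> x \<noteq> b"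
    then obtain K where K: "K \<in> Th" "x \<in> K" by blast
    let ?O = "\<Inter>(a,b)\<in>H K. {x. a \<bullet> x < b}"
    have "open ?O" using H(1)[OF K(1)] by (auto simp: open_halfspace_lt)
    moreover have "?O \<subseteq> K" by (subst H(3)[OF K(1)]) force
    moreover have "x \<in> ?O"
    proof -
      have "a \<bullet> x < b" if "(a,b) \<in> H K" for a b
      proof -
        have "a \<bullet> x \<le> b" using K(2) that H(3)[OF K(1)] by blast
        moreover have "a \<bullet> x \<noteq> b" using ne[of a b] that K by blast
        ultimately show ?thesis by simp
      qed
      then show ?thesis by auto
    qed
    ultimately have "x \<in> interior K" by (meson interiorI)
    then show "\<exists>K\<in>Th. x \<in> interior K" using K by blast
  qed
qed

lemma poly_domain_facts:
  fixes \<Omega> :: "(real^'d) set"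
  assumes P: "poly_domain_triang \<Omega> Th"
  shows "open \<Omega>" "bounded \<Omega>" "\<Omega> \<noteq> {}" "finite Th" "\<And>K. K \<in> Th \<Longrightarrow> compact K"
    "closed (\<Union>Th)" "closure \<Omega> \<subseteq> \<Union>Th" "\<And>K. K \<in> Th \<Longrightarrow> interior K \<subseteq> \<Omega>"
proof -
  show 1: "open \<Omega>" "bounded \<Omega>" "\<Omega> \<noteq> {}" "finite Th"
    using P by (auto simp: poly_domain_triang_def triangulation_def)
  show comp: "compact K" if "K \<in> Th" for K
  proof -
    have "d_simplex K" using P that by (auto simp: poly_domain_triang_def triangulation_def)
    then show ?thesis by (auto simp: d_simplex_def finite_imp_compact_convex_hull)
  qed
  then show cl: "closed (\<Union>Th)" using 1 by (intro closed_Union) (auto simp: compact_imp_closed)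
  have \<Omega>: "\<Omega> = interior (\<Union>Th)" using P by (simp add: poly_domain_triang_def)
  then show "closure \<Omega> \<subseteq> \<Union>Th" using cl by (simp add: closure_minimal interior_subset)
  show "interior K \<subseteq> \<Omega>" if "K \<in> Th" for K
    unfolding \<Omega> using that by (intro interior_mono) auto
qed

lemma negligible_skeleton:
  fixes HH :: "((real^'d) \<times> real) set"
  assumes "finite HH" "\<And>a b. (a, b) \<in> HH \<Longrightarrow> a \<noteq> 0"
  shows "AE x in lebesgue. \<forall>(a,b)\<in>HH. a \<bullet> x \<noteq> b"
proof -
  have "AE x in lebesgue. a \<bullet> x \<noteq> b" if "(a,b) \<in> HH" for a b
  proof -
    have "{x. a \<bullet> x = b} \<in> null_sets lebesgue"
      using negligible_hyperplane[of a b] assms(2)[OF that] by (simp add: negligible_iff_null_sets)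
    from AE_not_in[OF this] show ?thesis by simp
  qed
  then have "AE x in lebesgue. \<forall>p\<in>HH. fst p \<bullet> x \<noteq> snd p"
    using assms(1) by (subst AE_ball_countable) (auto simp: countable_finite)
  then show ?thesis by (simp add: case_prod_unfold)
qed

text \<open>The boundary of a general open set can have positive measure. Here the simplices cover
  the closure and have their interiors inside \<open>\<Omega>\<close>, so the boundary lies on
  finitely many hyperplanes.\<close>

lemma AE_not_boundary:
  fixes \<Omega> :: "(real^'d) set"
  assumes P: "poly_domain_triang \<Omega> Th"
  shows "AE x in lebesgue. x \<in> \<Omega> \<or> x \<notin> closure \<Omega>"
proof -
  obtain HH :: "((real^'d) \<times> real) set" where HH: "finite HH" "\<And>a b. (a, b) \<in> HH \<Longrightarrow> a \<noteq> 0"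
    "\<And>x. x \<in> \<Union>Th \<Longrightarrow> (\<And>a b. (a, b) \<in> HH \<Longrightarrow> a \<bullet> x \<noteq> b) \<Longrightarrow> \<exists>K\<in>Th. x \<in> interior K"
    using poly_domain_skeleton[OF P] by blast
  have "AE x in lebesgue. \<forall>(a,b)\<in>HH. a \<bullet> x \<noteq> b" by (rule negligible_skeleton[OF HH(1,2)])
  then show ?thesis
  proof eventually_elim
    case (elim x)
    show ?case
    proof (cases "x \<in> closure \<Omega>")
      case True
      then have "\<exists>K\<in>Th. x \<in> interior K" using poly_domain_facts(7)[OF P] elim by (intro HH(3)) auto
      then show ?thesis using poly_domain_facts(8)[OF P] by blast
    qed simp
  qed
qed

lemma AE_le_if_esssup_le:
  fixes f :: "'a \<Rightarrow> real"
  assumes "esssup M (\<lambda>x. ereal (f x)) \<le> ereal c"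
  shows "AE x in M. f x \<le> c"
  using esssup_AE[where f = "\<lambda>x. ereal (f x)" and M = M]
proof eventually_elim
  case (elim x)
  from order_trans[OF this assms] show ?case by simp
qed

lemma jac_component:
  "jac v x $ i $ j = frechet_derivative v (at x) (axis j 1) $ i"
  by (simp add: jac_def matrix_def)

text \<open>Where \<open>v\<close> is not differentiable, \<open>frechet_derivative\<close> is an
  arbitrary choice. Almost everywhere, however, the entry is a limit of continuous difference
  quotients, and completeness of \<open>lebesgue\<close> transfers measurability.\<close>

lemma borel_measurable_jac:
  fixes v :: "real^'d \<Rightarrow> real^'d"
  assumes v: "L-lipschitz_on UNIV v"
  shows "(\<lambda>x. jac v x $ i $ j) \<in> borel_measurable lebesgue"
proof -
  have cont: "continuous_on UNIV v" by (rule lipschitz_on_continuous_on[OF v])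
  let ?q = "\<lambda>n x. (v (x + (1 / Suc n) *\<^sub>R axis j 1) $ i - v x $ i) / (1 / Suc n)"
  have "?q n \<in> borel_measurable borel" for n
    by (intro borel_measurable_continuous_onI continuous_intros continuous_on_compose2[OF cont]) auto
  then have "(\<lambda>x. lim (\<lambda>n. ?q n x)) \<in> borel_measurable borel"
    by (rule borel_measurable_lim_metric)
  then have meas: "(\<lambda>x. lim (\<lambda>n. ?q n x)) \<in> borel_measurable lebesgue"
    using measurable_completion[of _ lborel borel] by simp
  have "AE x in lebesgue. lim (\<lambda>n. ?q n x) = jac v x $ i $ j"
    using AE_differentiable_lipschitz_vec[OF v]
  proof eventually_elim
    case (elim x)
    let ?D = "\<lambda>h. frechet_derivative v (at x) h $ i"
    have der: "((\<lambda>x. v x $ i) has_derivative ?D) (at x)" by (rule has_derivative_vec_component[OF elim])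
    then interpret bounded_linear ?D by (rule has_derivative_bounded_linear)
    have "((\<lambda>t. x + t *\<^sub>R axis j 1) has_derivative (\<lambda>t. t *\<^sub>R axis j 1)) (at (0::real))"
      by (auto intro!: derivative_eq_intros)
    from diff_chain_at[OF this, of "\<lambda>x. v x $ i" ?D] der
    have "((\<lambda>t. v (x + t *\<^sub>R axis j 1) $ i) has_derivative (\<lambda>t. ?D (t *\<^sub>R axis j 1))) (at 0)"
      by (simp add: o_def)
    then have "((\<lambda>t. v (x + t *\<^sub>R axis j 1) $ i) has_real_derivative ?D (axis j 1)) (at 0)"
      unfolding has_field_derivative_def by (rule has_derivative_eq_rhs) (auto simp: scaleR)
    then have lim: "(\<lambda>t. (v (x + t *\<^sub>R axis j 1) $ i - v x $ i) / t) \<midarrow>0\<rightarrow> ?D (axis j 1)"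
      by (simp add: DERIV_def)
    have "filterlim (\<lambda>n. 1 / real (Suc n)) (at 0) sequentially"
      using LIMSEQ_Suc[OF lim_1_over_n] by (auto simp: filterlim_at)
    from filterlim_compose[OF lim this]
    have "(\<lambda>n. ?q n x) \<longlonglongrightarrow> ?D (axis j 1)" .
    then show ?case by (simp add: jac_component limI)
  qed
  with meas show ?thesis by (rule borel_measurable_AE)
qed

lemma frechet_derivative_locally_zero:
  assumes "open S" "x \<in> S" "\<And>y. y \<in> S \<Longrightarrow> f y = 0" "(f has_derivative f') (at x)"
  shows "f' = (\<lambda>h. 0)"
proof -
  have "(f has_derivative (\<lambda>h. 0)) (at x)"
    by (rule has_derivative_transform_within_open[OF has_derivative_const assms(1,2)]) (use assms(3) in auto)
  then show ?thesis using assms(4) has_derivative_unique by blast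
qed

text \<open>The seminorm sees only \<open>\<Omega>\<close>. Off the closure the derivative vanishes
  with \<open>v\<close>, and the boundary is null, so the bound on the partial derivatives holds
  almost everywhere in the whole space. The resulting Lipschitz constant is therefore independent of
  the shape of \<open>\<Omega>\<close>.\<close>

lemma W1inf_semi_lipschitz:
  fixes \<Omega> :: "(real^'d) set"
  assumes P: "poly_domain_triang \<Omega> Th" and v: "L-lipschitz_on UNIV v" and zero: "\<And>x. x \<notin> \<Omega> \<Longrightarrow> v x = 0"
    and m: "0 \<le> m" "W1inf_semi \<Omega> v \<le> ereal m"
  shows "AE x in lebesgue_on \<Omega>. v differentiable (at x) \<and> (\<forall>i j. \<bar>jac v x $ i $ j\<bar> \<le> m)"
    and "(real CARD('d) * m)-lipschitz_on UNIV v"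
proof -
  have \<Omega>m: "\<Omega> \<in> sets lebesgue" using poly_domain_facts(1)[OF P] by (simp add: borel_open)
  have diff: "AE x in lebesgue. v differentiable (at x)" by (rule AE_differentiable_lipschitz_vec[OF v])
  have "AE x in lebesgue_on \<Omega>. \<bar>jac v x $ i $ j\<bar> \<le> m" for i j
  proof (rule AE_le_if_esssup_le, rule order_trans[OF _ m(2)])
    show "esssup (lebesgue_on \<Omega>) (\<lambda>x. ereal \<bar>jac v x $ i $ j\<bar>) \<le> W1inf_semi \<Omega> v"
      unfolding W1inf_semi_def by (rule SUP_upper2[of "(i,j)"]) auto
  qed
  then have "AE x in lebesgue_on \<Omega>. \<forall>i j. \<bar>jac v x $ i $ j\<bar> \<le> m" by (simp add: AE_all_countable)
  moreover have "AE x in lebesgue_on \<Omega>. v differentiable (at x)"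
    unfolding AE_lebesgue_on_iff[OF \<Omega>m] using diff by eventually_elim simp
  ultimately show *: "AE x in lebesgue_on \<Omega>. v differentiable (at x) \<and> (\<forall>i j. \<bar>jac v x $ i $ j\<bar> \<le> m)"
    by eventually_elim simp
  have "\<bar>v (x + t *\<^sub>R axis j 1) $ i - v x $ i\<bar> \<le> m * \<bar>t\<bar>" for x t i j
  proof (rule lipschitz_directional_bound[OF lipschitz_on_vec_component[OF v] m(1)])
    from * have "AE x in lebesgue. x \<in> \<Omega> \<longrightarrow> v differentiable (at x) \<and> (\<forall>i j. \<bar>jac v x $ i $ j\<bar> \<le> m)"
      unfolding AE_lebesgue_on_iff[OF \<Omega>m] .
    with AE_not_boundary[OF P]
    show "AE x in lebesgue. \<forall>f'. ((\<lambda>x. v x $ i) has_derivative f') (at x) \<longrightarrow> \<bar>f' (axis j 1)\<bar> \<le> m"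
    proof eventually_elim
      case (elim x)
      show ?case
      proof (intro allI impI)
        fix f' assume f': "((\<lambda>x. v x $ i) has_derivative f') (at x)"
        show "\<bar>f' (axis j 1)\<bar> \<le> m"
        proof (cases "x \<in> \<Omega>")
          case True
          then have "f' = (\<lambda>h. frechet_derivative v (at x) h $ i)"
            using elim has_derivative_vec_component has_derivative_unique[OF f'] by blast
          then show ?thesis using elim True by (auto simp: jac_component)
        next
          case False
          then have "x \<in> - closure \<Omega>" using elim by auto
          moreover have "v y $ i = 0" if "y \<in> - closure \<Omega>" for y
          proof -
            have "y \<notin> \<Omega>" using that closure_subset by blast
            then show ?thesis by (simp add: zero)
          qed
          ultimately have "f' = (\<lambda>h. 0)" using frechet_derivative_locally_zero[OF _ _ _ f'] by blast
          then show ?thesis using m by simp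
        qed
      qed
    qed
  qed
  from lipschitz_vec_of_partial_bounds[OF m(1) this]
  show "(real CARD('d) * m)-lipschitz_on UNIV v" by (simp add: real_sqrt_mult)
qed

text \<open>The hypothesis \<open>dt * |u| \<le> 1/8\<close> already forces the seminorm, and hence (by boundedness of the
  domain and the zero boundary values) the full norm, to be finite; so \<open>real_of_ereal\<close> is harmless.\<close>

lemma velocity_bounds:
  fixes \<Omega> :: "(real^'d) set"
  assumes P: "poly_domain_triang \<Omega> Th" and V: "velocity_field \<Omega> T u" and d3: "CARD('d) \<le> 3"
    and dt: "0 < dt" "ereal dt * C_W1inf_semi \<Omega> T u \<le> ereal (1/8)" and t: "t \<in> {0..T}"
  defines "a \<equiv> real_of_ereal (C_W1inf_norm \<Omega> T u)"
  obtains \<Lambda> m where "0 \<le> m" "m \<le> a" "dt * m \<le> 1/8" "\<Lambda>-lipschitz_on UNIV (u t)" "2 * dt * \<Lambda> \<le> 3/4"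
    "AE x in lebesgue_on \<Omega>. u t differentiable (at x) \<and> (\<forall>i j. \<bar>jac (u t) x $ i $ j\<bar> \<le> m)"
    "AE x in lebesgue_on \<Omega>. norm (u t x) \<le> 3 * a"
proof -
  let ?S = "C_W1inf_semi \<Omega> T u"
  have \<Omega>m: "\<Omega> \<in> sets lebesgue" using poly_domain_facts(1)[OF P] by (simp add: borel_open)
  have "emeasure lebesgue \<Omega> \<noteq> 0"
    using open_not_negligible[OF poly_domain_facts(1,3)[OF P]] \<Omega>m by (auto simp: negligible_iff_emeasure0)
  \<comment> \<open>An essential supremum of a nonnegative function is certain to be nonnegative
    only if the underlying space is not null.\<close>
  then have nontriv: "\<not> (AE x in lebesgue_on \<Omega>. False)"
    using \<Omega>m by (auto simp: AE_lebesgue_on_iff AE_iff_null_sets[symmetric] completion.AE_iff_null_sets null_sets_def)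
  have lip: "\<exists>L. L-lipschitz_on UNIV (u s)" and zero: "x \<notin> \<Omega> \<Longrightarrow> u s x = 0" if "s \<in> {0..T}" for s x
    using V that by (auto simp: velocity_field_def)
  have semi_le: "W1inf_semi \<Omega> (u s) \<le> ?S" if "s \<in> {0..T}" for s
    unfolding C_W1inf_semi_def using that by (intro SUP_upper2[of s]) auto
  have semi_nonneg: "0 \<le> ?S"
  proof -
    have "AE x in lebesgue_on \<Omega>. ereal \<bar>jac (u t) x $ i $ i\<bar> \<le> ?S" for i :: 'd
    proof -
      have "esssup (lebesgue_on \<Omega>) (\<lambda>x. ereal \<bar>jac (u t) x $ i $ i\<bar>) \<le> ?S"
        using semi_le[OF t] unfolding W1inf_semi_def
        by (rule order_trans[rotated]) (rule SUP_upper2[of "(i,i)"], auto)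
      with esssup_AE[where f = "\<lambda>x. ereal \<bar>jac (u t) x $ i $ i\<bar>" and M = "lebesgue_on \<Omega>"]
      show ?thesis by (auto elim!: eventually_mono)
    qed
    from this[of undefined] have "AE x in lebesgue_on \<Omega>. 0 \<le> ?S"
    proof eventually_elim
      case (elim x)
      show ?case by (rule order_trans[OF _ elim]) simp
    qed
    then show ?thesis using nontriv by (auto intro: ccontr)
  qed
  have "?S \<noteq> \<infinity>" using dt by auto
  then obtain m where m: "?S = ereal m" using semi_nonneg by (cases ?S) auto
  then have m0: "0 \<le> m" using semi_nonneg by simp
  have dtm: "dt * m \<le> 1/8" using dt(2) m by simp
  define \<Lambda> where "\<Lambda> = real CARD('d) * m"
  have AEjac: "AE x in lebesgue_on \<Omega>. u s differentiable (at x) \<and> (\<forall>i j. \<bar>jac (u s) x $ i $ j\<bar> \<le> m)"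
    and \<Lambda>: "\<Lambda>-lipschitz_on UNIV (u s)" if "s \<in> {0..T}" for s
    using W1inf_semi_lipschitz[OF P _ zero[OF that] m0] lip[OF that] semi_le[OF that] m
    by (auto simp: \<Lambda>_def)
  obtain B where B: "0 < B" "\<And>x. x \<in> \<Omega> \<Longrightarrow> norm x \<le> B"
    using poly_domain_facts(2)[OF P] by (auto simp: bounded_pos)
  have "\<Omega> \<noteq> UNIV" using poly_domain_facts(2)[OF P] not_bounded_UNIV by auto
  \<comment> \<open>All velocities vanish at \<open>z\<close>; with the common Lipschitz constant
    and bounded \<open>\<Omega>\<close> this bounds them uniformly in time.\<close>
  then obtain z where z: "z \<notin> \<Omega>" by blast
  define c where "c = \<Lambda> * (B + norm z)"
  have \<Lambda>0: "0 \<le> \<Lambda>" using m0 by (simp add: \<Lambda>_def)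
  have uc: "norm (u s x) \<le> c" if "s \<in> {0..T}" "x \<in> \<Omega>" for s x
  proof -
    have "norm (u s x) \<le> \<Lambda> * dist x z"
      using lipschitz_onD[OF \<Lambda>[OF that(1)], of x z] zero[OF that(1) z] by simp
    also have "\<dots> \<le> c" unfolding c_def using B(2)[OF that(2)] \<Lambda>0
      by (intro mult_left_mono) (auto simp: dist_norm intro: order_trans[OF norm_triangle_ineq4])
    finally show ?thesis .
  qed
  have comp_le: "esssup (lebesgue_on \<Omega>) (\<lambda>x. ereal \<bar>u s x $ i\<bar>) \<le> C_W1inf_norm \<Omega> T u" if "s \<in> {0..T}" for s i
    unfolding C_W1inf_norm_def
  proof (rule SUP_upper2[OF that])
    show "esssup (lebesgue_on \<Omega>) (\<lambda>x. ereal \<bar>u s x $ i\<bar>) \<le> W1inf_norm \<Omega> (u s)"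
      unfolding W1inf_norm_def by (rule max.coboundedI1) (rule SUP_upper, simp)
  qed
  have norm_le: "C_W1inf_norm \<Omega> T u \<le> ereal (max c m)"
    unfolding C_W1inf_norm_def
  proof (rule SUP_least)
    fix s assume s: "s \<in> {0..T}"
    have "esssup (lebesgue_on \<Omega>) (\<lambda>x. ereal \<bar>u s x $ i\<bar>) \<le> ereal (max c m)" for i
    proof (rule esssup_I)
      have "continuous_on UNIV (\<lambda>x. \<bar>u s x $ i\<bar>)"
        by (intro continuous_intros lipschitz_on_continuous_on[OF \<Lambda>[OF s]])
      then have "(\<lambda>x. \<bar>u s x $ i\<bar>) \<in> borel_measurable lebesgue"
        by (intro measurable_completion) (simp add: borel_measurable_continuous_onI)
      then show "(\<lambda>x. ereal \<bar>u s x $ i\<bar>) \<in> borel_measurable (lebesgue_on \<Omega>)"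
        by (intro borel_measurable_ereal measurable_restrict_space1)
      have "\<bar>u s x $ i\<bar> \<le> max c m" if "x \<in> \<Omega>" for x
        using component_le_norm_cart[of "u s x" i] uc[OF s that] by linarith
      then show "AE x in lebesgue_on \<Omega>. ereal \<bar>u s x $ i\<bar> \<le> ereal (max c m)"
        using \<Omega>m by (simp add: AE_lebesgue_on_iff del: ereal_max)
    qed
    moreover have "W1inf_semi \<Omega> (u s) \<le> ereal (max c m)"
      using semi_le[OF s] unfolding m by (rule order_trans) simp
    ultimately show "W1inf_norm \<Omega> (u s) \<le> ereal (max c m)"
      unfolding W1inf_norm_def by (auto intro!: SUP_least simp del: ereal_max)
  qed
  have mle: "ereal m \<le> C_W1inf_norm \<Omega> T u"
    unfolding m[symmetric] C_W1inf_norm_def C_W1inf_semi_def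
  proof (rule SUP_mono)
    fix s assume "s \<in> {0..T}"
    then show "\<exists>r\<in>{0..T}. W1inf_semi \<Omega> (u s) \<le> W1inf_norm \<Omega> (u r)"
      by (intro bexI[of _ s]) (simp_all add: W1inf_norm_def)
  qed
  then have a: "C_W1inf_norm \<Omega> T u = ereal a"
    using norm_le m0 unfolding a_def by (cases "C_W1inf_norm \<Omega> T u") (auto simp del: ereal_max)
  have ma: "m \<le> a" using mle by (simp add: a)
  have "AE x in lebesgue_on \<Omega>. \<bar>u t x $ i\<bar> \<le> a" for i
    by (rule AE_le_if_esssup_le) (use comp_le[OF t, of i] a in simp)
  then have "AE x in lebesgue_on \<Omega>. \<forall>i. \<bar>u t x $ i\<bar> \<le> a" by (simp add: AE_all_countable)
  then have ua: "AE x in lebesgue_on \<Omega>. norm (u t x) \<le> 3 * a"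
  proof eventually_elim
    case (elim x)
    have "norm (u t x) \<le> (\<Sum>i\<in>UNIV. \<bar>u t x $ i\<bar>)" by (rule norm_le_l1_cart)
    also have "\<dots> \<le> (\<Sum>i\<in>(UNIV::'d set). a)" using elim by (intro sum_mono) auto
    also have "\<dots> \<le> 3 * a" using d3 ma m0 by (simp add: mult_right_mono)
    finally show ?case .
  qed
  \<comment> \<open>The dimension bound and the bound 1/8 meet here: even for the double step
    \<open>2 * dt\<close> the displacement has Lipschitz constant at most 3/4.\<close>
  have "real CARD('d) * (dt * m) \<le> 3 * (1/8)" using d3 dtm dt m0 by (intro mult_mono) auto
  then have "2 * dt * \<Lambda> \<le> 3/4" by (simp add: \<Lambda>_def algebra_simps)
  from that[OF m0 ma dtm \<Lambda>[OF t] this AEjac[OF t] ua] show thesis .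
qed

section \<open>The inner product of square-integrable functions\<close>

text \<open>Values in a Euclidean space let one calculus serve both functions and their gradients.
  Functions are not identified almost everywhere, so \<open>nrm\<close> is only a seminorm.\<close>

definition sq_integrable :: "'a measure \<Rightarrow> ('a \<Rightarrow> 'b::euclidean_space) \<Rightarrow> bool" where
  "sq_integrable M f \<longleftrightarrow> f \<in> borel_measurable M \<and> integrable M (\<lambda>x. (norm (f x))\<^sup>2)"

definition ip :: "'a measure \<Rightarrow> ('a \<Rightarrow> 'b::euclidean_space) \<Rightarrow> ('a \<Rightarrow> 'b) \<Rightarrow> real" where
  "ip M f g = (\<integral>x. f x \<bullet> g x \<partial>M)"

definition nrm :: "'a measure \<Rightarrow> ('a \<Rightarrow> 'b::euclidean_space) \<Rightarrow> real" where
  "nrm M f = sqrt (\<integral>x. (norm (f x))\<^sup>2 \<partial>M)"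

lemma sq_integrableD:
  assumes "sq_integrable M f"
  shows "f \<in> borel_measurable M" "integrable M (\<lambda>x. (norm (f x))\<^sup>2)"
  using assms by (auto simp: sq_integrable_def)

lemma integrable_inner_sq:
  assumes "sq_integrable M f" "sq_integrable M g"
  shows "integrable M (\<lambda>x. f x \<bullet> g x)"
proof (rule Bochner_Integration.integrable_bound)
  show "integrable M (\<lambda>x. (norm (f x))\<^sup>2 + (norm (g x))\<^sup>2)"
    using assms by (auto dest: sq_integrableD)
  show "(\<lambda>x. f x \<bullet> g x) \<in> borel_measurable M"
    using assms by (auto dest: sq_integrableD intro: borel_measurable_inner)
  show "AE x in M. norm (f x \<bullet> g x) \<le> norm ((norm (f x))\<^sup>2 + (norm (g x))\<^sup>2)"
  proof (intro AE_I2)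
    fix x
    have "\<bar>f x \<bullet> g x\<bar> \<le> norm (f x) * norm (g x)" by (rule Cauchy_Schwarz_ineq2)
    also have "\<dots> \<le> (norm (f x))\<^sup>2 + (norm (g x))\<^sup>2"
      using sum_squares_bound[of "norm (f x)" "norm (g x)"]
        mult_nonneg_nonneg[OF norm_ge_zero[of "f x"] norm_ge_zero[of "g x"]] by linarith
    finally show "norm (f x \<bullet> g x) \<le> norm ((norm (f x))\<^sup>2 + (norm (g x))\<^sup>2)" by simp
  qed
qed

lemma sq_integrable_scaleR:
  assumes "sq_integrable M f"
  shows "sq_integrable M (\<lambda>x. c *\<^sub>R f x)"
  using assms by (auto simp: sq_integrable_def power_mult_distrib)

lemma sq_integrable_add:
  assumes "sq_integrable M f" "sq_integrable M g"
  shows "sq_integrable M (\<lambda>x. f x + g x)"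
proof -
  have "integrable M (\<lambda>x. (norm (f x))\<^sup>2 + 2 * (f x \<bullet> g x) + (norm (g x))\<^sup>2)"
    using assms[THEN sq_integrableD(2)] integrable_inner_sq[OF assms] by auto
  moreover have "(norm (f x + g x))\<^sup>2 = (norm (f x))\<^sup>2 + 2 * (f x \<bullet> g x) + (norm (g x))\<^sup>2" for x
    by (simp add: power2_norm_eq_inner inner_add inner_commute)
  ultimately show ?thesis using assms by (auto simp: sq_integrable_def)
qed

lemma sq_integrable_diff:
  assumes "sq_integrable M f" "sq_integrable M g"
  shows "sq_integrable M (\<lambda>x. f x - g x)"
  using sq_integrable_add[OF assms(1) sq_integrable_scaleR[OF assms(2), of "-1"]] by simp

lemma sq_integrable_cmult:
  fixes f :: "'a \<Rightarrow> real"
  assumes "sq_integrable M f"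
  shows "sq_integrable M (\<lambda>x. c * f x)"
  using sq_integrable_scaleR[OF assms, of c] by simp

lemma sq_integrable_divide:
  fixes f :: "'a \<Rightarrow> real"
  assumes "sq_integrable M f"
  shows "sq_integrable M (\<lambda>x. f x / c)"
  using sq_integrable_scaleR[OF assms, of "1/c"] by simp

lemmas sq_integrable_intros =
  sq_integrable_add sq_integrable_diff sq_integrable_scaleR sq_integrable_cmult sq_integrable_divide

lemma ip_commute: "ip M f g = ip M g f"
  by (simp add: ip_def inner_commute)

lemma ip_add_left:
  assumes "sq_integrable M f" "sq_integrable M g" "sq_integrable M h"
  shows "ip M (\<lambda>x. f x + g x) h = ip M f h + ip M g h"
  unfolding ip_def inner_add_left using assms by (intro Bochner_Integration.integral_add integrable_inner_sq)

lemma ip_scaleR_left: "ip M (\<lambda>x. c *\<^sub>R f x) h = c * ip M f h"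
  by (simp add: ip_def)

lemma ip_cmult_left: "ip M (\<lambda>x. c * f x) h = c * ip M f h" for f :: "'a \<Rightarrow> real"
  using ip_scaleR_left[of M c f h] by simp

lemma ip_diff_left:
  assumes "sq_integrable M f" "sq_integrable M g" "sq_integrable M h"
  shows "ip M (\<lambda>x. f x - g x) h = ip M f h - ip M g h"
  unfolding ip_def inner_diff_left using assms by (intro Bochner_Integration.integral_diff integrable_inner_sq)

lemma nrm_nonneg [simp]: "0 \<le> nrm M f"
  by (simp add: nrm_def integral_nonneg_AE)

lemma nrm_power2: "(nrm M f)\<^sup>2 = (\<integral>x. (norm (f x))\<^sup>2 \<partial>M)"
  by (simp add: nrm_def integral_nonneg_AE)

lemma ip_self: "ip M f f = (nrm M f)\<^sup>2"
  by (simp add: nrm_power2 ip_def power2_norm_eq_inner)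

lemma nrm_scaleR: "nrm M (\<lambda>x. c *\<^sub>R f x) = \<bar>c\<bar> * nrm M f"
  by (simp add: nrm_def power_mult_distrib real_sqrt_mult)

lemma nrm_cmult: "nrm M (\<lambda>x. c * f x) = \<bar>c\<bar> * nrm M f" for f :: "'a \<Rightarrow> real"
  using nrm_scaleR[of M c f] by simp

lemma nrm_diff_commute: "nrm M (\<lambda>x. f x - g x) = nrm M (\<lambda>x. g x - f x)"
  by (simp add: nrm_def norm_minus_commute)

lemma nrm_add_power2:
  assumes "sq_integrable M f" "sq_integrable M g"
  shows "(nrm M (\<lambda>x. f x + g x))\<^sup>2 = (nrm M f)\<^sup>2 + 2 * ip M f g + (nrm M g)\<^sup>2"
proof -
  have "(norm (f x + g x))\<^sup>2 = (norm (f x))\<^sup>2 + 2 * (f x \<bullet> g x) + (norm (g x))\<^sup>2" for x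
    by (simp add: power2_norm_eq_inner inner_add inner_commute)
  then show ?thesis
    using assms integrable_inner_sq[OF assms]
    by (simp add: nrm_power2 ip_def sq_integrable_def)
qed

lemma nrm_diff_power2:
  assumes "sq_integrable M f" "sq_integrable M g"
  shows "(nrm M (\<lambda>x. f x - g x))\<^sup>2 = (nrm M f)\<^sup>2 - 2 * ip M f g + (nrm M g)\<^sup>2"
  using nrm_add_power2[OF assms(1) sq_integrable_scaleR[OF assms(2), of "-1"]]
    ip_scaleR_left[of M "-1" g f] nrm_scaleR[of M "-1" g]
  by (simp add: ip_commute[of M f])

lemma ip_Cauchy_Schwarz:
  assumes f: "sq_integrable M f" and g: "sq_integrable M g"
  shows "\<bar>ip M f g\<bar> \<le> nrm M f * nrm M g"
proof -
  have quad: "0 \<le> (nrm M f)\<^sup>2 + 2 * t * ip M f g + t\<^sup>2 * (nrm M g)\<^sup>2" for t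
  proof -
    have "(nrm M (\<lambda>x. f x + t *\<^sub>R g x))\<^sup>2 = (nrm M f)\<^sup>2 + 2 * (t * ip M f g) + (t * nrm M g)\<^sup>2"
      using nrm_add_power2[OF f sq_integrable_scaleR[OF g, of t]] ip_scaleR_left[of M t g f]
      by (simp add: nrm_scaleR ip_commute[of M f] power_mult_distrib)
    then show ?thesis by (simp add: power_mult_distrib flip: mult.assoc) (metis zero_le_power2)
  qed
  have "(ip M f g)\<^sup>2 \<le> (nrm M f * nrm M g)\<^sup>2"
  proof (cases "nrm M g = 0")
    case True
    have "ip M f g = 0"
    proof (rule ccontr)
      assume ne: "ip M f g \<noteq> 0"
      \<comment> \<open>This parameter turns the polynomial, linear in this case, into -1.\<close>
      have "0 \<le> (nrm M f)\<^sup>2 + 2 * (- ((nrm M f)\<^sup>2 + 1) / (2 * ip M f g)) * ip M f g"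
        using quad[of "- ((nrm M f)\<^sup>2 + 1) / (2 * ip M f g)"] True by simp
      then show False using ne by (simp add: field_simps)
    qed
    then show ?thesis by simp
  next
    case False
    then have n: "0 < (nrm M g)\<^sup>2" by simp
    have cs: "p\<^sup>2 \<le> F * q" if "0 < q" "0 \<le> F + 2 * (- p / q) * p + (- p / q)\<^sup>2 * q" for F p q :: real
    proof -
      have "F + 2 * (- p / q) * p + (- p / q)\<^sup>2 * q = F - p\<^sup>2 / q"
        using that(1) by (simp add: power_divide power2_eq_square)
      with that(2) have "p\<^sup>2 / q \<le> F" by linarith
      then show ?thesis using that(1) by (simp add: pos_divide_le_eq)
    qed
    show ?thesis using cs[OF n quad[of "- ip M f g / (nrm M g)\<^sup>2"]] by (simp add: power_mult_distrib)
  qed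
  then show ?thesis by (simp add: abs_le_square_iff[symmetric] abs_mult)
qed

lemma ip_le: "sq_integrable M f \<Longrightarrow> sq_integrable M g \<Longrightarrow> ip M f g \<le> nrm M f * nrm M g"
  using ip_Cauchy_Schwarz[of M f g] by auto

lemma nrm_triangle:
  assumes "sq_integrable M f" "sq_integrable M g"
  shows "nrm M (\<lambda>x. f x + g x) \<le> nrm M f + nrm M g"
proof (rule power2_le_imp_le)
  show "(nrm M (\<lambda>x. f x + g x))\<^sup>2 \<le> (nrm M f + nrm M g)\<^sup>2"
    using ip_le[OF assms] by (simp add: nrm_add_power2[OF assms] power2_sum)
qed simp

lemma nrm_triangle_diff:
  assumes "sq_integrable M f" "sq_integrable M g"
  shows "nrm M (\<lambda>x. f x - g x) \<le> nrm M f + nrm M g"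
  using nrm_triangle[OF assms(1) sq_integrable_scaleR[OF assms(2), of "-1"]] nrm_scaleR[of M "-1" g] by simp

lemma sq_integrable_bound:
  fixes f :: "'a \<Rightarrow> 'b::euclidean_space" and g :: "'a \<Rightarrow> 'c::euclidean_space"
  assumes "sq_integrable M g" "f \<in> borel_measurable M" "AE x in M. norm (f x) \<le> c * norm (g x)" "0 \<le> c"
  shows "sq_integrable M f" "nrm M f \<le> c * nrm M g"
proof -
  have ae: "AE x in M. (norm (f x))\<^sup>2 \<le> c\<^sup>2 * (norm (g x))\<^sup>2"
    using assms(3) by eventually_elim (simp flip: power_mult_distrib add: power_mono)
  have ig: "integrable M (\<lambda>x. c\<^sup>2 * (norm (g x))\<^sup>2)" using assms(1) by (simp add: sq_integrable_def)
  have "integrable M (\<lambda>x. (norm (f x))\<^sup>2)"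
    by (rule Bochner_Integration.integrable_bound[OF ig]) (use assms(2) ae in auto)
  then show f: "sq_integrable M f" using assms(2) by (simp add: sq_integrable_def)
  have "(\<integral>x. (norm (f x))\<^sup>2 \<partial>M) \<le> (\<integral>x. c\<^sup>2 * (norm (g x))\<^sup>2 \<partial>M)"
    using f ig ae by (intro integral_mono_AE) (auto simp: sq_integrable_def)
  then have "(nrm M f)\<^sup>2 \<le> (c * nrm M g)\<^sup>2" by (simp add: nrm_power2 power_mult_distrib)
  then show "nrm M f \<le> c * nrm M g" by (rule power2_le_imp_le) (simp add: assms(4))
qed

lemma sq_integrable_const_bound:
  assumes "finite_measure M" "f \<in> borel_measurable M" "AE x in M. norm (f x) \<le> B"
  shows "sq_integrable M f"
proof -
  have "AE x in M. norm ((norm (f x))\<^sup>2) \<le> B\<^sup>2"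
    using assms(3) by eventually_elim (simp add: power_mono)
  then have "integrable M (\<lambda>x. (norm (f x))\<^sup>2)"
    by (rule finite_measure.integrable_const_bound[OF assms(1)]) (use assms(2) in simp)
  then show ?thesis using assms(2) by (simp add: sq_integrable_def)
qed

lemma nrm_cong_AE:
  assumes "f \<in> borel_measurable M" "g \<in> borel_measurable M" "AE x in M. f x = g x"
  shows "nrm M f = nrm M g"
  unfolding nrm_def using assms by (intro arg_cong[of _ _ sqrt] integral_cong_AE) (auto elim: eventually_mono)

lemma ip_cong_AE:
  assumes "f \<in> borel_measurable M" "g \<in> borel_measurable M" "h \<in> borel_measurable M" "AE x in M. f x = g x"
  shows "ip M f h = ip M g h"
  unfolding ip_def using assms
  by (intro integral_cong_AE) (auto elim: eventually_mono intro: borel_measurable_inner)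

text \<open>G-stability of BDF2: the energy of two consecutive steps \<open>f\<close>,
  \<open>g\<close> is \<open>|f|^2 + |2 f - g|^2\<close>, and the final square is the numerical
  dissipation. Both sides are quadratic forms in three functions and are compared after expansion
  into the six inner products. Vector values allow its use for gradients as well.\<close>

lemma BDF2_identity:
  assumes f: "sq_integrable M f" and g: "sq_integrable M g" and h: "sq_integrable M h"
  shows "2 * ip M (\<lambda>x. 3 *\<^sub>R f x - 4 *\<^sub>R g x + h x) f =
    (nrm M f)\<^sup>2 + (nrm M (\<lambda>x. 2 *\<^sub>R f x - g x))\<^sup>2 - ((nrm M g)\<^sup>2 + (nrm M (\<lambda>x. 2 *\<^sub>R g x - h x))\<^sup>2)
    + (nrm M (\<lambda>x. f x - 2 *\<^sub>R g x + h x))\<^sup>2"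
proof -
  note sq = sq_integrable_intros f g h
  have "ip M (\<lambda>x. 3 *\<^sub>R f x - 4 *\<^sub>R g x + h x) f = 3 * (nrm M f)\<^sup>2 - 4 * ip M g f + ip M h f"
    by (subst ip_add_left ip_diff_left; (intro sq)?)+ (simp add: ip_scaleR_left ip_self)
  moreover have "(nrm M (\<lambda>x. 2 *\<^sub>R f x - g x))\<^sup>2 = 4 * (nrm M f)\<^sup>2 - 4 * ip M g f + (nrm M g)\<^sup>2"
    by (subst nrm_diff_power2; (intro sq)?)
      (simp add: ip_scaleR_left nrm_scaleR power_mult_distrib ip_commute[of M g f])
  moreover have "(nrm M (\<lambda>x. 2 *\<^sub>R g x - h x))\<^sup>2 = 4 * (nrm M g)\<^sup>2 - 4 * ip M h g + (nrm M h)\<^sup>2"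
    by (subst nrm_diff_power2; (intro sq)?)
      (simp add: ip_scaleR_left nrm_scaleR power_mult_distrib ip_commute[of M h g])
  moreover have "(nrm M (\<lambda>x. f x - 2 *\<^sub>R g x + h x))\<^sup>2 =
      (nrm M f)\<^sup>2 + 4 * (nrm M g)\<^sup>2 + (nrm M h)\<^sup>2 - 4 * ip M g f - 4 * ip M h g + 2 * ip M h f"
  proof -
    have "ip M (\<lambda>x. f x - 2 *\<^sub>R g x) h = ip M f h - 2 * ip M g h"
      by (subst ip_diff_left; (intro sq)?) (simp add: ip_scaleR_left)
    moreover have "(nrm M (\<lambda>x. f x - 2 *\<^sub>R g x))\<^sup>2 = (nrm M f)\<^sup>2 - 4 * ip M g f + 4 * (nrm M g)\<^sup>2"
      by (subst nrm_diff_power2; (intro sq)?)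
        (simp add: ip_commute[of M f] ip_scaleR_left nrm_scaleR power_mult_distrib)
    ultimately show ?thesis
      by (subst nrm_add_power2; (intro sq)?) (simp add: ip_commute[of M f h] ip_commute[of M g h])
  qed
  ultimately show ?thesis by simp
qed

section \<open>Finite element functions\<close>

lemma L2_eq:
  fixes \<Omega> :: "(real^'d) set"
  assumes "\<Omega> \<in> sets lebesgue"
  shows "L2ip \<Omega> f g = ip (lebesgue_on \<Omega>) f g" "L2norm \<Omega> f = nrm (lebesgue_on \<Omega>) f"
    "grad_L2norm \<Omega> f = nrm (lebesgue_on \<Omega>) (grad f)"
    "a0 \<nu> \<Omega> f g = \<nu> * ip (lebesgue_on \<Omega>) (grad f) (grad g)"
  using assms
  by (simp_all add: L2ip_def ip_def L2norm_def nrm_def grad_L2norm_def a0_def set_lebesgue_integral_def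
      integral_restrict_space)

text \<open>The gradient appears as a continuous vector field, the form from which boundedness on
  compact cells and measurability are read off.\<close>

definition C1_function :: "(real^'d \<Rightarrow> real) \<Rightarrow> bool" where
  "C1_function p \<longleftrightarrow> (\<exists>p'. continuous_on UNIV p' \<and> (\<forall>x. (p has_derivative (\<lambda>h. p' x \<bullet> h)) (at x)))"

lemma C1_const: "C1_function (\<lambda>x::real^'d. c)"
proof -
  have "(\<bullet>) (0 :: real^'d) = (\<lambda>h. 0)" by auto
  then show ?thesis unfolding C1_function_def by (intro exI[of _ "\<lambda>x. 0"]) auto
qed

lemma C1_coord: "C1_function (\<lambda>x::real^'d. x $ i)"
  unfolding C1_function_def
proof (intro exI[of _ "\<lambda>x. axis i 1"] conjI allI continuous_intros)
  fix x :: "real^'d"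
  have "((\<lambda>x. x $ i) has_derivative (\<lambda>h. h $ i)) (at x)"
    by (rule bounded_linear_imp_has_derivative[OF bounded_linear_vec_nth])
  moreover have "(\<lambda>h. h $ i) = (\<bullet>) (axis i (1::real))" by (auto simp: inner_axis')
  ultimately show "((\<lambda>x. x $ i) has_derivative (\<bullet>) (axis i 1)) (at x)" by simp
qed

lemma C1_add: "C1_function p \<Longrightarrow> C1_function q \<Longrightarrow> C1_function (\<lambda>x. p x + q x)"
  unfolding C1_function_def
proof clarify
  fix p' q' assume *: "continuous_on UNIV p'" "\<forall>x. (p has_derivative (\<bullet>) (p' x)) (at x)"
    "continuous_on UNIV q'" "\<forall>x. (q has_derivative (\<bullet>) (q' x)) (at x)"
  show "\<exists>r'. continuous_on UNIV r' \<and> (\<forall>x. ((\<lambda>x. p x + q x) has_derivative (\<bullet>) (r' x)) (at x))"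
  proof (intro exI[of _ "\<lambda>x. p' x + q' x"] conjI allI)
    fix x
    show "((\<lambda>x. p x + q x) has_derivative (\<bullet>) (p' x + q' x)) (at x)"
      using has_derivative_add[of p "(\<bullet>) (p' x)" "at x" q "(\<bullet>) (q' x)"] * by (simp add: inner_add_left[abs_def])
  qed (intro continuous_intros *)
qed

lemma C1_mult:
  assumes "C1_function p" "C1_function q"
  shows "C1_function (\<lambda>x. p x * q x)"
proof -
  obtain p' q' where *: "continuous_on UNIV p'" "\<And>x. (p has_derivative (\<bullet>) (p' x)) (at x)"
    "continuous_on UNIV q'" "\<And>x. (q has_derivative (\<bullet>) (q' x)) (at x)"
    using assms unfolding C1_function_def by blast
  have cont: "continuous_on UNIV p" "continuous_on UNIV q"
    using has_derivative_continuous[OF *(2)] has_derivative_continuous[OF *(4)]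
    by (auto simp: continuous_on_eq_continuous_within)
  show ?thesis
    unfolding C1_function_def
  proof (intro exI[of _ "\<lambda>x. p x *\<^sub>R q' x + q x *\<^sub>R p' x"] conjI allI)
    fix x
    show "((\<lambda>x. p x * q x) has_derivative (\<bullet>) (p x *\<^sub>R q' x + q x *\<^sub>R p' x)) (at x)"
      by (rule has_derivative_eq_rhs[OF has_derivative_mult[OF *(2) *(4)]])
        (auto simp: inner_add_left fun_eq_iff)
  qed (intro continuous_intros * cont)
qed

lemma C1_power: "C1_function p \<Longrightarrow> C1_function (\<lambda>x. p x ^ n)"
  by (induction n) (auto intro: C1_const C1_mult)

lemma C1_prod: "(\<And>i. i \<in> I \<Longrightarrow> C1_function (p i)) \<Longrightarrow> C1_function (\<lambda>x. \<Prod>i\<in>I. p i x)"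
  by (induction I rule: infinite_finite_induct) (auto intro: C1_const C1_mult)

lemma C1_sum: "(\<And>i. i \<in> I \<Longrightarrow> C1_function (p i)) \<Longrightarrow> C1_function (\<lambda>x. \<Sum>i\<in>I. p i x)"
  by (induction I rule: infinite_finite_induct) (auto intro: C1_const C1_add)

lemma C1_poly:
  fixes p :: "real^'d \<Rightarrow> real"
  assumes "poly_le k p"
  shows "C1_function p"
proof -
  obtain c where "p = (\<lambda>x. \<Sum>\<alpha>\<in>{\<alpha>::'d\<Rightarrow>nat. (\<Sum>i\<in>UNIV. \<alpha> i) \<le> k}. c \<alpha> * (\<Prod>i\<in>UNIV. (x$i) ^ (\<alpha> i)))"
    using assms unfolding poly_le_def by blast
  then show ?thesis by (simp add: C1_sum C1_mult C1_const C1_prod C1_power C1_coord)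
qed

lemma poly_le_linear_combination:
  assumes "poly_le k p" "poly_le k q"
  shows "poly_le k (\<lambda>x. a * p x + b * q x)"
proof -
  obtain c c' where "p = (\<lambda>x. \<Sum>\<alpha>\<in>{\<alpha>::'a\<Rightarrow>nat. (\<Sum>i\<in>UNIV. \<alpha> i) \<le> k}. c \<alpha> * (\<Prod>i\<in>UNIV. (x$i) ^ (\<alpha> i)))"
    "q = (\<lambda>x. \<Sum>\<alpha>\<in>{\<alpha>::'a\<Rightarrow>nat. (\<Sum>i\<in>UNIV. \<alpha> i) \<le> k}. c' \<alpha> * (\<Prod>i\<in>UNIV. (x$i) ^ (\<alpha> i)))"
    using assms unfolding poly_le_def by blast
  then show ?thesis
    unfolding poly_le_def
    by (intro exI[of _ "\<lambda>\<alpha>. a * c \<alpha> + b * c' \<alpha>"])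
      (simp add: sum_distrib_left sum.distrib[symmetric] distrib_right mult.assoc)
qed

lemma Psi_h_linear_combination:
  assumes "\<phi> \<in> Psi_h \<Omega> Th k" "\<psi> \<in> Psi_h \<Omega> Th k"
  shows "(\<lambda>x. a * \<phi> x + b * \<psi> x) \<in> Psi_h \<Omega> Th k"
proof -
  have "\<exists>p. poly_le k p \<and> (\<forall>x\<in>K. a * \<phi> x + b * \<psi> x = p x)" if K: "K \<in> Th" for K
  proof -
    obtain p q where "poly_le k p" "poly_le k q" "\<forall>x\<in>K. \<phi> x = p x" "\<forall>x\<in>K. \<psi> x = q x"
      using assms K unfolding Psi_h_def by blast
    then show ?thesis
      by (intro exI[of _ "\<lambda>x. a * p x + b * q x"]) (auto intro: poly_le_linear_combination)
  qed
  then show ?thesis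
    using assms unfolding Psi_h_def by (auto intro!: continuous_intros)
qed

lemma grad_eqI:
  assumes "(f has_derivative (\<lambda>h. y \<bullet> h)) (at x)"
  shows "grad f x = y"
  using frechet_derivative_at[OF assms, symmetric] by (simp add: grad_def vec_eq_iff inner_axis)

definition cell_interiors :: "(real^'d) set set \<Rightarrow> (real^'d) set" where
  "cell_interiors Th = (\<Union>K\<in>Th. interior K)"

lemma open_cell_interiors: "open (cell_interiors Th)"
  by (auto simp: cell_interiors_def)

lemma AE_cell_interiors:
  fixes \<Omega> :: "(real^'d) set"
  assumes P: "poly_domain_triang \<Omega> Th"
  shows "AE x in lebesgue. x \<in> closure \<Omega> \<longrightarrow> x \<in> cell_interiors Th"
proof -
  obtain HH :: "((real^'d) \<times> real) set" where HH: "finite HH" "\<And>a b. (a, b) \<in> HH \<Longrightarrow> a \<noteq> 0"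
    "\<And>x. x \<in> \<Union>Th \<Longrightarrow> (\<And>a b. (a, b) \<in> HH \<Longrightarrow> a \<bullet> x \<noteq> b) \<Longrightarrow> \<exists>K\<in>Th. x \<in> interior K"
    using poly_domain_skeleton[OF P] by blast
  have "AE x in lebesgue. \<forall>(a,b)\<in>HH. a \<bullet> x \<noteq> b" by (rule negligible_skeleton[OF HH(1,2)])
  then show ?thesis
  proof eventually_elim
    case (elim x)
    have "\<exists>K\<in>Th. x \<in> interior K" if "x \<in> closure \<Omega>"
      using that poly_domain_facts(7)[OF P] elim by (intro HH(3)) auto
    then show ?case by (auto simp: cell_interiors_def)
  qed
qed

text \<open>In the interior of a cell the gradient is that of a polynomial, which is bounded on the
  compact cell, and there are finitely many cells. On the skeleton \<open>grad \<phi>\<close> is an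
  arbitrary choice, which is why every claim is confined to the cell interiors.\<close>

lemma Psi_h_gradient:
  fixes \<Omega> :: "(real^'d) set"
  assumes P: "poly_domain_triang \<Omega> Th" and \<phi>: "\<phi> \<in> Psi_h \<Omega> Th k"
  shows "\<And>x. x \<in> cell_interiors Th \<Longrightarrow> (\<phi> has_derivative (\<lambda>h. grad \<phi> x \<bullet> h)) (at x)"
    and "(\<lambda>x. indicator (cell_interiors Th) x *\<^sub>R grad \<phi> x) \<in> borel_measurable borel"
    and "\<exists>B. \<forall>x\<in>cell_interiors Th. norm (grad \<phi> x) \<le> B"
proof -
  have "\<forall>K\<in>Th. \<exists>p'. continuous_on UNIV p' \<and> (\<forall>x\<in>interior K. (\<phi> has_derivative (\<lambda>h. p' x \<bullet> h)) (at x))"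
  proof
    fix K assume K: "K \<in> Th"
    then obtain p where p: "poly_le k p" "\<forall>x\<in>K. \<phi> x = p x" using \<phi> unfolding Psi_h_def by blast
    from C1_poly[OF p(1)] obtain p' where p': "continuous_on UNIV p'" "\<And>x. (p has_derivative (\<lambda>h. p' x \<bullet> h)) (at x)"
      unfolding C1_function_def by blast
    have "(\<phi> has_derivative (\<lambda>h. p' x \<bullet> h)) (at x)" if "x \<in> interior K" for x
      by (rule has_derivative_transform_within_open[OF p'(2) open_interior that])
        (use p(2) interior_subset[of K] in auto)
    then show "\<exists>p'. continuous_on UNIV p' \<and> (\<forall>x\<in>interior K. (\<phi> has_derivative (\<lambda>h. p' x \<bullet> h)) (at x))"
      using p'(1) by blast
  qed
  then obtain p' where p': "\<forall>K\<in>Th. continuous_on UNIV (p' K) \<and> (\<forall>x\<in>interior K. (\<phi> has_derivative (\<lambda>h. p' K x \<bullet> h)) (at x))"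
    by (rule bchoice[THEN exE])
  have g: "grad \<phi> x = p' K x" if "K \<in> Th" "x \<in> interior K" for K x
    using p' that by (intro grad_eqI) blast
  show "(\<phi> has_derivative (\<lambda>h. grad \<phi> x \<bullet> h)) (at x)" if "x \<in> cell_interiors Th" for x
  proof -
    obtain K where "K \<in> Th" "x \<in> interior K"
      using \<open>x \<in> cell_interiors Th\<close> by (auto simp: cell_interiors_def)
    then show ?thesis using p' g by simp
  qed
  have "continuous_on (cell_interiors Th) (grad \<phi>)"
    unfolding cell_interiors_def
  proof (rule continuous_on_open_UN)
    fix K assume K: "K \<in> Th"
    have "continuous_on (interior K) (p' K)" using p' K continuous_on_subset by blast
    then show "continuous_on (interior K) (grad \<phi>)" using g[OF K] by (simp cong: continuous_on_cong)
  qed auto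
  then show "(\<lambda>x. indicator (cell_interiors Th) x *\<^sub>R grad \<phi> x) \<in> borel_measurable borel"
    by (intro borel_measurable_continuous_on_indicator) (auto simp: open_cell_interiors)
  have "\<forall>K\<in>Th. \<exists>B. \<forall>x\<in>K. norm (p' K x) \<le> B"
  proof
    fix K assume K: "K \<in> Th"
    have "compact (p' K ` K)"
      using p' K poly_domain_facts(5)[OF P K] by (intro compact_continuous_image) (auto intro: continuous_on_subset)
    from compact_imp_bounded[OF this] show "\<exists>B. \<forall>x\<in>K. norm (p' K x) \<le> B"
      by (auto simp: bounded_iff)
  qed
  then obtain B where B: "\<forall>K\<in>Th. \<forall>x\<in>K. norm (p' K x) \<le> B K" by (rule bchoice[THEN exE])
  show "\<exists>B. \<forall>x\<in>cell_interiors Th. norm (grad \<phi> x) \<le> B"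
  proof (intro exI ballI)
    fix x assume "x \<in> cell_interiors Th"
    then obtain K where K: "K \<in> Th" "x \<in> interior K" by (auto simp: cell_interiors_def)
    then have "norm (grad \<phi> x) \<le> B K" using B interior_subset g by fastforce
    also have "\<dots> \<le> (\<Sum>K\<in>Th. \<bar>B K\<bar>)"
      using member_le_sum[of K Th "\<lambda>K. \<bar>B K\<bar>"] K poly_domain_facts(4)[OF P] by auto
    finally show "norm (grad \<phi> x) \<le> (\<Sum>K\<in>Th. \<bar>B K\<bar>)" .
  qed
qed

lemma Psi_h_bounded_measurable:
  fixes \<Omega> :: "(real^'d) set"
  assumes P: "poly_domain_triang \<Omega> Th" and \<phi>: "\<phi> \<in> Psi_h \<Omega> Th k"
  shows "\<phi> \<in> borel_measurable borel" "\<exists>B. \<forall>x. \<bar>\<phi> x\<bar> \<le> B"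
proof -
  have c: "continuous_on (closure \<Omega>) \<phi>" and z: "\<And>x. x \<notin> closure \<Omega> \<Longrightarrow> \<phi> x = 0"
    using \<phi> by (auto simp: Psi_h_def)
  have "(\<lambda>x. indicator (closure \<Omega>) x *\<^sub>R \<phi> x) = \<phi>" using z by (intro ext) (auto simp: indicator_def)
  then show "\<phi> \<in> borel_measurable borel"
    using borel_measurable_continuous_on_indicator[OF _ c] by simp
  have "compact (\<phi> ` closure \<Omega>)"
    using c poly_domain_facts(2)[OF P] by (intro compact_continuous_image) auto
  then obtain B where B: "\<And>x. x \<in> closure \<Omega> \<Longrightarrow> \<bar>\<phi> x\<bar> \<le> B"
    using compact_imp_bounded by (force simp: bounded_iff)
  have "\<bar>\<phi> x\<bar> \<le> \<bar>B\<bar>" for x using B[of x] z[of x] by (cases "x \<in> closure \<Omega>") auto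
  then show "\<exists>B. \<forall>x. \<bar>\<phi> x\<bar> \<le> B" by blast
qed

lemma finite_measure_lebesgue_on_domain:
  fixes \<Omega> :: "(real^'d) set"
  assumes P: "poly_domain_triang \<Omega> Th"
  shows "\<Omega> \<in> sets lebesgue" "finite_measure (lebesgue_on \<Omega>)"
proof -
  show 1: "\<Omega> \<in> sets lebesgue" using poly_domain_facts(1)[OF P] by (simp add: borel_open)
  have "\<Omega> \<in> lmeasurable" using poly_domain_facts(1,2)[OF P] by (simp add: lmeasurable_open)
  then show "finite_measure (lebesgue_on \<Omega>)" by (rule finite_measure_lebesgue_on)
qed

lemma borel_measurable_lebesgue_on:
  "f \<in> borel_measurable borel \<Longrightarrow> f \<in> borel_measurable (lebesgue_on S)"
  by (intro measurable_restrict_space1 measurable_completion) simp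

text \<open>Both functions are essentially bounded on a set of finite measure. The gradient agrees
  almost everywhere with its Borel cut-off to the cell interiors, and completeness of the measure
  makes the gradient itself measurable.\<close>

lemma Psi_h_sq_integrable:
  fixes \<Omega> :: "(real^'d) set"
  assumes P: "poly_domain_triang \<Omega> Th" and \<phi>: "\<phi> \<in> Psi_h \<Omega> Th k"
  shows "sq_integrable (lebesgue_on \<Omega>) \<phi>" "sq_integrable (lebesgue_on \<Omega>) (grad \<phi>)"
proof -
  note fm = finite_measure_lebesgue_on_domain[OF P]
  obtain B where B: "\<And>x. \<bar>\<phi> x\<bar> \<le> B" using Psi_h_bounded_measurable(2)[OF P \<phi>] by blast
  show "sq_integrable (lebesgue_on \<Omega>) \<phi>"
    using B by (intro sq_integrable_const_bound[OF fm(2), of _ B]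
        borel_measurable_lebesgue_on Psi_h_bounded_measurable(1)[OF P \<phi>]) auto
  let ?G = "\<lambda>x. indicator (cell_interiors Th) x *\<^sub>R grad \<phi> x"
  have "AE x in lebesgue_on \<Omega>. x \<in> cell_interiors Th"
    unfolding AE_lebesgue_on_iff[OF fm(1)] using AE_cell_interiors[OF P]
    by eventually_elim (use closure_subset in auto)
  then have eq: "AE x in lebesgue_on \<Omega>. ?G x = grad \<phi> x" by eventually_elim simp
  have "?G \<in> borel_measurable lebesgue"
    using Psi_h_gradient(2)[OF P \<phi>] by (intro measurable_completion) simp
  moreover have "AE x in lebesgue. ?G x = (if x \<in> \<Omega> then grad \<phi> x else ?G x)"
    using eq unfolding AE_lebesgue_on_iff[OF fm(1)] by eventually_elim auto
  ultimately have "(\<lambda>x. if x \<in> \<Omega> then grad \<phi> x else ?G x) \<in> borel_measurable lebesgue"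
    by (rule borel_measurable_AE)
  then have "(\<lambda>x. if x \<in> \<Omega> then grad \<phi> x else ?G x) \<in> borel_measurable (lebesgue_on \<Omega>)"
    by (rule measurable_restrict_space1)
  then have "grad \<phi> \<in> borel_measurable (lebesgue_on \<Omega>)"
    by (rule measurable_cong[THEN iffD1, rotated]) (simp add: space_restrict_space)
  moreover obtain B where "\<And>x. x \<in> cell_interiors Th \<Longrightarrow> norm (grad \<phi> x) \<le> B"
    using Psi_h_gradient(3)[OF P \<phi>] by blast
  then have "AE x in lebesgue_on \<Omega>. norm (grad \<phi> x) \<le> B"
    using \<open>AE x in lebesgue_on \<Omega>. x \<in> cell_interiors Th\<close> by (auto elim: eventually_mono)
  ultimately show "sq_integrable (lebesgue_on \<Omega>) (grad \<phi>)"
    by (intro sq_integrable_const_bound[OF fm(2)])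
qed

text \<open>Linearity can fail on the skeleton, where the derivatives are arbitrary choices; almost
  everywhere is what the inner products see.\<close>

lemma grad_linear_combination:
  fixes \<Omega> :: "(real^'d) set"
  assumes P: "poly_domain_triang \<Omega> Th" and \<phi>: "\<phi> \<in> Psi_h \<Omega> Th k" and \<psi>: "\<psi> \<in> Psi_h \<Omega> Th k"
  shows "AE x in lebesgue_on \<Omega>. grad (\<lambda>x. a * \<phi> x + b * \<psi> x) x = a *\<^sub>R grad \<phi> x + b *\<^sub>R grad \<psi> x"
proof -
  have "AE x in lebesgue_on \<Omega>. x \<in> cell_interiors Th"
    unfolding AE_lebesgue_on_iff[OF finite_measure_lebesgue_on_domain(1)[OF P]] using AE_cell_interiors[OF P]
    by eventually_elim (use closure_subset in auto)
  then show ?thesis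
  proof eventually_elim
    case (elim x)
    have "((\<lambda>x. a * \<phi> x + b * \<psi> x) has_derivative (\<lambda>h. a * (grad \<phi> x \<bullet> h) + b * (grad \<psi> x \<bullet> h))) (at x)"
      using Psi_h_gradient(1)[OF P \<phi> elim] Psi_h_gradient(1)[OF P \<psi> elim]
      by (intro has_derivative_add has_derivative_mult_right)
    then show ?case by (intro grad_eqI) (simp add: inner_add_left)
  qed
qed

text \<open>A segment starting off the finitely many hyperplanes carrying the faces meets each of them at
  most once, so the fundamental theorem of calculus applies along it.\<close>

lemma Psi_h_segment_bound:
  fixes \<Omega> :: "(real^'d) set"
  assumes P: "poly_domain_triang \<Omega> Th" and \<phi>: "\<phi> \<in> Psi_h \<Omega> Th k"
  shows "AE x in lebesgue. \<forall>w. x \<in> \<Omega> \<and> (\<forall>r\<in>{0..1}. x + r *\<^sub>R w \<in> \<Omega>) \<longrightarrow>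
    ennreal ((\<phi> (x + w) - \<phi> x)\<^sup>2) \<le> ennreal ((norm w)\<^sup>2) *
      (\<integral>\<^sup>+r. ennreal ((norm (indicator (cell_interiors Th) (x + r *\<^sub>R w) *\<^sub>R grad \<phi> (x + r *\<^sub>R w)))\<^sup>2) * indicator {0..1} r \<partial>lborel)"
proof -
  obtain HH :: "((real^'d) \<times> real) set" where HH: "finite HH" "\<And>a b. (a, b) \<in> HH \<Longrightarrow> a \<noteq> 0"
    "\<And>x. x \<in> \<Union>Th \<Longrightarrow> (\<And>a b. (a, b) \<in> HH \<Longrightarrow> a \<bullet> x \<noteq> b) \<Longrightarrow> \<exists>K\<in>Th. x \<in> interior K"
    using poly_domain_skeleton[OF P] by blast
  define G where "G x = indicator (cell_interiors Th) x *\<^sub>R grad \<phi> x" for x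
  have Gm[measurable]: "G \<in> borel_measurable borel"
    unfolding G_def using Psi_h_gradient(2)[OF P \<phi>] .
  obtain B0 where B0: "\<And>x. x \<in> cell_interiors Th \<Longrightarrow> norm (grad \<phi> x) \<le> B0"
    using Psi_h_gradient(3)[OF P \<phi>] by blast
  define B where "B = \<bar>B0\<bar>"
  have GB: "norm (G x) \<le> B" for x
    using B0[of x] by (cases "x \<in> cell_interiors Th") (auto simp: G_def B_def)
  \<comment> \<open>The exceptional set is independent of \<open>w\<close>. Later \<open>w\<close>
    is the displacement along the characteristic and depends on \<open>x\<close>.\<close>
  have "AE x in lebesgue. \<forall>(a,b)\<in>HH. a \<bullet> x \<noteq> b" by (rule negligible_skeleton[OF HH(1,2)])
  then show ?thesis
    unfolding G_def[symmetric]
  proof (eventually_elim, intro allI impI)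
    fix x w
    assume off: "\<forall>(a,b)\<in>HH. a \<bullet> x \<noteq> b" and xw: "x \<in> \<Omega> \<and> (\<forall>r\<in>{0..1}. x + r *\<^sub>R w \<in> \<Omega>)"
    define S where "S = (\<Union>(a,b)\<in>HH. {r. a \<bullet> (x + r *\<^sub>R w) = b})"
    have "finite {r. a \<bullet> (x + r *\<^sub>R w) = b}" if "(a,b) \<in> HH" for a b
    proof (cases "a \<bullet> w = 0")
      case True
      then have "{r. a \<bullet> (x + r *\<^sub>R w) = b} = {}" using off that by (auto simp: inner_add_right)
      then show ?thesis by simp
    next
      case False
      then have "{r. a \<bullet> (x + r *\<^sub>R w) = b} \<subseteq> {(b - a \<bullet> x) / (a \<bullet> w)}"
        by (auto simp: inner_add_right field_simps)
      then show ?thesis by (rule finite_subset) simp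
    qed
    then have "finite S" unfolding S_def using HH(1) by auto
    have FTC: "((\<lambda>r. G (x + r *\<^sub>R w) \<bullet> w) has_integral (\<phi> (x + 1 *\<^sub>R w) - \<phi> (x + 0 *\<^sub>R w))) {0..1}"
    proof (rule fundamental_theorem_of_calculus_interior_strong[OF \<open>finite S\<close>])
      fix r :: real assume r: "r \<in> {0<..<1} - S"
      let ?y = "x + r *\<^sub>R w"
      have "?y \<in> \<Omega>" using xw r by auto
      then have "?y \<in> \<Union>Th" using poly_domain_facts(7)[OF P] closure_subset by blast
      then have "\<exists>K\<in>Th. ?y \<in> interior K" using r by (intro HH(3)) (auto simp: S_def)
      then have y: "?y \<in> cell_interiors Th" by (auto simp: cell_interiors_def)
      have "((\<lambda>r. x + r *\<^sub>R w) has_derivative (\<lambda>t. t *\<^sub>R w)) (at r)"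
        by (auto intro!: derivative_eq_intros)
      from diff_chain_at[OF this, of \<phi> "\<lambda>h. grad \<phi> ?y \<bullet> h"] Psi_h_gradient(1)[OF P \<phi> y]
      have "((\<lambda>r. \<phi> (x + r *\<^sub>R w)) has_derivative (\<lambda>t. t * (grad \<phi> ?y \<bullet> w))) (at r)"
        by (simp add: o_def)
      then show "((\<lambda>r. \<phi> (x + r *\<^sub>R w)) has_vector_derivative G ?y \<bullet> w) (at r)"
        unfolding has_vector_derivative_def using y by (simp add: G_def)
    next
      have c: "continuous_on (closure \<Omega>) \<phi>" using \<phi> by (auto simp: Psi_h_def)
      show "continuous_on {0..1} (\<lambda>r. \<phi> (x + r *\<^sub>R w))"
        by (rule continuous_on_compose2[OF c]) (use xw closure_subset in \<open>auto intro!: continuous_intros\<close>)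
    qed simp
    \<comment> \<open>Cauchy-Schwarz on the unit interval against the constant function
      \<open>w\<close>.\<close>
    let ?M = "restrict_space lborel {0..1::real}"
    interpret finite_measure ?M
      by (rule finite_measureI) (simp add: emeasure_restrict_space space_restrict_space)
    have sq1: "sq_integrable ?M (\<lambda>r. G (x + r *\<^sub>R w))"
      using GB by (intro sq_integrable_const_bound[of _ _ B] finite_measure_axioms measurable_restrict_space1) auto
    have sq2: "sq_integrable ?M (\<lambda>r. w)"
      by (intro sq_integrable_const_bound[of _ _ "norm w"] finite_measure_axioms measurable_restrict_space1) auto
    have int: "integrable ?M (\<lambda>r. G (x + r *\<^sub>R w) \<bullet> w)" by (rule integrable_inner_sq[OF sq1 sq2])
    then have "set_integrable lborel {0..1} (\<lambda>r. G (x + r *\<^sub>R w) \<bullet> w)"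
      by (simp add: integrable_restrict_space set_integrable_def)
    from set_borel_integral_eq_integral(2)[OF this] FTC
    have "\<phi> (x + w) - \<phi> x = ip ?M (\<lambda>r. G (x + r *\<^sub>R w)) (\<lambda>r. w)"
      by (simp add: ip_def integral_restrict_space set_lebesgue_integral_def integral_unique)
    moreover have "nrm ?M (\<lambda>r. w) = norm w"
      by (simp add: nrm_def measure_restrict_space)
    ultimately have "\<bar>\<phi> (x + w) - \<phi> x\<bar> \<le> nrm ?M (\<lambda>r. G (x + r *\<^sub>R w)) * norm w"
      using ip_Cauchy_Schwarz[OF sq1 sq2] by simp
    then have "(\<phi> (x + w) - \<phi> x)\<^sup>2 \<le> (nrm ?M (\<lambda>r. G (x + r *\<^sub>R w)) * norm w)\<^sup>2"
      by (simp add: abs_le_square_iff[symmetric] abs_mult)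
    also have "\<dots> = (norm w)\<^sup>2 * (\<integral>r. (norm (G (x + r *\<^sub>R w)))\<^sup>2 \<partial>?M)"
      by (simp add: power_mult_distrib nrm_power2)
    finally have "ennreal ((\<phi> (x + w) - \<phi> x)\<^sup>2) \<le> ennreal ((norm w)\<^sup>2 * (\<integral>r. (norm (G (x + r *\<^sub>R w)))\<^sup>2 \<partial>?M))"
      by (rule ennreal_leI)
    also have "\<dots> = ennreal ((norm w)\<^sup>2) * ennreal (\<integral>r. (norm (G (x + r *\<^sub>R w)))\<^sup>2 \<partial>?M)"
      by (simp add: ennreal_mult)
    also have "ennreal (\<integral>r. (norm (G (x + r *\<^sub>R w)))\<^sup>2 \<partial>?M) = (\<integral>\<^sup>+r. ennreal ((norm (G (x + r *\<^sub>R w)))\<^sup>2) \<partial>?M)"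
      using sq1 by (intro nn_integral_eq_integral[symmetric]) (auto simp: sq_integrable_def)
    also have "\<dots> = (\<integral>\<^sup>+r. ennreal ((norm (G (x + r *\<^sub>R w)))\<^sup>2) * indicator {0..1} r \<partial>lborel)"
      by (rule nn_integral_restrict_space) simp
    finally show "ennreal ((\<phi> (x + w) - \<phi> x)\<^sup>2) \<le> ennreal ((norm w)\<^sup>2) *
        (\<integral>\<^sup>+r. ennreal ((norm (G (x + r *\<^sub>R w)))\<^sup>2) * indicator {0..1} r \<partial>lborel)" .
  qed
qed

section \<open>Composition with the characteristics\<close>

text \<open>Norms live on the completed measure over \<open>\<Omega>\<close>, whereas Tonelli and
  the volume bound are applied on \<open>lborel\<close>; this is the passage between them.\<close>

lemma nrm_power2_eq_nn_integral:
  fixes f :: "real^'d \<Rightarrow> 'b::euclidean_space"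
  assumes f: "f \<in> borel_measurable borel" "sq_integrable (lebesgue_on \<Omega>) f" and \<Omega>: "\<Omega> \<in> sets borel"
  shows "ennreal ((nrm (lebesgue_on \<Omega>) f)\<^sup>2) = (\<integral>\<^sup>+x. ennreal ((norm (f x))\<^sup>2) * indicator \<Omega> x \<partial>lborel)"
proof -
  have "ennreal ((nrm (lebesgue_on \<Omega>) f)\<^sup>2) = (\<integral>\<^sup>+x. ennreal ((norm (f x))\<^sup>2) \<partial>lebesgue_on \<Omega>)"
    unfolding nrm_power2 using f(2) by (intro nn_integral_eq_integral[symmetric]) (auto simp: sq_integrable_def)
  also have "\<dots> = (\<integral>\<^sup>+x. ennreal ((norm (f x))\<^sup>2) * indicator \<Omega> x \<partial>lebesgue)"
    using \<Omega> by (intro nn_integral_restrict_space) simp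
  also have "\<dots> = (\<integral>\<^sup>+x. ennreal ((norm (f x))\<^sup>2) * indicator \<Omega> x \<partial>lborel)"
    using f(1) \<Omega> by (intro nn_integral_completion) measurable
  finally show ?thesis .
qed

text \<open>The map differs from the identity by a map with Lipschitz constant at most 3/4, and 1/4
  is what remains.\<close>

lemma flow_expanding:
  fixes v :: "'a::euclidean_space \<Rightarrow> 'a"
  assumes v: "\<Lambda>-lipschitz_on UNIV v" and s: "0 \<le> s" "s * \<Lambda> \<le> 3/4"
  shows "(1/4) * dist x y \<le> dist (x - s *\<^sub>R v x) (y - s *\<^sub>R v y)"
proof -
  have "s * norm (v x - v y) \<le> s * (\<Lambda> * norm (x - y))"
    using lipschitz_onD[OF v, of x y] s by (intro mult_left_mono) (auto simp: dist_norm)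
  also have "\<dots> \<le> (3/4) * norm (x - y)"
    using s(2) mult_right_mono[OF s(2), of "norm (x - y)"] by (simp add: mult.assoc)
  finally have "norm (s *\<^sub>R (v x - v y)) \<le> (3/4) * norm (x - y)" using s by simp
  moreover have "norm (x - y) - norm (s *\<^sub>R (v x - v y)) \<le> norm ((x - y) - s *\<^sub>R (v x - v y))"
    by (rule norm_triangle_ineq2)
  moreover have "(x - s *\<^sub>R v x) - (y - s *\<^sub>R v y) = (x - y) - s *\<^sub>R (v x - v y)"
    by (simp add: algebra_simps)
  ultimately show ?thesis unfolding dist_norm by (simp only:)
qed

text \<open>If a point \<open>z\<close> of the characteristic through \<open>x\<close> left the domain, then \<open>v z = 0\<close> and the
  Lipschitz bound would give \<open>norm (v x) \<le> 3/4 * norm (v x)\<close>, so the characteristic is constant.\<close>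

lemma flow_stays_inside:
  fixes v :: "'a::euclidean_space \<Rightarrow> 'a"
  assumes v: "\<Lambda>-lipschitz_on UNIV v" and s: "0 \<le> s" "s * \<Lambda> \<le> 3/4"
    and zero: "\<And>x. x \<notin> \<Omega> \<Longrightarrow> v x = 0" and x: "x \<in> \<Omega>"
  shows "x - s *\<^sub>R v x \<in> \<Omega>"
proof (rule ccontr)
  assume "x - s *\<^sub>R v x \<notin> \<Omega>"
  then have "norm (v x) \<le> \<Lambda> * (s * norm (v x))"
    using lipschitz_onD[OF v, of x "x - s *\<^sub>R v x"] zero s by (simp add: dist_norm)
  also have "\<dots> \<le> (3/4) * norm (v x)"
    using mult_right_mono[OF s(2), of "norm (v x)"] by (simp add: mult_ac)
  finally have "v x = 0" by simp
  with x \<open>x - s *\<^sub>R v x \<notin> \<Omega>\<close> show False by simp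
qed

text \<open>The expansion constant 1/4 gives the volume factor \<open>2 / (1/4) = 8\<close> per
  dimension. The integral is enlarged to the whole space before the volume bound and returns to
  \<open>\<Omega>\<close> afterwards, since \<open>\<phi>\<close> vanishes off the closure and the
  boundary is null.\<close>

lemma composition_flow_bound:
  fixes \<Omega> :: "(real^'d) set"
  assumes P: "poly_domain_triang \<Omega> Th" and \<phi>: "\<phi> \<in> Psi_h \<Omega> Th k"
    and v: "\<Lambda>-lipschitz_on UNIV v" and s: "0 \<le> s" "s * \<Lambda> \<le> 3/4"
  shows "sq_integrable (lebesgue_on \<Omega>) (\<lambda>x. \<phi> (x - s *\<^sub>R v x))"
    and "nrm (lebesgue_on \<Omega>) (\<lambda>x. \<phi> (x - s *\<^sub>R v x)) \<le> sqrt (8 ^ CARD('d)) * nrm (lebesgue_on \<Omega>) \<phi>"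
proof -
  note fm = finite_measure_lebesgue_on_domain[OF P]
  have \<Omega>b[measurable]: "\<Omega> \<in> sets borel" using poly_domain_facts(1)[OF P] by simp
  let ?X = "\<lambda>x. x - s *\<^sub>R v x"
  have Xm[measurable]: "?X \<in> borel_measurable borel"
    by (intro borel_measurable_continuous_onI continuous_intros lipschitz_on_continuous_on[OF v])
  have \<phi>m[measurable]: "\<phi> \<in> borel_measurable borel" by (rule Psi_h_bounded_measurable(1)[OF P \<phi>])
  obtain B where B: "\<And>x. \<bar>\<phi> x\<bar> \<le> B" using Psi_h_bounded_measurable(2)[OF P \<phi>] by blast
  have fX[measurable]: "(\<lambda>x. \<phi> (?X x)) \<in> borel_measurable borel" by measurable
  show sq: "sq_integrable (lebesgue_on \<Omega>) (\<lambda>x. \<phi> (?X x))"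
    using B by (intro sq_integrable_const_bound[OF fm(2), of _ B] borel_measurable_lebesgue_on fX) auto
  have AE: "AE x in lborel. x \<in> \<Omega> \<or> x \<notin> closure \<Omega>"
    using AE_not_boundary[OF P] by (simp add: AE_completion_iff)
  have "ennreal ((nrm (lebesgue_on \<Omega>) (\<lambda>x. \<phi> (?X x)))\<^sup>2) = (\<integral>\<^sup>+x. ennreal ((norm (\<phi> (?X x)))\<^sup>2) * indicator \<Omega> x \<partial>lborel)"
    by (rule nrm_power2_eq_nn_integral[OF fX sq \<Omega>b])
  also have "\<dots> \<le> (\<integral>\<^sup>+x. ennreal ((norm (\<phi> (?X x)))\<^sup>2) \<partial>lborel)"
    by (intro nn_integral_mono) (auto simp: indicator_def)
  also have "\<dots> \<le> ennreal ((2 / (1/4)) ^ DIM(real^'d)) * (\<integral>\<^sup>+x. ennreal ((norm (\<phi> x))\<^sup>2) \<partial>lborel)"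
    by (rule nn_integral_expanding_le[OF Xm _ flow_expanding[OF v s]]) auto
  also have "(\<integral>\<^sup>+x. ennreal ((norm (\<phi> x))\<^sup>2) \<partial>lborel) = (\<integral>\<^sup>+x. ennreal ((norm (\<phi> x))\<^sup>2) * indicator \<Omega> x \<partial>lborel)"
    using AE by (intro nn_integral_cong_AE) (auto elim!: eventually_mono simp: indicator_def, use \<phi> in \<open>auto simp: Psi_h_def\<close>)
  also have "\<dots> = ennreal ((nrm (lebesgue_on \<Omega>) \<phi>)\<^sup>2)"
    by (rule nrm_power2_eq_nn_integral[symmetric, OF \<phi>m Psi_h_sq_integrable(1)[OF P \<phi>] \<Omega>b])
  also have "ennreal ((2 / (1/4)) ^ DIM(real^'d)) * \<dots> = ennreal ((sqrt (8 ^ CARD('d)) * nrm (lebesgue_on \<Omega>) \<phi>)\<^sup>2)"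
    by (simp add: power_mult_distrib flip: ennreal_mult)
  finally have "(nrm (lebesgue_on \<Omega>) (\<lambda>x. \<phi> (?X x)))\<^sup>2 \<le> (sqrt (8 ^ CARD('d)) * nrm (lebesgue_on \<Omega>) \<phi>)\<^sup>2"
    by simp
  then show "nrm (lebesgue_on \<Omega>) (\<lambda>x. \<phi> (?X x)) \<le> sqrt (8 ^ CARD('d)) * nrm (lebesgue_on \<Omega>) \<phi>"
    by (rule power2_le_imp_le) simp
qed

text \<open>The segment bound with \<open>w = - (s *\<^sub>R v x)\<close> dominates the squared
  difference by an average over \<open>r\<close> of squared gradients at
  \<open>x - (r * s) *\<^sub>R v x\<close>. After exchanging the integrals, each fixed
  \<open>r\<close> gives an expanding map with the same constant 1/4, and the volume bound applies
  to the gradient.\<close>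

lemma composition_flow_difference:
  fixes \<Omega> :: "(real^'d) set"
  assumes P: "poly_domain_triang \<Omega> Th" and \<phi>: "\<phi> \<in> Psi_h \<Omega> Th k"
    and v: "\<Lambda>-lipschitz_on UNIV v" and s: "0 \<le> s" "s * \<Lambda> \<le> 3/4"
    and zero: "\<And>x. x \<notin> \<Omega> \<Longrightarrow> v x = 0" and A: "0 \<le> A" "AE x in lebesgue_on \<Omega>. norm (v x) \<le> A"
  shows "nrm (lebesgue_on \<Omega>) (\<lambda>x. \<phi> (x - s *\<^sub>R v x) - \<phi> x) \<le> s * A * sqrt (8 ^ CARD('d)) * nrm (lebesgue_on \<Omega>) (grad \<phi>)"
proof -
  note fm = finite_measure_lebesgue_on_domain[OF P]
  have \<Omega>b[measurable]: "\<Omega> \<in> sets borel" using poly_domain_facts(1)[OF P] by simp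
  have \<Lambda>: "0 \<le> \<Lambda>" using v lipschitz_on_nonneg by auto
  let ?X = "\<lambda>x. x - s *\<^sub>R v x"
  have vm[measurable]: "v \<in> borel_measurable borel"
    by (intro borel_measurable_continuous_onI lipschitz_on_continuous_on[OF v])
  have \<phi>m[measurable]: "\<phi> \<in> borel_measurable borel" by (rule Psi_h_bounded_measurable(1)[OF P \<phi>])
  have dm: "(\<lambda>x. \<phi> (?X x) - \<phi> x) \<in> borel_measurable borel" by measurable
  have sq: "sq_integrable (lebesgue_on \<Omega>) (\<lambda>x. \<phi> (?X x) - \<phi> x)"
    by (intro sq_integrable_diff composition_flow_bound[OF P \<phi> v s] Psi_h_sq_integrable[OF P \<phi>])
  define G where "G x = indicator (cell_interiors Th) x *\<^sub>R grad \<phi> x" for x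
  have Gm[measurable]: "G \<in> borel_measurable borel"
    unfolding G_def using Psi_h_gradient(2)[OF P \<phi>] .
  have sub: "cell_interiors Th \<subseteq> \<Omega>" using poly_domain_facts(8)[OF P] by (auto simp: cell_interiors_def)
  have "AE x in lebesgue_on \<Omega>. x \<in> cell_interiors Th"
    unfolding AE_lebesgue_on_iff[OF fm(1)] using AE_cell_interiors[OF P]
    by eventually_elim (use closure_subset in auto)
  then have "AE x in lebesgue_on \<Omega>. G x = grad \<phi> x" by eventually_elim (simp add: G_def)
  moreover have Gm': "G \<in> borel_measurable (lebesgue_on \<Omega>)" by (rule borel_measurable_lebesgue_on[OF Gm])
  ultimately have nrmG: "nrm (lebesgue_on \<Omega>) G = nrm (lebesgue_on \<Omega>) (grad \<phi>)"
    using Psi_h_sq_integrable(2)[OF P \<phi>] by (intro nrm_cong_AE) (auto simp: sq_integrable_def)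
  have "AE x in lebesgue_on \<Omega>. norm (G x) \<le> 1 * norm (grad \<phi> x)"
    using \<open>AE x in lebesgue_on \<Omega>. G x = grad \<phi> x\<close> by eventually_elim simp
  then have sqG: "sq_integrable (lebesgue_on \<Omega>) G"
    by (rule sq_integrable_bound(1)[OF Psi_h_sq_integrable(2)[OF P \<phi>] Gm']) simp
  have seg: "AE x in lborel. x \<in> \<Omega> \<longrightarrow> ennreal ((\<phi> (?X x) - \<phi> x)\<^sup>2) \<le> ennreal ((s * A)\<^sup>2) *
      (\<integral>\<^sup>+r. ennreal ((norm (G (x - (r * s) *\<^sub>R v x)))\<^sup>2) * indicator {0..1} r \<partial>lborel)"
  proof -
    have "AE x in lebesgue. x \<in> \<Omega> \<longrightarrow> norm (v x) \<le> A" using A(2) unfolding AE_lebesgue_on_iff[OF fm(1)] .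
    with Psi_h_segment_bound[OF P \<phi>] have "AE x in lebesgue. x \<in> \<Omega> \<longrightarrow> ennreal ((\<phi> (?X x) - \<phi> x)\<^sup>2) \<le> ennreal ((s * A)\<^sup>2) *
      (\<integral>\<^sup>+r. ennreal ((norm (G (x - (r * s) *\<^sub>R v x)))\<^sup>2) * indicator {0..1} r \<partial>lborel)"
    proof (eventually_elim, intro impI)
      fix x
      assume elim: "\<forall>w. x \<in> \<Omega> \<and> (\<forall>r\<in>{0..1}. x + r *\<^sub>R w \<in> \<Omega>) \<longrightarrow>
          ennreal ((\<phi> (x + w) - \<phi> x)\<^sup>2) \<le> ennreal ((norm w)\<^sup>2) *
          (\<integral>\<^sup>+r. ennreal ((norm (indicator (cell_interiors Th) (x + r *\<^sub>R w) *\<^sub>R grad \<phi> (x + r *\<^sub>R w)))\<^sup>2) * indicator {0..1} r \<partial>lborel)"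
        "x \<in> \<Omega> \<longrightarrow> norm (v x) \<le> A" "x \<in> \<Omega>"
      have inside: "x + r *\<^sub>R (- (s *\<^sub>R v x)) \<in> \<Omega>" if r: "r \<in> {0..1}" for r
      proof -
        have "r * s * \<Lambda> \<le> 1 * (s * \<Lambda>)" using r s \<Lambda> by (simp add: mult.assoc mult_left_le_one_le)
        then have "x - (r * s) *\<^sub>R v x \<in> \<Omega>"
          using r s elim(3) zero by (intro flow_stays_inside[OF v]) auto
        then show ?thesis by simp
      qed
      have "ennreal ((\<phi> (x + - (s *\<^sub>R v x)) - \<phi> x)\<^sup>2) \<le> ennreal ((norm (- (s *\<^sub>R v x)))\<^sup>2) *
        (\<integral>\<^sup>+r. ennreal ((norm (G (x + r *\<^sub>R - (s *\<^sub>R v x))))\<^sup>2) * indicator {0..1} r \<partial>lborel)"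
        using elim(1,3) inside unfolding G_def by blast
      also have "\<dots> \<le> ennreal ((s * A)\<^sup>2) *
        (\<integral>\<^sup>+r. ennreal ((norm (G (x + r *\<^sub>R - (s *\<^sub>R v x))))\<^sup>2) * indicator {0..1} r \<partial>lborel)"
      proof (intro mult_right_mono ennreal_leI power_mono)
        show "norm (- (s *\<^sub>R v x)) \<le> s * A" using elim(2,3) s by (simp add: mult_left_mono)
      qed auto
      finally show "ennreal ((\<phi> (?X x) - \<phi> x)\<^sup>2) \<le> ennreal ((s * A)\<^sup>2) *
        (\<integral>\<^sup>+r. ennreal ((norm (G (x - (r * s) *\<^sub>R v x)))\<^sup>2) * indicator {0..1} r \<partial>lborel)" by simp
    qed
    then show ?thesis by (simp add: AE_completion_iff)
  qed
  have "ennreal ((nrm (lebesgue_on \<Omega>) (\<lambda>x. \<phi> (?X x) - \<phi> x))\<^sup>2) =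
      (\<integral>\<^sup>+x. ennreal ((norm (\<phi> (?X x) - \<phi> x))\<^sup>2) * indicator \<Omega> x \<partial>lborel)"
    by (rule nrm_power2_eq_nn_integral[OF dm sq \<Omega>b])
  also have "\<dots> \<le> (\<integral>\<^sup>+x. ennreal ((s * A)\<^sup>2) *
      (\<integral>\<^sup>+r. ennreal ((norm (G (x - (r * s) *\<^sub>R v x)))\<^sup>2) * indicator {0..1} r \<partial>lborel) \<partial>lborel)"
    using seg by (intro nn_integral_mono_AE) (auto elim!: eventually_mono simp: indicator_def)
  also have "\<dots> = ennreal ((s * A)\<^sup>2) *
      (\<integral>\<^sup>+x. (\<integral>\<^sup>+r. ennreal ((norm (G (x - (r * s) *\<^sub>R v x)))\<^sup>2) * indicator {0..1} r \<partial>lborel) \<partial>lborel)"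
    by (intro nn_integral_cmult) measurable
  also have "(\<integral>\<^sup>+x. (\<integral>\<^sup>+r. ennreal ((norm (G (x - (r * s) *\<^sub>R v x)))\<^sup>2) * indicator {0..1} r \<partial>lborel) \<partial>lborel) =
      (\<integral>\<^sup>+r. (\<integral>\<^sup>+x. ennreal ((norm (G (x - (r * s) *\<^sub>R v x)))\<^sup>2) * indicator {0..1} r \<partial>lborel) \<partial>lborel)"
    by (rule lborel_pair.Fubini') measurable
  also have "\<dots> \<le> (\<integral>\<^sup>+r. ennreal (8 ^ CARD('d)) * ennreal ((nrm (lebesgue_on \<Omega>) (grad \<phi>))\<^sup>2) * indicator {0..1::real} r \<partial>lborel)"
  proof (intro nn_integral_mono)
    fix r :: real
    show "(\<integral>\<^sup>+x. ennreal ((norm (G (x - (r * s) *\<^sub>R v x)))\<^sup>2) * indicator {0..1} r \<partial>lborel) \<le>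
      ennreal (8 ^ CARD('d)) * ennreal ((nrm (lebesgue_on \<Omega>) (grad \<phi>))\<^sup>2) * indicator {0..1} r"
    proof (cases "r \<in> {0..1}")
      case True
      have rs: "0 \<le> r * s" "r * s * \<Lambda> \<le> 3/4"
      proof -
        have "r * s * \<Lambda> \<le> 1 * (s * \<Lambda>)" using True s \<Lambda> by (simp add: mult.assoc mult_left_le_one_le)
        then show "r * s * \<Lambda> \<le> 3/4" using s by simp
      qed (use True s in simp)
      have Xm: "(\<lambda>x. x - (r * s) *\<^sub>R v x) \<in> borel_measurable borel" by measurable
      have "(\<integral>\<^sup>+x. ennreal ((norm (G (x - (r * s) *\<^sub>R v x)))\<^sup>2) \<partial>lborel) \<le>
          ennreal ((2 / (1/4)) ^ DIM(real^'d)) * (\<integral>\<^sup>+x. ennreal ((norm (G x))\<^sup>2) \<partial>lborel)"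
        by (rule nn_integral_expanding_le[OF Xm _ flow_expanding[OF v rs]]) auto
      also have "(\<integral>\<^sup>+x. ennreal ((norm (G x))\<^sup>2) \<partial>lborel) = (\<integral>\<^sup>+x. ennreal ((norm (G x))\<^sup>2) * indicator \<Omega> x \<partial>lborel)"
        using sub by (intro nn_integral_cong) (auto simp: G_def indicator_def)
      also have "\<dots> = ennreal ((nrm (lebesgue_on \<Omega>) (grad \<phi>))\<^sup>2)"
        unfolding nrmG[symmetric] by (rule nrm_power2_eq_nn_integral[symmetric, OF Gm sqG \<Omega>b])
      finally show ?thesis using True by simp
    qed simp
  qed
  also have "\<dots> = ennreal (8 ^ CARD('d)) * ennreal ((nrm (lebesgue_on \<Omega>) (grad \<phi>))\<^sup>2)"
    by (simp add: nn_integral_cmult_indicator)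
  finally have "ennreal ((nrm (lebesgue_on \<Omega>) (\<lambda>x. \<phi> (?X x) - \<phi> x))\<^sup>2) \<le>
      ennreal ((s * A)\<^sup>2) * (ennreal (8 ^ CARD('d)) * ennreal ((nrm (lebesgue_on \<Omega>) (grad \<phi>))\<^sup>2))"
    by (simp add: mult_left_mono)
  also have "\<dots> = ennreal ((s * A * sqrt (8 ^ CARD('d)) * nrm (lebesgue_on \<Omega>) (grad \<phi>))\<^sup>2)"
    by (simp add: power_mult_distrib mult.assoc flip: ennreal_mult)
  finally have "(nrm (lebesgue_on \<Omega>) (\<lambda>x. \<phi> (?X x) - \<phi> x))\<^sup>2 \<le> (s * A * sqrt (8 ^ CARD('d)) * nrm (lebesgue_on \<Omega>) (grad \<phi>))\<^sup>2"
    by simp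
  then show ?thesis by (rule power2_le_imp_le) (use s A in simp)
qed

section \<open>Jacobian determinants of the characteristics\<close>

lemma det_lipschitz:
  fixes A B :: "real^'n^'n"
  assumes "\<And>i j. \<bar>A $ i $ j\<bar> \<le> 2" "\<And>i j. \<bar>B $ i $ j\<bar> \<le> 2" "\<And>i j. \<bar>A $ i $ j - B $ i $ j\<bar> \<le> e"
  shows "\<bar>det A - det B\<bar> \<le> real (card {p. p permutes (UNIV::'n set)}) * (2 ^ CARD('n) * real CARD('n)) * e"
proof -
  have leibniz: "\<bar>of_int (sign p) * (\<Prod>i\<in>UNIV. A $ i $ p i) - of_int (sign p) * (\<Prod>i\<in>UNIV. B $ i $ p i)\<bar> \<le> (2 ^ CARD('n) * real CARD('n)) * e"
    if "p permutes UNIV" for p :: "'n \<Rightarrow> 'n"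
  proof -
    \<comment> \<open>\<open>norm_prod_diff\<close> needs factors of norm at most 1\<close>
    have half: "(\<Prod>i\<in>(UNIV::'n set). M $ i $ p i) = 2 ^ CARD('n) * (\<Prod>i\<in>UNIV. M $ i $ p i / 2)" for M :: "real^'n^'n"
      by (simp add: prod_dividef)
    have e0: "0 \<le> e" using assms(3) abs_ge_zero order_trans by blast
    have "norm ((\<Prod>i\<in>UNIV. A $ i $ p i / 2) - (\<Prod>i\<in>UNIV. B $ i $ p i / 2)) \<le> (\<Sum>i\<in>UNIV. norm (A $ i $ p i / 2 - B $ i $ p i / 2))"
      using assms(1,2) by (intro norm_prod_diff) auto
    also have "\<dots> \<le> (\<Sum>i\<in>(UNIV::'n set). e)"
    proof (intro sum_mono)
      fix i
      show "norm (A $ i $ p i / 2 - B $ i $ p i / 2) \<le> e"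
        using assms(3)[of i "p i"] e0 by (simp flip: diff_divide_distrib)
    qed
    finally have "2 ^ CARD('n) * \<bar>(\<Prod>i\<in>UNIV. A $ i $ p i / 2) - (\<Prod>i\<in>UNIV. B $ i $ p i / 2)\<bar> \<le> 2 ^ CARD('n) * (real CARD('n) * e)"
      by (intro mult_left_mono) auto
    moreover have "\<bar>of_int (sign p) * (\<Prod>i\<in>UNIV. A $ i $ p i) - of_int (sign p) * (\<Prod>i\<in>UNIV. B $ i $ p i)\<bar> =
       2 ^ CARD('n) * \<bar>(\<Prod>i\<in>UNIV. A $ i $ p i / 2) - (\<Prod>i\<in>UNIV. B $ i $ p i / 2)\<bar>"
      unfolding half[of A] half[of B] by (simp add: abs_mult sign_def flip: right_diff_distrib)
    ultimately show ?thesis by (simp add: mult.assoc)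
  qed
  have "\<bar>det A - det B\<bar> \<le> (\<Sum>p\<in>{p. p permutes (UNIV::'n set)}. (2 ^ CARD('n) * real CARD('n)) * e)"
    unfolding det_def sum_subtractf[symmetric]
    by (rule order_trans[OF sum_abs]) (intro sum_mono leibniz, simp)
  then show ?thesis by simp
qed

text \<open>A Lipschitz constant of the determinant on matrices with entries bounded by 2: Leibniz'
  formula has \<open>d!\<close> products of \<open>d\<close> factors, and a change of all entries by
  at most \<open>e\<close> changes a product by at most \<open>2^d * d * e\<close>.\<close>

definition det_const :: "'d::finite itself \<Rightarrow> real" where
  "det_const _ = real (card {p. p permutes (UNIV::'d set)}) * (2 ^ CARD('d) * real CARD('d))"

lemma det_const_nonneg: "0 \<le> det_const TYPE('d::finite)"
  by (simp add: det_const_def)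

text \<open>Where \<open>v\<close> is differentiable, the Jacobian is the identity minus
  \<open>s\<close> times that of \<open>v\<close>. The bound \<open>s * m \<le> 1/4\<close> keeps
  its entries below 2, so the Lipschitz bound for the determinant applies against the
  identity.\<close>

lemma flow_jacobian:
  fixes v :: "real^'d \<Rightarrow> real^'d"
  assumes \<Omega>: "\<Omega> \<in> sets lebesgue"
    and v: "\<Lambda>-lipschitz_on UNIV v" and s: "0 \<le> s" "s * m \<le> 1/4" and m: "0 \<le> m"
    and J: "AE x in lebesgue_on \<Omega>. v differentiable (at x) \<and> (\<forall>i j. \<bar>jac v x $ i $ j\<bar> \<le> m)"
  shows "AE x in lebesgue_on \<Omega>. \<bar>det (jac (\<lambda>x. x - s *\<^sub>R v x) x) - 1\<bar> \<le> det_const TYPE('d) * (s * m)"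
    and "(\<lambda>x. det (jac (\<lambda>x. x - s *\<^sub>R v x) x)) \<in> borel_measurable (lebesgue_on \<Omega>)"
proof -
  let ?X = "\<lambda>x. x - s *\<^sub>R v x"
  from J show "AE x in lebesgue_on \<Omega>. \<bar>det (jac ?X x) - 1\<bar> \<le> det_const TYPE('d) * (s * m)"
  proof eventually_elim
    case (elim x)
    have "(v has_derivative frechet_derivative v (at x)) (at x)" using elim frechet_derivative_works by blast
    then have "(?X has_derivative (\<lambda>h. h - s *\<^sub>R frechet_derivative v (at x) h)) (at x)"
      by (auto intro!: derivative_eq_intros)
    from frechet_derivative_at[OF this, symmetric]
    have jX: "jac ?X x $ i $ j = mat 1 $ i $ j - s * jac v x $ i $ j" for i j
      by (simp add: jac_component) (simp add: mat_def axis_def)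
    have sJ: "\<bar>s * jac v x $ i $ j\<bar> \<le> s * m" for i j
      using elim s by (auto simp: abs_mult intro: mult_left_mono)
    have I: "\<bar>(mat 1 :: real^'d^'d) $ i $ j\<bar> \<le> 1" for i j by (simp add: mat_def)
    have "\<bar>det (jac ?X x) - det (mat 1 :: real^'d^'d)\<bar> \<le> det_const TYPE('d) * (s * m)"
      unfolding det_const_def
    proof (rule det_lipschitz)
      fix i j
      show "\<bar>jac ?X x $ i $ j\<bar> \<le> 2" unfolding jX using sJ[of i j] I[of i j] s by linarith
      show "\<bar>(mat 1 :: real^'d^'d) $ i $ j\<bar> \<le> 2" using I[of i j] by linarith
      show "\<bar>jac ?X x $ i $ j - mat 1 $ i $ j\<bar> \<le> s * m" unfolding jX using sJ[of i j] by simp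
    qed
    then show ?case by (simp add: det_I)
  qed
  have "(1 + s * \<Lambda>)-lipschitz_on UNIV ?X"
  proof (rule lipschitz_onI)
    fix x y
    have "dist (?X x) (?X y) = norm ((x - y) - s *\<^sub>R (v x - v y))" by (simp add: dist_norm algebra_simps)
    also have "\<dots> \<le> norm (x - y) + s * norm (v x - v y)"
      using norm_triangle_ineq4[of "x - y" "s *\<^sub>R (v x - v y)"] s by simp
    also have "\<dots> \<le> norm (x - y) + s * (\<Lambda> * norm (x - y))"
      using lipschitz_onD[OF v, of x y] s by (intro add_left_mono mult_left_mono) (auto simp: dist_norm)
    finally show "dist (?X x) (?X y) \<le> (1 + s * \<Lambda>) * dist x y" by (simp add: dist_norm algebra_simps)
  qed (use s v lipschitz_on_nonneg[OF v] in simp)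
  note [measurable] = borel_measurable_jac[OF this]
  have "(\<lambda>x. det (jac ?X x)) \<in> borel_measurable lebesgue"
    unfolding det_def by measurable
  then show "(\<lambda>x. det (jac ?X x)) \<in> borel_measurable (lebesgue_on \<Omega>)"
    by (rule measurable_restrict_space1)
qed

text \<open>One constant dominating three: \<open>1 + det_const d\<close> bounds the Jacobian
  weight, \<open>3 * a\<close> the velocity, and \<open>det_const d * a\<close> the deviation of the
  weight from 1 per unit of displacement time. The root is the operator bound for the
  composition.\<close>

definition flow_const :: "'d::finite itself \<Rightarrow> real \<Rightarrow> real" where
  "flow_const d a = (1 + det_const d + 3 * a + det_const d * a) * sqrt (8 ^ CARD('d))"

lemma flow_const_nonneg: "0 \<le> a \<Longrightarrow> 0 \<le> flow_const TYPE('d::finite) a"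
  using det_const_nonneg[where 'd='d] by (simp add: flow_const_def)

text \<open>The difference is split into \<open>\<phi> - \<phi> \<circ> X\<close> and
  \<open>(\<phi> \<circ> X) * (1 - g)\<close>. The first part costs a gradient times the
  displacement; the second needs no gradient because the Jacobian weight \<open>g\<close> is within
  order \<open>s\<close> of 1.\<close>

lemma weighted_flow_estimates:
  fixes \<Omega> :: "(real^'d) set"
  assumes P: "poly_domain_triang \<Omega> Th" and \<phi>: "\<phi> \<in> Psi_h \<Omega> Th k"
    and v: "\<Lambda>-lipschitz_on UNIV v" and s: "0 \<le> s" "s * \<Lambda> \<le> 3/4" "s * m \<le> 1/4" and m: "0 \<le> m" "m \<le> a"
    and zero: "\<And>x. x \<notin> \<Omega> \<Longrightarrow> v x = 0" and A: "AE x in lebesgue_on \<Omega>. norm (v x) \<le> 3 * a"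
    and J: "AE x in lebesgue_on \<Omega>. v differentiable (at x) \<and> (\<forall>i j. \<bar>jac v x $ i $ j\<bar> \<le> m)"
  defines "g \<equiv> \<lambda>x. det (jac (\<lambda>x. x - s *\<^sub>R v x) x)" and "M \<equiv> lebesgue_on \<Omega>"
  shows "sq_integrable M (\<lambda>x. \<phi> (x - s *\<^sub>R v x) * g x)"
    and "nrm M (\<lambda>x. \<phi> (x - s *\<^sub>R v x) * g x) \<le> flow_const TYPE('d) a * nrm M \<phi>"
    and "nrm M (\<lambda>x. \<phi> x - \<phi> (x - s *\<^sub>R v x) * g x) \<le> s * flow_const TYPE('d) a * (nrm M \<phi> + nrm M (grad \<phi>))"
proof -
  let ?X = "\<lambda>x. x - s *\<^sub>R v x"
  let ?C = "det_const TYPE('d)" and ?q = "sqrt (8 ^ CARD('d))"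
  have C: "0 \<le> ?C" by (rule det_const_nonneg)
  have a: "0 \<le> a" using m by simp
  have \<Omega>: "\<Omega> \<in> sets lebesgue" by (rule finite_measure_lebesgue_on_domain(1)[OF P])
  have g: "AE x in M. \<bar>g x - 1\<bar> \<le> ?C * (s * m)" "g \<in> borel_measurable M"
    unfolding g_def M_def using flow_jacobian[OF \<Omega> v s(1,3) m(1) J] by auto
  note cX = composition_flow_bound[OF P \<phi> v s(1,2), folded M_def]
  note sq = Psi_h_sq_integrable[OF P \<phi>, folded M_def]
  have Csm: "?C * (s * m) \<le> ?C" using C s by (intro mult_left_le) auto
  have meas: "(\<lambda>x. \<phi> (?X x) * g x) \<in> borel_measurable M"
    using cX(1) g(2) by (auto simp: sq_integrable_def)
  have ae1: "AE x in M. norm (\<phi> (?X x) * g x) \<le> (1 + ?C) * norm (\<phi> (?X x))"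
    using g(1)
  proof eventually_elim
    case (elim x)
    then have "\<bar>g x\<bar> \<le> 1 + ?C" using Csm by linarith
    then show ?case by (simp add: abs_mult mult.commute mult_right_mono)
  qed
  note b1 = sq_integrable_bound[OF cX(1) meas ae1]
  show sqg: "sq_integrable M (\<lambda>x. \<phi> (?X x) * g x)" using b1(1) C by simp
  have "nrm M (\<lambda>x. \<phi> (?X x) * g x) \<le> (1 + ?C) * nrm M (\<lambda>x. \<phi> (?X x))" using b1(2) C by simp
  also have "\<dots> \<le> (1 + ?C) * (?q * nrm M \<phi>)" using cX(2) C by (intro mult_left_mono) auto
  also have "\<dots> \<le> flow_const TYPE('d) a * nrm M \<phi>"
    unfolding flow_const_def mult.assoc[symmetric]
    by (intro mult_right_mono) (use C a in auto)
  finally show "nrm M (\<lambda>x. \<phi> (?X x) * g x) \<le> flow_const TYPE('d) a * nrm M \<phi>" .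
  have ae2: "AE x in M. norm (\<phi> (?X x) * (1 - g x)) \<le> (?C * (s * m)) * norm (\<phi> (?X x))"
    using g(1) by eventually_elim (simp add: abs_mult abs_minus_commute mult.commute mult_right_mono)
  have meas2: "(\<lambda>x. \<phi> (?X x) * (1 - g x)) \<in> borel_measurable M"
    using cX(1) g(2) by (auto simp: sq_integrable_def)
  note b2 = sq_integrable_bound[OF cX(1) meas2 ae2]
  have Csm0: "0 \<le> ?C * (s * m)" using C s m by simp
  have "nrm M (\<lambda>x. \<phi> x - \<phi> (?X x) * g x) = nrm M (\<lambda>x. (\<phi> x - \<phi> (?X x)) + \<phi> (?X x) * (1 - g x))"
    by (simp add: algebra_simps)
  also have "\<dots> \<le> nrm M (\<lambda>x. \<phi> x - \<phi> (?X x)) + nrm M (\<lambda>x. \<phi> (?X x) * (1 - g x))"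
    using b2(1) Csm0 by (intro nrm_triangle sq_integrable_diff sq cX) auto
  also have "nrm M (\<lambda>x. \<phi> x - \<phi> (?X x)) \<le> s * (3 * a) * ?q * nrm M (grad \<phi>)"
    using composition_flow_difference[OF P \<phi> v s(1,2) zero _ A] a by (simp add: M_def nrm_diff_commute[of _ \<phi>])
  also have "nrm M (\<lambda>x. \<phi> (?X x) * (1 - g x)) \<le> (?C * (s * m)) * (?q * nrm M \<phi>)"
    using b2(2) Csm0 mult_left_mono[OF cX(2) Csm0] by simp
  also have "(?C * (s * m)) * (?q * nrm M \<phi>) \<le> (?C * (s * a)) * (?q * nrm M \<phi>)"
    using C s m by (intro mult_right_mono mult_left_mono) auto
  also have "s * (3 * a) * ?q * nrm M (grad \<phi>) + (?C * (s * a)) * (?q * nrm M \<phi>) =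
      s * ((3 * a * ?q) * nrm M (grad \<phi>) + (?C * a * ?q) * nrm M \<phi>)"
    by (simp add: algebra_simps)
  also have "\<dots> \<le> s * (flow_const TYPE('d) a * nrm M (grad \<phi>) + flow_const TYPE('d) a * nrm M \<phi>)"
    unfolding flow_const_def
    by (intro mult_left_mono[OF _ s(1)] add_mono mult_right_mono) (use C a in auto)
  finally show "nrm M (\<lambda>x. \<phi> x - \<phi> (?X x) * g x) \<le> s * flow_const TYPE('d) a * (nrm M \<phi> + nrm M (grad \<phi>))"
    by (simp add: algebra_simps)
qed

section \<open>Discrete energy estimates\<close>

lemma weighted_Young:
  fixes x y c :: real
  assumes "0 < c"
  shows "2 * x * y \<le> c * x\<^sup>2 + y\<^sup>2 / c"
proof -
  have "0 \<le> (c * x - y)\<^sup>2 / c" using assms by simp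
  also have "\<dots> = c * x\<^sup>2 - 2 * x * y + y\<^sup>2 / c"
    using assms by (simp add: power2_diff field_simps power2_eq_square)
  finally show ?thesis by simp
qed

lemma power2_sum_le: "(x + y)\<^sup>2 \<le> 2 * x\<^sup>2 + 2 * y\<^sup>2" for x y :: real
  using sum_squares_bound[of x y] by (simp add: power2_sum)

lemma power2_sum4_le: "(a + b + (c + d))\<^sup>2 \<le> 4 * (a\<^sup>2 + b\<^sup>2 + c\<^sup>2 + d\<^sup>2)" for a b c d :: real
proof -
  have "(a + b + (c + d))\<^sup>2 \<le> 2 * (a + b)\<^sup>2 + 2 * (c + d)\<^sup>2" by (rule power2_sum_le)
  also have "\<dots> \<le> 2 * (2 * a\<^sup>2 + 2 * b\<^sup>2) + 2 * (2 * c\<^sup>2 + 2 * d\<^sup>2)"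
    by (intro add_mono mult_left_mono power2_sum_le) auto
  finally show ?thesis by simp
qed

lemma discrete_Gronwall:
  fixes Y S :: "nat \<Rightarrow> real"
  assumes x: "0 \<le> x" and S: "\<And>n. 0 \<le> S n"
    and step: "\<And>n. m < n \<Longrightarrow> n \<le> N \<Longrightarrow> Y n \<le> (1 + x) * Y (n - 1) + S n"
    and n: "m \<le> n" "n \<le> N"
  shows "Y n \<le> (1 + x) ^ (n - m) * (Y m + (\<Sum>k\<in>{m<..n}. S k))"
  using n
proof (induction n rule: dec_induct)
  case (step n)
  have "Y (Suc n) \<le> (1 + x) * Y n + S (Suc n)"
    using assms(3)[of "Suc n"] step by simp
  also have "\<dots> \<le> (1 + x) * ((1 + x) ^ (n - m) * (Y m + (\<Sum>k\<in>{m<..n}. S k))) + (1 + x) ^ (Suc n - m) * S (Suc n)"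
  proof (rule add_mono)
    show "S (Suc n) \<le> (1 + x) ^ (Suc n - m) * S (Suc n)"
      using mult_right_mono[OF one_le_power[of "1 + x" "Suc n - m"], of "S (Suc n)"] x S[of "Suc n"] by simp
  qed (use step x in \<open>intro mult_left_mono, auto\<close>)
  also have "(1 + x) * ((1 + x) ^ (n - m) * (Y m + (\<Sum>k\<in>{m<..n}. S k))) = (1 + x) ^ (Suc n - m) * (Y m + (\<Sum>k\<in>{m<..n}. S k))"
    using step by (simp add: Suc_diff_le)
  also have "\<dots> + (1 + x) ^ (Suc n - m) * S (Suc n) = (1 + x) ^ (Suc n - m) * (Y m + (\<Sum>k\<in>{m<..Suc n}. S k))"
  proof -
    have "{m<..Suc n} = insert (Suc n) {m<..n}" using step by auto
    then show ?thesis by (simp add: algebra_simps)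
  qed
  finally show ?case .
qed simp

text \<open>\<open>p\<close> is the norm of the new step, \<open>r\<close> that of the second
  difference, \<open>e\<close> that of the extrapolation from older steps, \<open>P\<close> and
  \<open>G\<close> are sums of older norms and gradient norms. One half of \<open>r\<^sup>2\<close>
  absorbs \<open>2 * w * r\<close>, the other half the data term with \<open>r\<close>; half of the
  dissipation absorbs the data term with \<open>g\<close>. The two estimates of \<open>w\<close>
  leave \<open>\<nu> / 8\<close> each as weight on \<open>G\<^sup>2\<close>.\<close>

lemma energy_step:
  fixes E r dt \<nu> g Ep F p w e P G L g1 g2 :: real
  assumes dt: "0 < dt" "dt < 1" and \<nu>: "0 < \<nu>" and L: "0 \<le> L"
    and nn: "0 \<le> r" "0 \<le> w" "0 \<le> F" "0 \<le> e" "0 \<le> P" "0 \<le> G"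
    and en: "E + r\<^sup>2 + 4 * dt * \<nu> * g\<^sup>2 \<le> Ep + 4 * dt * F * (p + g) + 2 * w * p"
    and p: "p \<le> r + e" and w1: "w \<le> L * dt * (P + G)" and w2: "w \<le> L * P"
    and e: "e\<^sup>2 \<le> Ep" and P: "P\<^sup>2 \<le> 18 * Ep" and G: "G\<^sup>2 \<le> 2 * (g1\<^sup>2 + g2\<^sup>2)"
  shows "E + 2 * dt * \<nu> * g\<^sup>2 \<le> (1 + dt * (18 * (2 * L\<^sup>2 + 8 * L^4 / \<nu> + L) + (L + 8 * L\<^sup>2 / \<nu> + 2))) * Ep
     + dt * \<nu> / 2 * (g1\<^sup>2 + g2\<^sup>2) + (10 + 2 / \<nu>) * (dt * F\<^sup>2)"
proof -
  have wr: "2 * w * r \<le> r\<^sup>2 / 2 + 2 * w\<^sup>2" using weighted_Young[of "1/2" r w] by (simp add: mult_ac)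
  \<comment> \<open>One factor \<open>w\<close> is bounded by the estimate of order
    \<open>dt\<close>, the other by the one without gradients, so \<open>G\<close> enters only
    linearly.\<close>
  have ww: "w\<^sup>2 \<le> dt * (L\<^sup>2 * P\<^sup>2 + L\<^sup>2 * G * P)"
    using mult_mono[OF w1 w2] nn dt L by (simp add: power2_eq_square algebra_simps)
  have GP: "2 * (L\<^sup>2 * G * P) \<le> \<nu> / 8 * G\<^sup>2 + 8 * L^4 / \<nu> * P\<^sup>2"
    using weighted_Young[of "\<nu>/8" G "L\<^sup>2 * P"] \<nu> by (simp add: mult_ac power_mult_distrib flip: power_mult)
  have we: "2 * w * e \<le> dt * (L * (P\<^sup>2 + e\<^sup>2) + \<nu> / 8 * G\<^sup>2 + 8 * L\<^sup>2 / \<nu> * e\<^sup>2)"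
  proof -
    have "2 * w * e \<le> 2 * (L * dt * (P + G)) * e" using w1 nn by (intro mult_right_mono mult_left_mono) auto
    also have "\<dots> = dt * (L * (2 * P * e) + 2 * G * (L * e))" by (simp add: algebra_simps)
    also have "\<dots> \<le> dt * (L * (P\<^sup>2 + e\<^sup>2) + (\<nu> / 8 * G\<^sup>2 + 8 * L\<^sup>2 / \<nu> * e\<^sup>2))"
    proof (intro mult_left_mono add_mono)
      show "2 * P * e \<le> P\<^sup>2 + e\<^sup>2" using sum_squares_bound[of P e] by simp
      show "2 * G * (L * e) \<le> \<nu> / 8 * G\<^sup>2 + 8 * L\<^sup>2 / \<nu> * e\<^sup>2"
        using weighted_Young[of "\<nu>/8" G "L * e"] \<nu> by (simp add: mult_ac power_mult_distrib)
    qed (use dt L in auto)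
    finally show ?thesis by (simp add: algebra_simps)
  qed
  have dt2: "dt\<^sup>2 * F\<^sup>2 \<le> dt * F\<^sup>2" using dt by (intro mult_right_mono) (auto simp: power2_eq_square mult_left_le)
  have Fr: "4 * dt * F * r \<le> r\<^sup>2 / 2 + 8 * (dt * F\<^sup>2)"
    using weighted_Young[of "1/2" r "2 * dt * F"] dt2 by (simp add: mult_ac power_mult_distrib)
  have Fe: "4 * dt * F * e \<le> 2 * (dt * F\<^sup>2) + 2 * dt * e\<^sup>2"
    using mult_left_mono[OF sum_squares_bound[of F e], of "2 * dt"] dt by (simp add: algebra_simps)
  have Fg: "4 * dt * F * g \<le> 2 * dt * \<nu> * g\<^sup>2 + 2 / \<nu> * (dt * F\<^sup>2)"
    using mult_left_mono[OF weighted_Young[OF \<nu>, of g F], of "2 * dt"] dt by (simp add: algebra_simps)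
  have wp: "2 * w * p \<le> 2 * w * r + 2 * w * e"
    using mult_left_mono[OF p, of "2 * w"] nn by (simp add: algebra_simps)
  have Fp: "4 * dt * F * p \<le> 4 * dt * F * r + 4 * dt * F * e"
    using mult_left_mono[OF p, of "4 * dt * F"] nn dt by (simp add: algebra_simps)
  have "2 * (L\<^sup>2 * P\<^sup>2 + L\<^sup>2 * G * P) \<le> 2 * L\<^sup>2 * P\<^sup>2 + (\<nu> / 8 * G\<^sup>2 + 8 * L^4 / \<nu> * P\<^sup>2)"
    using GP by (simp add: algebra_simps)
  then have "dt * (2 * (L\<^sup>2 * P\<^sup>2 + L\<^sup>2 * G * P)) \<le> dt * (2 * L\<^sup>2 * P\<^sup>2 + (\<nu> / 8 * G\<^sup>2 + 8 * L^4 / \<nu> * P\<^sup>2))"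
    using dt by (intro mult_left_mono) auto
  moreover have "2 * w\<^sup>2 \<le> 2 * (dt * (L\<^sup>2 * P\<^sup>2 + L\<^sup>2 * G * P))" using ww by linarith
  then have "2 * w\<^sup>2 \<le> dt * (2 * (L\<^sup>2 * P\<^sup>2 + L\<^sup>2 * G * P))" by (simp only: mult.left_commute)
  ultimately have ww': "2 * w\<^sup>2 \<le> dt * (2 * L\<^sup>2 * P\<^sup>2 + (\<nu> / 8 * G\<^sup>2 + 8 * L^4 / \<nu> * P\<^sup>2))" by linarith
  have "E + 2 * dt * \<nu> * g\<^sup>2 \<le> Ep + dt * ((2 * L\<^sup>2 + 8 * L^4 / \<nu> + L) * P\<^sup>2 + (L + 8 * L\<^sup>2 / \<nu> + 2) * e\<^sup>2)
      + dt * \<nu> / 4 * G\<^sup>2 + (10 + 2 / \<nu>) * (dt * F\<^sup>2)"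
    using en wp Fp wr ww' we Fr Fe Fg by (simp add: algebra_simps)
  also have "\<dots> \<le> Ep + dt * ((2 * L\<^sup>2 + 8 * L^4 / \<nu> + L) * (18 * Ep) + (L + 8 * L\<^sup>2 / \<nu> + 2) * Ep)
      + dt * \<nu> / 4 * (2 * (g1\<^sup>2 + g2\<^sup>2)) + (10 + 2 / \<nu>) * (dt * F\<^sup>2)"
    using e P G dt \<nu> L by (intro add_mono mult_left_mono order_refl) auto
  finally show ?thesis by (simp add: algebra_simps)
qed

text \<open>The growth rate of the energy per unit of time left over by \<open>energy_step\<close>.
  It depends on \<open>1 / \<nu>\<close> but not on \<open>dt\<close>, and the factor 18 recovers
  two older norms from the energy of one level.\<close>

definition energy_rate :: "real \<Rightarrow> real \<Rightarrow> real" where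
  "energy_rate L \<nu> = 18 * (2 * L\<^sup>2 + 8 * L^4 / \<nu> + L) + (L + 8 * L\<^sup>2 / \<nu> + 2)"

text \<open>Here \<open>p n\<close>, \<open>g n\<close> and \<open>q n\<close> are the norms of \<open>\<phi> n\<close>, its gradient and \<open>2 \<phi> n - \<phi> (n-1)\<close>, \<open>F n\<close> is the dual
  norm of the data, \<open>r n\<close> the norm of the second difference and \<open>w n\<close> that of the transport error. The
  first two steps are treated separately since the gradient of \<open>\<phi> 0\<close> must not enter the estimate.\<close>

lemma discrete_stability:
  fixes p g q F r w :: "nat \<Rightarrow> real" and dt \<nu> K L T :: real
  assumes dt: "0 < dt" "dt < 1" "real N * dt \<le> T" and \<nu>: "0 < \<nu>" and K: "0 \<le> K" and L: "0 \<le> L"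
    and nn: "\<And>n. 0 \<le> p n" "\<And>n. 0 \<le> g n" "\<And>n. 0 \<le> q n" "\<And>n. 0 \<le> F n"
    and first: "1 \<le> N \<Longrightarrow> (p 1)\<^sup>2 + dt * \<nu> * (g 1)\<^sup>2 \<le> K * p 0 * p 1 + dt * F 1 * (p 1 + g 1)"
    and second: "2 \<le> N \<Longrightarrow> 3 * (p 2)\<^sup>2 + 2 * dt * \<nu> * (g 2)\<^sup>2 \<le> K * (4 * p 1 + p 0) * p 2 + 2 * dt * F 2 * (p 2 + g 2)"
    and rw: "\<And>n. 0 \<le> r n" "\<And>n. 0 \<le> w n"
    and step: "\<And>n. 3 \<le> n \<Longrightarrow> n \<le> N \<Longrightarrow> (p n)\<^sup>2 + (q n)\<^sup>2 + (r n)\<^sup>2 + 4 * dt * \<nu> * (g n)\<^sup>2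
        \<le> (p (n-1))\<^sup>2 + (q (n-1))\<^sup>2 + 4 * dt * F n * (p n + g n) + 2 * w n * p n"
    and p_le: "\<And>n. 3 \<le> n \<Longrightarrow> n \<le> N \<Longrightarrow> p n \<le> r n + q (n-1)"
    and w1: "\<And>n. 3 \<le> n \<Longrightarrow> n \<le> N \<Longrightarrow> w n \<le> L * dt * ((p (n-1) + p (n-2)) + (g (n-1) + g (n-2)))"
    and w2: "\<And>n. 3 \<le> n \<Longrightarrow> n \<le> N \<Longrightarrow> w n \<le> L * (p (n-1) + p (n-2))"
    and q: "\<And>n. 2 \<le> n \<Longrightarrow> n \<le> N \<Longrightarrow> q n \<le> 2 * p n + p (n-1) \<and> p (n-1) \<le> 2 * p n + q n"
  defines "D \<equiv> (p 0)\<^sup>2 + dt * (\<Sum>n=1..N. (F n)\<^sup>2)"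
  defines "c1 \<equiv> 2 * K\<^sup>2 + 2 + 1 / \<nu>"
  defines "c2 \<equiv> K\<^sup>2 * (8 * c1 + 1) + (1 + 1 / \<nu>)"
  defines "c3 \<equiv> exp (energy_rate L \<nu> * T) * (10 * c2 + 3 * c1 + (10 + 2 / \<nu>))"
  shows "\<And>n. n \<in> {1..N} \<Longrightarrow> (p n)\<^sup>2 \<le> (c1 + c2 + c3) * D"
    and "dt * \<nu> * (\<Sum>n=1..N. (g n)\<^sup>2) \<le> (c1 + c2 + c3) * D"
proof -
  have c: "0 \<le> c1" "0 \<le> c2" "0 \<le> c3" "0 \<le> 10 * c2 + 3 * c1 + (10 + 2 / \<nu>)"
    using \<nu> by (auto simp: c1_def c2_def c3_def)
  have D: "0 \<le> D" using dt by (simp add: D_def sum_nonneg)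
  have p0D: "(p 0)\<^sup>2 \<le> D" using dt by (simp add: D_def sum_nonneg)
  have FD: "dt * (F n)\<^sup>2 \<le> D" if "n \<in> {1..N}" for n
  proof -
    have "(F n)\<^sup>2 \<le> (\<Sum>n=1..N. (F n)\<^sup>2)" using that by (intro member_le_sum) auto
    then have "dt * (F n)\<^sup>2 \<le> dt * (\<Sum>n=1..N. (F n)\<^sup>2)" using dt by (intro mult_left_mono) auto
    then show ?thesis by (simp add: D_def add_increasing)
  qed
  have dt2: "dt\<^sup>2 * x \<le> dt * x" if "0 \<le> x" for x
    using dt that by (intro mult_right_mono) (auto simp: power2_eq_square mult_left_le)
  \<comment> \<open>Quarters of \<open>(p 1)\<^sup>2\<close> absorb the initial value and the data,
    half of the dissipation absorbs the data term with the gradient, and the remaining halves are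
    doubled.\<close>
  have b1: "(p 1)\<^sup>2 + dt * \<nu> * (g 1)\<^sup>2 \<le> c1 * D" if N: "1 \<le> N"
  proof -
    have "K * p 0 * p 1 \<le> (p 1)\<^sup>2 / 4 + K\<^sup>2 * (p 0)\<^sup>2"
      using weighted_Young[of "1/2" "p 1" "K * p 0"] by (simp add: power_mult_distrib mult_ac)
    moreover have "dt * F 1 * p 1 \<le> (p 1)\<^sup>2 / 4 + dt * (F 1)\<^sup>2"
      using weighted_Young[of "1/2" "p 1" "dt * F 1"] dt2[of "(F 1)\<^sup>2"] by (simp add: power_mult_distrib mult_ac)
    moreover have "2 * (dt * F 1 * g 1) \<le> dt * \<nu> * (g 1)\<^sup>2 + 1 / \<nu> * (dt * (F 1)\<^sup>2)"
      using mult_left_mono[OF weighted_Young[OF \<nu>, of "g 1" "F 1"], of dt] dt by (simp add: algebra_simps)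
    moreover have "(p 1)\<^sup>2 + dt * \<nu> * (g 1)\<^sup>2 \<le> K * p 0 * p 1 + dt * F 1 * p 1 + dt * F 1 * g 1"
      using first[OF N] by (simp add: distrib_left)
    moreover have "(2 + 1 / \<nu>) * (dt * (F 1)\<^sup>2) = 2 * (dt * (F 1)\<^sup>2) + 1 / \<nu> * (dt * (F 1)\<^sup>2)"
      by (rule distrib_right)
    ultimately have "(p 1)\<^sup>2 + dt * \<nu> * (g 1)\<^sup>2 \<le> 2 * (K\<^sup>2 * (p 0)\<^sup>2) + (2 + 1 / \<nu>) * (dt * (F 1)\<^sup>2)"
      by linarith
    also have "\<dots> \<le> 2 * (K\<^sup>2 * D) + (2 + 1 / \<nu>) * D"
      using p0D FD[of 1] N \<nu> by (intro add_mono mult_left_mono) auto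
    finally show ?thesis by (simp add: c1_def algebra_simps)
  qed
  have b2: "(p 2)\<^sup>2 + dt * \<nu> * (g 2)\<^sup>2 \<le> c2 * D" if N: "2 \<le> N"
  proof -
    have "K * (4 * p 1 + p 0) * p 2 \<le> (p 2)\<^sup>2 + K\<^sup>2 * ((4 * p 1 + p 0)\<^sup>2 / 4)"
      using weighted_Young[of 1 "p 2" "K * (4 * p 1 + p 0) / 2"] by (simp add: power_mult_distrib power_divide mult_ac)
    also have "K\<^sup>2 * ((4 * p 1 + p 0)\<^sup>2 / 4) \<le> K\<^sup>2 * (8 * (p 1)\<^sup>2 + (p 0)\<^sup>2)"
    proof (rule mult_left_mono)
      have "(4 * p 1 + p 0)\<^sup>2 \<le> 32 * (p 1)\<^sup>2 + 2 * (p 0)\<^sup>2"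
        using power2_sum_le[of "4 * p 1" "p 0"] by (simp add: power_mult_distrib)
      then show "(4 * p 1 + p 0)\<^sup>2 / 4 \<le> 8 * (p 1)\<^sup>2 + (p 0)\<^sup>2"
        using zero_le_power2[of "p 0"] by linarith
    qed simp
    finally have "K * (4 * p 1 + p 0) * p 2 \<le> (p 2)\<^sup>2 + K\<^sup>2 * (8 * (p 1)\<^sup>2 + (p 0)\<^sup>2)" by simp
    moreover have "2 * dt * F 2 * p 2 \<le> (p 2)\<^sup>2 + dt * (F 2)\<^sup>2"
      using weighted_Young[of 1 "p 2" "dt * F 2"] dt2[of "(F 2)\<^sup>2"] by (simp add: power_mult_distrib mult_ac)
    moreover have "2 * dt * F 2 * g 2 \<le> dt * \<nu> * (g 2)\<^sup>2 + 1 / \<nu> * (dt * (F 2)\<^sup>2)"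
      using mult_left_mono[OF weighted_Young[OF \<nu>, of "g 2" "F 2"], of dt] dt by (simp add: algebra_simps)
    ultimately have "(p 2)\<^sup>2 + dt * \<nu> * (g 2)\<^sup>2 \<le> K\<^sup>2 * (8 * (p 1)\<^sup>2 + (p 0)\<^sup>2) + (1 + 1 / \<nu>) * (dt * (F 2)\<^sup>2)"
      using second[OF N] by (simp add: algebra_simps)
    also have "\<dots> \<le> K\<^sup>2 * (8 * (c1 * D) + D) + (1 + 1 / \<nu>) * D"
    proof -
      have "0 \<le> dt * \<nu> * (g 1)\<^sup>2" using dt \<nu> by simp
      then have "(p 1)\<^sup>2 \<le> c1 * D" using b1 N by linarith
      then show ?thesis using p0D FD[of 2] N \<nu> by (intro add_mono mult_left_mono) auto
    qed
    finally show ?thesis by (simp add: c2_def algebra_simps)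
  qed
  \<comment> \<open>The gradient weights make the recursion exact: passing from \<open>n - 1\<close>
    to \<open>n\<close> changes them by \<open>2 * dt * \<nu> * (g n)\<^sup>2\<close> minus
    \<open>dt * \<nu> / 2\<close> times each of the two older squares, which is what
    \<open>energy_step\<close> provides. The sum accumulates the dissipation that is finally to be
    bounded.\<close>
  define Y where "Y n = (p n)\<^sup>2 + (q n)\<^sup>2 + dt * \<nu> * (g n)\<^sup>2 + dt * \<nu> / 2 * (g (n-1))\<^sup>2 + dt * \<nu> * (\<Sum>k\<in>{2<..n}. (g k)\<^sup>2)" for n
  have Ystep: "Y n \<le> (1 + dt * energy_rate L \<nu>) * Y (n-1) + (10 + 2 / \<nu>) * (dt * (F n)\<^sup>2)" if n: "2 < n" "n \<le> N" for n
  proof -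
    have n3: "3 \<le> n" using n by simp
    let ?Ep = "(p (n-1))\<^sup>2 + (q (n-1))\<^sup>2"
    \<comment> \<open>The energy at level \<open>n - 1\<close> contains the older norm only through
      the extrapolation; \<open>(3 * p + q)\<^sup>2 \<le> 18 * p\<^sup>2 + 2 * q\<^sup>2\<close>
      then yields the factor 18.\<close>
    have "p (n-2) \<le> 2 * p (n-1) + q (n-1)" 
    proof -
      have "n - 1 - 1 = n - 2" by simp
      then show ?thesis using q[of "n - 1"] n by auto
    qed
    then have "(p (n-1) + p (n-2))\<^sup>2 \<le> (3 * p (n-1) + q (n-1))\<^sup>2" using nn by (intro power_mono) auto
    also have "\<dots> \<le> 18 * (p (n-1))\<^sup>2 + 2 * (q (n-1))\<^sup>2"
      using power2_sum_le[of "3 * p (n-1)" "q (n-1)"] by (simp add: power_mult_distrib)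
    also have "\<dots> \<le> 18 * ?Ep" using zero_le_power2[of "q (n-1)"] by (simp add: distrib_left del: zero_le_power2)
    finally have PE: "(p (n-1) + p (n-2))\<^sup>2 \<le> 18 * ?Ep" .
    have GE: "(g (n-1) + g (n-2))\<^sup>2 \<le> 2 * ((g (n-1))\<^sup>2 + (g (n-2))\<^sup>2)" using power2_sum_le by simp
    have "(p n)\<^sup>2 + (q n)\<^sup>2 + 2 * dt * \<nu> * (g n)\<^sup>2 \<le> (1 + dt * energy_rate L \<nu>) * ?Ep
       + dt * \<nu> / 2 * ((g (n-1))\<^sup>2 + (g (n-2))\<^sup>2) + (10 + 2 / \<nu>) * (dt * (F n)\<^sup>2)"
      unfolding energy_rate_def
      by (rule energy_step[OF dt(1,2) \<nu> L rw nn(4) nn(3) _ _ step[OF n3 n(2)] p_le[OF n3 n(2)] w1[OF n3 n(2)] w2[OF n3 n(2)] _ PE GE])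
        (use nn in auto)
    moreover have sum: "(\<Sum>k\<in>{2<..n}. (g k)\<^sup>2) = (g n)\<^sup>2 + (\<Sum>k\<in>{2<..n-1}. (g k)\<^sup>2)"
    proof -
      have "{2<..n} = insert n {2<..n-1}" using n by auto
      moreover have "n \<notin> {2<..n-1}" using n by auto
      ultimately show ?thesis by simp
    qed
    ultimately have "Y n \<le> Y (n-1) + dt * energy_rate L \<nu> * ?Ep + (10 + 2 / \<nu>) * (dt * (F n)\<^sup>2)"
    proof -
      have "n - 1 - 1 = n - 2" by simp
      then show ?thesis using \<open>_ \<le> (1 + dt * energy_rate L \<nu>) * ?Ep + _ + _\<close>
        unfolding Y_def sum by (simp add: algebra_simps)
    qed
    also have "dt * energy_rate L \<nu> * ?Ep \<le> dt * energy_rate L \<nu> * Y (n-1)"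
      using dt \<nu> L unfolding Y_def energy_rate_def by (intro mult_left_mono) (auto simp: sum_nonneg)
    finally show ?thesis by (simp add: algebra_simps)
  qed
  have Ybound: "Y n \<le> c3 * D" if n: "2 \<le> n" "n \<le> N" for n
  proof -
    have rate: "0 \<le> energy_rate L \<nu>" using L \<nu> by (simp add: energy_rate_def)
    have "Y n \<le> (1 + dt * energy_rate L \<nu>) ^ (n - 2) * (Y 2 + (\<Sum>k\<in>{2<..n}. (10 + 2 / \<nu>) * (dt * (F k)\<^sup>2)))"
      by (rule discrete_Gronwall[where Y = Y and S = "\<lambda>k. (10 + 2 / \<nu>) * (dt * (F k)\<^sup>2)" and m = 2 and N = N])
        (use rate dt \<nu> Ystep n in auto)
    also have "\<dots> \<le> exp (energy_rate L \<nu> * T) * ((10 * c2 + 3 * c1) * D + (10 + 2 / \<nu>) * D)"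
    proof (rule mult_mono)
      have "(1 + dt * energy_rate L \<nu>) ^ (n - 2) \<le> exp (dt * energy_rate L \<nu>) ^ (n - 2)"
        using rate dt by (intro power_mono exp_ge_add_one_self) auto
      also have "\<dots> = exp (energy_rate L \<nu> * (real (n - 2) * dt))" by (simp add: exp_of_nat_mult[symmetric] mult_ac)
      also have "\<dots> \<le> exp (energy_rate L \<nu> * T)"
      proof -
        have "real (n - 2) * dt \<le> real N * dt" using n dt by (intro mult_right_mono) auto
        then show ?thesis using dt(3) rate by (simp add: mult_left_mono)
      qed
      finally show "(1 + dt * energy_rate L \<nu>) ^ (n - 2) \<le> exp (energy_rate L \<nu> * T)" .
      have "(q 2)\<^sup>2 \<le> (2 * p 2 + p 1)\<^sup>2" using q[of 2] n nn by (intro power_mono) auto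
      also have "\<dots> \<le> 8 * (p 2)\<^sup>2 + 2 * (p 1)\<^sup>2"
        using power2_sum_le[of "2 * p 2" "p 1"] by (simp add: power_mult_distrib)
      finally have "(q 2)\<^sup>2 \<le> 8 * (p 2)\<^sup>2 + 2 * (p 1)\<^sup>2" .
      \<comment> \<open>At level 2 the functional reaches back to \<open>g 1\<close> but not to
        \<open>g 0\<close>; this is why the recursion starts here.\<close>
      have "Y 2 \<le> 9 * ((p 2)\<^sup>2 + dt * \<nu> * (g 2)\<^sup>2) + 2 * ((p 1)\<^sup>2 + dt * \<nu> * (g 1)\<^sup>2)"
      proof -
        have "0 \<le> dt * \<nu> * (g 2)\<^sup>2" "0 \<le> dt * \<nu> * (g 1)\<^sup>2" using dt \<nu> by auto
        moreover have "Y 2 = (p 2)\<^sup>2 + (q 2)\<^sup>2 + dt * \<nu> * (g 2)\<^sup>2 + (dt * \<nu> * (g 1)\<^sup>2) / 2"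
          by (simp add: Y_def)
        ultimately show ?thesis
          using \<open>(q 2)\<^sup>2 \<le> 8 * (p 2)\<^sup>2 + 2 * (p 1)\<^sup>2\<close> unfolding distrib_left by linarith
      qed
      also have "\<dots> \<le> 9 * (c2 * D) + 2 * (c1 * D)" using b1 b2 n by (intro add_mono mult_left_mono) auto
      also have "\<dots> \<le> (10 * c2 + 3 * c1) * D" using c D by (simp add: algebra_simps)
      finally have Y2: "Y 2 \<le> (10 * c2 + 3 * c1) * D" .
      have "(\<Sum>k\<in>{2<..n}. (F k)\<^sup>2) \<le> (\<Sum>k=1..N. (F k)\<^sup>2)" using n by (intro sum_mono2) auto
      then have "dt * (\<Sum>k\<in>{2<..n}. (F k)\<^sup>2) \<le> D" using dt by (simp add: D_def add_increasing mult_left_mono)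
      then have "(\<Sum>k\<in>{2<..n}. (10 + 2 / \<nu>) * (dt * (F k)\<^sup>2)) \<le> (10 + 2 / \<nu>) * D"
        unfolding sum_distrib_left[symmetric] using \<nu> by (intro mult_left_mono) auto
      with Y2 show "Y 2 + (\<Sum>k\<in>{2<..n}. (10 + 2 / \<nu>) * (dt * (F k)\<^sup>2)) \<le> (10 * c2 + 3 * c1) * D + (10 + 2 / \<nu>) * D"
        by simp
      show "0 \<le> Y 2 + (\<Sum>k\<in>{2<..n}. (10 + 2 / \<nu>) * (dt * (F k)\<^sup>2))"
        unfolding Y_def using dt \<nu> by (intro add_nonneg_nonneg sum_nonneg mult_nonneg_nonneg) auto
    qed simp
    also have "\<dots> = c3 * D" by (simp add: c3_def algebra_simps)
    finally show ?thesis .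
  qed
  have pY: "(p n)\<^sup>2 \<le> Y n" and gY: "dt * \<nu> * (\<Sum>k\<in>{2<..n}. (g k)\<^sup>2) \<le> Y n" for n
    unfolding Y_def using dt \<nu> by (auto simp: sum_nonneg)
  have cD: "0 \<le> c1 * D" "0 \<le> c2 * D" "0 \<le> c3 * D" using c D by auto
  show "(p n)\<^sup>2 \<le> (c1 + c2 + c3) * D" if n: "n \<in> {1..N}" for n
  proof (cases "n = 1")
    case True
    have "0 \<le> dt * \<nu> * (g 1)\<^sup>2" using dt \<nu> by simp
    then have "(p 1)\<^sup>2 \<le> c1 * D" using b1 n True by simp
    then show ?thesis using True cD unfolding distrib_right by simp
  next
    case False
    then have "(p n)\<^sup>2 \<le> c3 * D" using n by (intro order_trans[OF pY Ybound]) auto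
    then show ?thesis using cD unfolding distrib_right by linarith
  qed
  show "dt * \<nu> * (\<Sum>n=1..N. (g n)\<^sup>2) \<le> (c1 + c2 + c3) * D"
  proof -
    consider "N = 0" | "N = 1" | "2 \<le> N" by linarith
    then show ?thesis
    proof cases
      case 1
      then show ?thesis using c D by simp
    next
      case 2
      then have "dt * \<nu> * (g 1)\<^sup>2 \<le> c1 * D" using b1 zero_le_power2[of "p 1"] by linarith
      then show ?thesis using 2 cD unfolding distrib_right by simp
    next
      case 3
      have "{1..N} = {1, 2} \<union> {2<..N}" using 3 by auto
      then have "(\<Sum>n=1..N. (g n)\<^sup>2) = (\<Sum>n\<in>{1,2} \<union> {2<..N}. (g n)\<^sup>2)" by simp
      also have "\<dots> = (\<Sum>n\<in>{1,2}. (g n)\<^sup>2) + (\<Sum>k\<in>{2<..N}. (g k)\<^sup>2)"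
        by (rule sum.union_disjoint) auto
      finally have "dt * \<nu> * (\<Sum>n=1..N. (g n)\<^sup>2) = dt * \<nu> * (g 1)\<^sup>2 + dt * \<nu> * (g 2)\<^sup>2 + dt * \<nu> * (\<Sum>k\<in>{2<..N}. (g k)\<^sup>2)"
        by (simp add: algebra_simps)
      moreover have "dt * \<nu> * (g 1)\<^sup>2 \<le> c1 * D" using b1 3 zero_le_power2[of "p 1"] by linarith
      moreover have "dt * \<nu> * (g 2)\<^sup>2 \<le> c2 * D" using b2 3 zero_le_power2[of "p 2"] by linarith
      moreover have "dt * \<nu> * (\<Sum>k\<in>{2<..N}. (g k)\<^sup>2) \<le> c3 * D" using 3 by (intro order_trans[OF gY Ybound]) auto
      ultimately show ?thesis unfolding distrib_right by linarith
    qed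
  qed
qed

text \<open>In addition, \<open>d n\<close> is the norm of the discrete time derivative, \<open>Gq n\<close> that of the gradient of
  \<open>2 \<phi> n - \<phi> (n-1)\<close>, and \<open>z\<close> that of the gradient of \<open>\<phi> 1 - \<phi> 0\<close>.\<close>

lemma discrete_stability_gradient:
  fixes p g F d Gq :: "nat \<Rightarrow> real" and dt \<nu> K L T z c :: real
  assumes dt: "0 < dt" "dt < 1" "real N * dt \<le> T" and \<nu>: "0 < \<nu>" "\<nu> \<le> 1" and K: "0 \<le> K" and L: "0 \<le> L" and T: "0 \<le> T"
    and nn: "\<And>n. 0 \<le> p n" "\<And>n. 0 \<le> g n" "\<And>n. 0 \<le> F n" "\<And>n. 0 \<le> d n" "0 \<le> Gq 1" and c: "0 \<le> c"
    and first: "1 \<le> N \<Longrightarrow> 2 * dt * (d 1)\<^sup>2 + \<nu> * ((g 1)\<^sup>2 - (g 0)\<^sup>2 + z\<^sup>2) \<le> 2 * dt * (F 1 + K * (p 0 + g 0)) * d 1"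
    and Gq1: "1 \<le> N \<Longrightarrow> Gq 1 \<le> g 1 + z"
    and step: "\<And>n. 2 \<le> n \<Longrightarrow> n \<le> N \<Longrightarrow>
      4 * dt * (d n)\<^sup>2 + \<nu> * ((g n)\<^sup>2 + (Gq n)\<^sup>2 - ((g (n-1))\<^sup>2 + (Gq (n-1))\<^sup>2))
      \<le> dt * (4 * F n + 2 * L * ((p (n-1) + p (n-2)) + (g (n-1) + g (n-2)))) * d n"
  defines "D0 \<equiv> (p 0)\<^sup>2 + dt * (\<Sum>n=1..N. (F n)\<^sup>2)"
  assumes pb: "\<And>n. n \<in> {1..N} \<Longrightarrow> (p n)\<^sup>2 \<le> c * D0"
    and gb: "dt * \<nu> * (\<Sum>n=1..N. (g n)\<^sup>2) \<le> c * D0"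
  defines "D \<equiv> (p 0)\<^sup>2 + (g 0)\<^sup>2 + dt * (\<Sum>n=1..N. (F n)\<^sup>2)"
  defines "e1 \<equiv> 3 + 4 * K\<^sup>2"
  defines "e2 \<equiv> 3 * e1 + 4 + 8 * L\<^sup>2 * (1 + T * c + c / \<nu>)"
  shows "\<And>n. n \<in> {1..N} \<Longrightarrow> \<nu> * (g n)\<^sup>2 \<le> (e1 + e2) * D"
    and "dt * (\<Sum>n=1..N. (d n)\<^sup>2) \<le> (e1 + e2) * D"
proof -
  have e: "0 \<le> e1" "0 \<le> e2" using \<nu> c T by (auto simp: e1_def e2_def)
  have S0: "0 \<le> dt * (\<Sum>n=1..N. (F n)\<^sup>2)" using dt by (simp add: sum_nonneg)
  have D: "0 \<le> D" "D0 \<le> D" "0 \<le> D0" "(p 0)\<^sup>2 + (g 0)\<^sup>2 \<le> D" using S0 by (auto simp: D_def D0_def)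
  have FD: "dt * (F n)\<^sup>2 \<le> D" if "n \<in> {1..N}" for n
  proof -
    have "(F n)\<^sup>2 \<le> (\<Sum>n=1..N. (F n)\<^sup>2)" using that by (intro member_le_sum) auto
    then have "dt * (F n)\<^sup>2 \<le> dt * (\<Sum>n=1..N. (F n)\<^sup>2)" using dt by (intro mult_left_mono) auto
    then show ?thesis by (simp add: D_def add_increasing)
  qed
  have b1: "dt * (d 1)\<^sup>2 + \<nu> * ((g 1)\<^sup>2 + z\<^sup>2) \<le> e1 * D" if N: "1 \<le> N"
  proof -
    let ?x = "F 1 + K * (p 0 + g 0)"
    have "2 * dt * ?x * d 1 \<le> dt * (d 1)\<^sup>2 + dt * ?x\<^sup>2"
      using mult_left_mono[OF sum_squares_bound[of ?x "d 1"], of dt] dt by (simp add: algebra_simps)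
    moreover have "dt * ?x\<^sup>2 \<le> 2 * (dt * (F 1)\<^sup>2) + 4 * K\<^sup>2 * ((p 0)\<^sup>2 + (g 0)\<^sup>2)"
    proof -
      have "(K * (p 0 + g 0))\<^sup>2 \<le> K\<^sup>2 * (2 * ((p 0)\<^sup>2 + (g 0)\<^sup>2))"
        unfolding power_mult_distrib using power2_sum_le[of "p 0" "g 0"] by (intro mult_left_mono) auto
      then have "?x\<^sup>2 \<le> 2 * (F 1)\<^sup>2 + 4 * K\<^sup>2 * ((p 0)\<^sup>2 + (g 0)\<^sup>2)"
        using power2_sum_le[of "F 1" "K * (p 0 + g 0)"] by (simp add: algebra_simps)
      then have "dt * ?x\<^sup>2 \<le> dt * (2 * (F 1)\<^sup>2) + dt * (4 * K\<^sup>2 * ((p 0)\<^sup>2 + (g 0)\<^sup>2))"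
        using dt by (simp add: mult_left_mono flip: distrib_left)
      also have "dt * (4 * K\<^sup>2 * ((p 0)\<^sup>2 + (g 0)\<^sup>2)) \<le> 4 * K\<^sup>2 * ((p 0)\<^sup>2 + (g 0)\<^sup>2)"
        using dt by (intro mult_left_le_one_le) auto
      finally show ?thesis by simp
    qed
    moreover have "\<nu> * (g 0)\<^sup>2 \<le> (g 0)\<^sup>2" using \<nu> by (intro mult_left_le_one_le) auto
    ultimately have "dt * (d 1)\<^sup>2 + \<nu> * ((g 1)\<^sup>2 + z\<^sup>2) \<le> (g 0)\<^sup>2 + 2 * (dt * (F 1)\<^sup>2) + 4 * K\<^sup>2 * ((p 0)\<^sup>2 + (g 0)\<^sup>2)"
      using first[OF N] by (simp add: algebra_simps)
    also have "\<dots> \<le> D + 2 * D + 4 * K\<^sup>2 * D"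
    proof -
      have "(g 0)\<^sup>2 \<le> D" using D(4) zero_le_power2[of "p 0"] by linarith
      then show ?thesis using D(4) FD[of 1] N by (intro add_mono mult_left_mono) auto
    qed
    finally show ?thesis by (simp add: e1_def algebra_simps)
  qed
  \<comment> \<open>Older levels enter only through \<open>R\<close>, whose sum is controlled by the
    assumed bounds \<open>pb\<close> and \<open>gb\<close>, so the recursion can simply be
    summed.\<close>
  define R where "R n = dt * ((p n)\<^sup>2 + (g n)\<^sup>2)" for n
  have R0: "0 \<le> R n" for n using dt by (simp add: R_def)
  define E where "E n = (g n)\<^sup>2 + (Gq n)\<^sup>2" for n
  have stepE: "2 * dt * (d n)\<^sup>2 + \<nu> * E n \<le> \<nu> * E (n-1) + 4 * (dt * (F n)\<^sup>2) + 4 * L\<^sup>2 * (R (n-1) + R (n-2))" if n: "2 \<le> n" "n \<le> N" for n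
  proof -
    let ?P = "p (n-1) + p (n-2)" and ?G = "g (n-1) + g (n-2)"
    let ?x = "4 * F n + 2 * L * (?P + ?G)"
    \<comment> \<open>The weight leaves half of \<open>4 * dt * (d n)\<^sup>2\<close> on the
      left.\<close>
    have "x * y \<le> 2 * y\<^sup>2 + x\<^sup>2 / 8" for x y :: real
      using weighted_Young[of 4 y x] by (simp add: mult_ac)
    then have "?x * d n \<le> 2 * (d n)\<^sup>2 + ?x\<^sup>2 / 8" .
    moreover have "?x\<^sup>2 / 8 \<le> 4 * (F n)\<^sup>2 + 4 * L\<^sup>2 * ((p (n-1))\<^sup>2 + (p (n-2))\<^sup>2 + (g (n-1))\<^sup>2 + (g (n-2))\<^sup>2)"
    proof -
      have "(?P + ?G)\<^sup>2 \<le> 4 * ((p (n-1))\<^sup>2 + (p (n-2))\<^sup>2 + (g (n-1))\<^sup>2 + (g (n-2))\<^sup>2)"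
        by (rule power2_sum4_le)
      then have "L\<^sup>2 * (?P + ?G)\<^sup>2 \<le> L\<^sup>2 * (4 * ((p (n-1))\<^sup>2 + (p (n-2))\<^sup>2 + (g (n-1))\<^sup>2 + (g (n-2))\<^sup>2))"
        by (intro mult_left_mono) auto
      also have "\<dots> = 4 * L\<^sup>2 * ((p (n-1))\<^sup>2 + (p (n-2))\<^sup>2 + (g (n-1))\<^sup>2 + (g (n-2))\<^sup>2)"
        by (simp only: mult_ac)
      finally have "L\<^sup>2 * (?P + ?G)\<^sup>2 \<le> 4 * L\<^sup>2 * ((p (n-1))\<^sup>2 + (p (n-2))\<^sup>2 + (g (n-1))\<^sup>2 + (g (n-2))\<^sup>2)" .
      moreover have "?x\<^sup>2 \<le> 2 * (16 * (F n)\<^sup>2) + 2 * (4 * (L\<^sup>2 * (?P + ?G)\<^sup>2))"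
        using power2_sum_le[of "4 * F n" "2 * L * (?P + ?G)"] by (simp add: power_mult_distrib mult.assoc)
      ultimately show ?thesis by argo
    qed
    ultimately have "?x * d n \<le> 2 * (d n)\<^sup>2 + (4 * (F n)\<^sup>2 + 4 * L\<^sup>2 * ((p (n-1))\<^sup>2 + (p (n-2))\<^sup>2 + (g (n-1))\<^sup>2 + (g (n-2))\<^sup>2))" by linarith
    from mult_left_mono[OF this, of dt] dt
    have "dt * ?x * d n \<le> 2 * dt * (d n)\<^sup>2 + 4 * (dt * (F n)\<^sup>2) + 4 * L\<^sup>2 * (R (n-1) + R (n-2))"
      by (simp add: R_def algebra_simps)
    with step[OF n] show ?thesis unfolding E_def by (simp add: algebra_simps)
  qed
  have tel: "2 * dt * (\<Sum>k\<in>{1<..n}. (d k)\<^sup>2) + \<nu> * E n \<le>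
      \<nu> * E 1 + 4 * (dt * (\<Sum>k\<in>{1<..n}. (F k)\<^sup>2)) + 4 * L\<^sup>2 * (\<Sum>k\<in>{1<..n}. R (k-1) + R (k-2))"
    if n: "1 \<le> n" "n \<le> N" for n
    using n
  proof (induction n rule: dec_induct)
    case (step n)
    have ins: "{1<..Suc n} = insert (Suc n) {1<..n}" using step by auto
    have "2 * dt * (d (Suc n))\<^sup>2 + \<nu> * E (Suc n) \<le> \<nu> * E n + 4 * (dt * (F (Suc n))\<^sup>2) + 4 * L\<^sup>2 * (R (Suc n - 1) + R (Suc n - 2))"
      using stepE[of "Suc n"] step by simp
    then show ?case using step unfolding ins by (simp add: algebra_simps)
  qed simp
  have Rsum: "(\<Sum>k=0..N. R k) \<le> (1 + T * c + c / \<nu>) * D"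
  proof -
    have "(\<Sum>k=0..N. R k) = R 0 + (\<Sum>k=1..N. R k)" by (simp add: sum.atLeast_Suc_atMost)
    also have "(\<Sum>k=1..N. R k) = dt * (\<Sum>k=1..N. (p k)\<^sup>2) + dt * (\<Sum>k=1..N. (g k)\<^sup>2)"
      by (simp add: R_def sum_distrib_left sum.distrib distrib_left)
    also have "dt * (\<Sum>k=1..N. (p k)\<^sup>2) \<le> T * c * D"
    proof -
      have "(\<Sum>k=1..N. (p k)\<^sup>2) \<le> (\<Sum>k=1..N. c * D0)" by (intro sum_mono pb)
      then have "dt * (\<Sum>k=1..N. (p k)\<^sup>2) \<le> dt * (real N * (c * D0))" using dt by (simp add: mult_left_mono)
      also have "\<dots> = (real N * dt) * (c * D0)" by simp
      also have "\<dots> \<le> T * (c * D)" using dt D c T by (intro mult_mono) auto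
      finally show ?thesis by simp
    qed
    \<comment> \<open>The assumed bound controls gradients only with the weight
      \<open>\<nu>\<close>, hence the additional \<open>1 / \<nu>\<close> in the constant.\<close>
    also have "dt * (\<Sum>k=1..N. (g k)\<^sup>2) \<le> c / \<nu> * D"
    proof -
      have "\<nu> * (dt * (\<Sum>k=1..N. (g k)\<^sup>2)) \<le> c * D"
        using gb mult_left_mono[OF D(2) c] by (simp add: mult_ac)
      then show ?thesis using \<nu> by (simp add: field_simps)
    qed
    also have "R 0 \<le> D" unfolding R_def
      using mult_left_le_one_le[of "(p 0)\<^sup>2 + (g 0)\<^sup>2" dt] dt D by simp
    finally show ?thesis by (simp add: algebra_simps)
  qed
  have main: "2 * dt * (\<Sum>k\<in>{1<..n}. (d k)\<^sup>2) + \<nu> * E n \<le> e2 * D" if n: "1 \<le> n" "n \<le> N" for n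
  proof -
    have "(Gq 1)\<^sup>2 \<le> (g 1 + z)\<^sup>2" using Gq1 nn n by (intro power_mono) auto
    also have "\<dots> \<le> 2 * (g 1)\<^sup>2 + 2 * z\<^sup>2" by (rule power2_sum_le)
    also have "\<dots> \<le> 2 * (g 1)\<^sup>2 + 3 * z\<^sup>2" by simp
    finally have "E 1 \<le> 3 * ((g 1)\<^sup>2 + z\<^sup>2)" by (simp add: E_def)
    then have "\<nu> * E 1 \<le> \<nu> * (3 * ((g 1)\<^sup>2 + z\<^sup>2))" using \<nu> by (intro mult_left_mono) auto
    also have "\<dots> \<le> 3 * (e1 * D)"
    proof -
      have "0 \<le> dt * (d 1)\<^sup>2" using dt by simp
      then have "\<nu> * ((g 1)\<^sup>2 + z\<^sup>2) \<le> e1 * D" using b1 n by simp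
      then show ?thesis by (simp only: mult.left_commute[of \<nu> 3])
    qed
    finally have 1: "\<nu> * E 1 \<le> 3 * (e1 * D)" .
    have "(\<Sum>k\<in>{1<..n}. (F k)\<^sup>2) \<le> (\<Sum>k=1..N. (F k)\<^sup>2)" using n by (intro sum_mono2) auto
    then have 2: "dt * (\<Sum>k\<in>{1<..n}. (F k)\<^sup>2) \<le> D" using dt by (simp add: D_def add_increasing mult_left_mono)
    have "(\<Sum>k\<in>{1<..n}. R (k-1)) = (\<Sum>k\<in>(\<lambda>k. k - 1) ` {1<..n}. R k)"
      by (subst sum.reindex) (auto simp: inj_on_def)
    also have "\<dots> \<le> (\<Sum>k=0..N. R k)" using n R0 by (intro sum_mono2) auto
    finally have 3: "(\<Sum>k\<in>{1<..n}. R (k-1)) \<le> (\<Sum>k=0..N. R k)" .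
    \<comment> \<open>All indices are at least 2, so the truncated subtraction is injective; its
      values start at 0, which brings in the initial gradient.\<close>
    have "(\<Sum>k\<in>{1<..n}. R (k-2)) = (\<Sum>k\<in>(\<lambda>k. k - 2) ` {1<..n}. R k)"
      by (subst sum.reindex) (auto simp: inj_on_def)
    also have "\<dots> \<le> (\<Sum>k=0..N. R k)" using n R0 by (intro sum_mono2) auto
    finally have "(\<Sum>k\<in>{1<..n}. R (k-1) + R (k-2)) \<le> 2 * ((1 + T * c + c / \<nu>) * D)"
      using 3 Rsum by (simp add: sum.distrib)
    then have "4 * L\<^sup>2 * (\<Sum>k\<in>{1<..n}. R (k-1) + R (k-2)) \<le> 4 * L\<^sup>2 * (2 * ((1 + T * c + c / \<nu>) * D))"
      by (intro mult_left_mono) auto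
    with tel[OF n] 1 2 show ?thesis by (simp add: e2_def algebra_simps)
  qed
  have eD: "0 \<le> e1 * D" "0 \<le> e2 * D" using e D by auto
  show "\<nu> * (g n)\<^sup>2 \<le> (e1 + e2) * D" if n: "n \<in> {1..N}" for n
  proof -
    have "0 \<le> 2 * dt * (\<Sum>k\<in>{1<..n}. (d k)\<^sup>2)" using dt by (simp add: sum_nonneg)
    moreover have "\<nu> * (g n)\<^sup>2 \<le> \<nu> * E n" using \<nu> by (simp add: E_def)
    ultimately show ?thesis using main[of n] n eD unfolding distrib_right by simp
  qed
  show "dt * (\<Sum>n=1..N. (d n)\<^sup>2) \<le> (e1 + e2) * D"
  proof (cases "N = 0")
    case True
    then show ?thesis using e D by simp
  next
    case False
    then have N: "1 \<le> N" by simp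
    have "{1..N} = insert 1 {1<..N}" using N by auto
    then have "dt * (\<Sum>n=1..N. (d n)\<^sup>2) = dt * (d 1)\<^sup>2 + dt * (\<Sum>k\<in>{1<..N}. (d k)\<^sup>2)"
      by (simp add: distrib_left)
    moreover have "0 \<le> \<nu> * ((g 1)\<^sup>2 + z\<^sup>2)" "0 \<le> \<nu> * E N" "0 \<le> dt * (\<Sum>k\<in>{1<..N}. (d k)\<^sup>2)"
      using \<nu> dt by (auto simp: E_def sum_nonneg)
    ultimately show ?thesis using b1[OF N] main[OF N order_refl] unfolding distrib_right by simp
  qed
qed

text \<open>The three summands belong to the first step, the second step and all later ones. The
  closed form shows that nothing but \<open>K\<close>, \<open>L\<close>, \<open>T\<close> and
  \<open>\<nu>\<close> enters.\<close>

definition stability_const :: "real \<Rightarrow> real \<Rightarrow> real \<Rightarrow> real \<Rightarrow> real" where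
  "stability_const K L T \<nu> =
    (let c1 = 2 * K\<^sup>2 + 2 + 1 / \<nu>; c2 = K\<^sup>2 * (8 * c1 + 1) + (1 + 1 / \<nu>);
         c3 = exp (energy_rate L \<nu> * T) * (10 * c2 + 3 * c1 + (10 + 2 / \<nu>)) in c1 + c2 + c3)"

definition gradient_stability_const :: "real \<Rightarrow> real \<Rightarrow> real \<Rightarrow> real \<Rightarrow> real" where
  "gradient_stability_const K L T \<nu> =
    (let e1 = 3 + 4 * K\<^sup>2;
         e2 = 3 * e1 + 4 + 8 * L\<^sup>2 * (1 + T * stability_const K L T \<nu> + stability_const K L T \<nu> / \<nu>) in e1 + e2)"

lemma stability_const_nonneg: "0 < \<nu> \<Longrightarrow> 0 \<le> stability_const K L T \<nu>"
  unfolding stability_const_def Let_def by (intro add_nonneg_nonneg mult_nonneg_nonneg) auto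

lemma gradient_stability_const_nonneg: "0 < \<nu> \<Longrightarrow> 0 \<le> T \<Longrightarrow> 0 \<le> gradient_stability_const K L T \<nu>"
  using stability_const_nonneg[of \<nu> K L T] unfolding gradient_stability_const_def Let_def
  by (intro add_nonneg_nonneg mult_nonneg_nonneg) auto

section \<open>Stability of the scheme\<close>

lemma H1norm_facts:
  assumes "\<Omega> \<in> sets lebesgue"
  shows "0 \<le> H1norm \<Omega> \<psi>" "nrm (lebesgue_on \<Omega>) \<psi> \<le> H1norm \<Omega> \<psi>" "nrm (lebesgue_on \<Omega>) (grad \<psi>) \<le> H1norm \<Omega> \<psi>"
    "H1norm \<Omega> \<psi> \<le> nrm (lebesgue_on \<Omega>) \<psi> + nrm (lebesgue_on \<Omega>) (grad \<psi>)"
    "(H1norm \<Omega> \<psi>)\<^sup>2 = (nrm (lebesgue_on \<Omega>) \<psi>)\<^sup>2 + (nrm (lebesgue_on \<Omega>) (grad \<psi>))\<^sup>2"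
  using assms by (auto simp: H1norm_def L2_eq sqrt_sum_squares_le_sum real_sqrt_sum_squares_ge1 real_sqrt_sum_squares_ge2)

text \<open>A real supremum is meaningful only for a bounded set, and the a priori bound
  \<open>C\<close> supplies this. Where \<open>H1norm\<close> vanishes the quotient is 0 by
  convention and carries no information; there \<open>C\<close> forces \<open>G\<close> to vanish as
  well.\<close>

lemma dual_norm_h_bounds:
  fixes \<Omega> :: "(real^'d) set"
  assumes C: "\<And>\<psi>. \<psi> \<in> V \<Longrightarrow> \<bar>G \<psi>\<bar> \<le> C * H1norm \<Omega> \<psi>" and \<Omega>: "\<Omega> \<in> sets lebesgue" and "0 \<le> C"
  shows "0 \<le> dual_norm_h \<Omega> V G" "dual_norm_h \<Omega> V G \<le> C"
    "\<psi> \<in> V \<Longrightarrow> \<bar>G \<psi>\<bar> \<le> dual_norm_h \<Omega> V G * H1norm \<Omega> \<psi>"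
proof -
  let ?S = "insert 0 {\<bar>G \<psi>\<bar> / H1norm \<Omega> \<psi> | \<psi>. \<psi> \<in> V \<and> \<psi> \<noteq> (\<lambda>x. 0)}"
  have le: "x \<le> C" if x: "x \<in> ?S" for x
  proof (cases "x = 0")
    case False
    then obtain \<psi> where \<psi>: "\<psi> \<in> V" "x = \<bar>G \<psi>\<bar> / H1norm \<Omega> \<psi>" using x by auto
    then have "H1norm \<Omega> \<psi> \<noteq> 0" using False by auto
    then have "0 < H1norm \<Omega> \<psi>" using H1norm_facts(1)[OF \<Omega>, of \<psi>] by simp
    then show ?thesis using C[OF \<psi>(1)] \<psi>(2) by (simp add: pos_divide_le_eq)
  qed (use assms in simp)
  then have bdd: "bdd_above ?S" by (rule bdd_aboveI)
  show "0 \<le> dual_norm_h \<Omega> V G" unfolding dual_norm_h_def by (rule cSup_upper[OF _ bdd]) simp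
  show "dual_norm_h \<Omega> V G \<le> C" unfolding dual_norm_h_def by (rule cSup_least) (use le in auto)
  show "\<bar>G \<psi>\<bar> \<le> dual_norm_h \<Omega> V G * H1norm \<Omega> \<psi>" if \<psi>: "\<psi> \<in> V"
  proof (cases "H1norm \<Omega> \<psi> = 0")
    case True
    then show ?thesis using C[OF \<psi>] by simp
  next
    case False
    have "grad (\<lambda>x. 0) x = 0" for x :: "real^'d" by (rule grad_eqI) simp
    then have "H1norm \<Omega> (\<lambda>x. 0) = 0" by (simp add: H1norm_def L2norm_def grad_L2norm_def set_lebesgue_integral_def)
    then have "\<psi> \<noteq> (\<lambda>x. 0)" using False by auto
    then have "\<bar>G \<psi>\<bar> / H1norm \<Omega> \<psi> \<le> dual_norm_h \<Omega> V G"
      unfolding dual_norm_h_def using \<psi> by (intro cSup_upper[OF _ bdd]) auto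
    moreover have "0 < H1norm \<Omega> \<psi>" using False H1norm_facts(1)[OF \<Omega>, of \<psi>] by simp
    ultimately show ?thesis by (simp add: pos_divide_le_eq)
  qed
qed

lemma N_T_time: "0 < dt \<Longrightarrow> 0 < T \<Longrightarrow> n \<le> N_T T dt \<Longrightarrow> real n * dt \<le> T"
proof -
  assume "0 < dt" "0 < T" "n \<le> N_T T dt"
  then have "real n \<le> real (nat \<lfloor>T / dt\<rfloor>)" unfolding N_T_def by (intro of_nat_mono)
  also have "\<dots> \<le> T / dt" using \<open>0 < dt\<close> \<open>0 < T\<close> by (simp add: of_nat_floor)
  finally show ?thesis using \<open>0 < dt\<close> by (simp add: pos_le_divide_eq)
qed

section \<open>Energy estimates for a solution of the scheme\<close>

locale scheme_solution =
  fixes \<Omega> :: "(real^'d) set" and Th and k :: nat and \<nu> T dt :: real and u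
    and Fn :: "nat \<Rightarrow> (real^'d \<Rightarrow> real) \<Rightarrow> real" and \<phi> :: "nat \<Rightarrow> real^'d \<Rightarrow> real"
  assumes d3: "CARD('d) \<le> 3" and P: "poly_domain_triang \<Omega> Th" and \<nu>: "0 < \<nu>" "\<nu> \<le> 1" and T: "0 < T"
    and vel: "velocity_field \<Omega> T u" and semi: "ereal dt * C_W1inf_semi \<Omega> T u \<le> ereal (1/8)" and dt: "0 < dt" "dt < 1"
    and \<phi>0: "\<phi> 0 \<in> Psi_h \<Omega> Th k" and solves: "solves_scheme \<Omega> (Psi_h \<Omega> Th k) \<nu> u dt (N_T T dt) Fn \<phi>"
begin

abbreviation "M \<equiv> lebesgue_on \<Omega>"
abbreviation "V \<equiv> Psi_h \<Omega> Th k"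
abbreviation "N \<equiv> N_T T dt"
definition a where "a = real_of_ereal (C_W1inf_norm \<Omega> T u)"
definition K where "K = flow_const TYPE('d) a"
text \<open>Dominates all coefficients of the transport error: \<open>4 * K\<close> and
  \<open>2 * K\<close> in the bound of order \<open>dt\<close>, \<open>4 * (1 + K)\<close> and
  \<open>1 + K\<close> in the bound without gradients.\<close>

definition L where "L = 5 * (1 + K)"
definition p where "p n = nrm M (\<phi> n)"
definition g where "g n = nrm M (grad (\<phi> n))"
definition b where "b n x = \<phi> (n-1) (X1 u dt n x) * gam u dt n x"
definition c where "c n x = \<phi> (n-2) (X1t u dt n x) * gamt u dt n x"

lemma \<Omega>m: "\<Omega> \<in> sets lebesgue"
  by (rule finite_measure_lebesgue_on_domain(1)[OF P])

lemma \<phi>V: "n \<le> N \<Longrightarrow> \<phi> n \<in> V"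
  using solves \<phi>0 by (cases "n = 0") (auto simp: solves_scheme_def)

lemmas V_sq = Psi_h_sq_integrable[OF P, where k = k]

lemma a_nonneg: "0 \<le> a"
proof -
  have "0 \<in> {0..T}" using T by simp
  then show ?thesis using velocity_bounds[OF P vel d3 dt(1) semi, of 0] unfolding a_def by (meson order_trans)
qed

lemma K_nonneg: "0 \<le> K" unfolding K_def by (rule flow_const_nonneg[OF a_nonneg])

lemma flow_estimates:
  assumes n: "n \<le> N" and \<psi>: "\<psi> \<in> V" and s: "s = dt \<or> s = 2 * dt"
  defines "X \<equiv> \<lambda>x. x - s *\<^sub>R u (real n * dt) x"
  shows "sq_integrable M (\<lambda>x. \<psi> (X x) * det (jac X x))"
    and "nrm M (\<lambda>x. \<psi> (X x) * det (jac X x)) \<le> K * nrm M \<psi>"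
    and "nrm M (\<lambda>x. \<psi> x - \<psi> (X x) * det (jac X x)) \<le> s * K * (nrm M \<psi> + nrm M (grad \<psi>))"
proof -
  have t: "real n * dt \<in> {0..T}" using N_T_time[OF dt(1) T n] dt by auto
  obtain \<Lambda> m where vb: "0 \<le> m" "m \<le> a" "dt * m \<le> 1/8" "\<Lambda>-lipschitz_on UNIV (u (real n * dt))" "2 * dt * \<Lambda> \<le> 3/4"
    "AE x in M. u (real n * dt) differentiable (at x) \<and> (\<forall>i j. \<bar>jac (u (real n * dt)) x $ i $ j\<bar> \<le> m)"
    "AE x in M. norm (u (real n * dt) x) \<le> 3 * a"
    using velocity_bounds[OF P vel d3 dt(1) semi t] unfolding a_def by blast
  have zero: "x \<notin> \<Omega> \<Longrightarrow> u (real n * dt) x = 0" for x using vel t by (auto simp: velocity_field_def)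
  have \<Lambda>: "0 \<le> dt * \<Lambda>" using dt lipschitz_on_nonneg[OF vb(4)] by simp
  have s': "0 \<le> s" "s * \<Lambda> \<le> 3/4" "s * m \<le> 1/4" using s vb \<Lambda> dt by auto
  note est = weighted_flow_estimates[OF P \<psi> vb(4) s' vb(1,2) zero vb(7,6)]
  show "sq_integrable M (\<lambda>x. \<psi> (X x) * det (jac X x))"
    and "nrm M (\<lambda>x. \<psi> (X x) * det (jac X x)) \<le> K * nrm M \<psi>"
    and "nrm M (\<lambda>x. \<psi> x - \<psi> (X x) * det (jac X x)) \<le> s * K * (nrm M \<psi> + nrm M (grad \<psi>))"
    unfolding X_def K_def using est by auto
qed

lemma X1_eq: "X1 u dt n = (\<lambda>x. x - dt *\<^sub>R u (real n * dt) x)" "X1t u dt n = (\<lambda>x. x - (2 * dt) *\<^sub>R u (real n * dt) x)"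
  by (auto simp: X1_def X1t_def)

lemma b_estimates:
  assumes "1 \<le> n" "n \<le> N"
  shows "sq_integrable M (b n)" "nrm M (b n) \<le> K * p (n-1)"
    "nrm M (\<lambda>x. \<phi> (n-1) x - b n x) \<le> dt * K * (p (n-1) + g (n-1))"
proof -
  have "\<phi> (n-1) \<in> V" using \<phi>V assms by simp
  from flow_estimates[OF assms(2) this, of dt]
  show "sq_integrable M (b n)" "nrm M (b n) \<le> K * p (n-1)"
    "nrm M (\<lambda>x. \<phi> (n-1) x - b n x) \<le> dt * K * (p (n-1) + g (n-1))"
    unfolding b_def[abs_def] p_def g_def gam_def X1_eq by auto
qed

lemma c_estimates:
  assumes "2 \<le> n" "n \<le> N"
  shows "sq_integrable M (c n)" "nrm M (c n) \<le> K * p (n-2)"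
    "nrm M (\<lambda>x. \<phi> (n-2) x - c n x) \<le> 2 * dt * K * (p (n-2) + g (n-2))"
proof -
  have "\<phi> (n-2) \<in> V" using \<phi>V assms by simp
  from flow_estimates[OF assms(2) this, of "2 * dt"]
  show "sq_integrable M (c n)" "nrm M (c n) \<le> K * p (n-2)"
    "nrm M (\<lambda>x. \<phi> (n-2) x - c n x) \<le> 2 * dt * K * (p (n-2) + g (n-2))"
    unfolding c_def[abs_def] p_def g_def gamt_def X1_eq by auto
qed

lemma scheme_eq1:
  assumes "1 \<le> N" "\<psi> \<in> V"
  shows "ip M (\<lambda>x. \<phi> 1 x - b 1 x) \<psi> + dt * \<nu> * ip M (grad (\<phi> 1)) (grad \<psi>) = dt * Fn 1 \<psi>"
proof -
  have "ip M (\<lambda>x. (1 / dt) * (\<phi> 1 x - b 1 x)) \<psi> + \<nu> * ip M (grad (\<phi> 1)) (grad \<psi>) = Fn 1 \<psi>"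
    using solves assms unfolding solves_scheme_def L2_eq[OF \<Omega>m] b_def by simp
  then have "dt * ((1 / dt) * ip M (\<lambda>x. \<phi> 1 x - b 1 x) \<psi> + \<nu> * ip M (grad (\<phi> 1)) (grad \<psi>)) = dt * Fn 1 \<psi>"
    unfolding ip_cmult_left by simp
  then show ?thesis using dt by (simp add: distrib_left)
qed

lemma scheme_eq2:
  assumes "2 \<le> n" "n \<le> N" "\<psi> \<in> V"
  shows "ip M (\<lambda>x. 3 * \<phi> n x - 4 * b n x + c n x) \<psi> + 2 * dt * \<nu> * ip M (grad (\<phi> n)) (grad \<psi>) = 2 * dt * Fn n \<psi>"
proof -
  have "ip M (\<lambda>x. (1 / (2 * dt)) * (3 * \<phi> n x - 4 * b n x + c n x)) \<psi> + \<nu> * ip M (grad (\<phi> n)) (grad \<psi>) = Fn n \<psi>"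
    using solves assms unfolding solves_scheme_def L2_eq[OF \<Omega>m] b_def c_def by (simp add: mult.assoc)
  then have "2 * dt * ((1 / (2 * dt)) * ip M (\<lambda>x. 3 * \<phi> n x - 4 * b n x + c n x) \<psi> + \<nu> * ip M (grad (\<phi> n)) (grad \<psi>)) = 2 * dt * Fn n \<psi>"
    unfolding ip_cmult_left by simp
  then show ?thesis using dt by (simp add: distrib_left)
qed

text \<open>The transport error: replacing the transported functions \<open>b n\<close>,
  \<open>c n\<close> by the undisplaced ones turns the scheme into BDF2 with \<open>err n\<close> as
  perturbation.\<close>

definition err where "err n x = 4 * (\<phi> (n-1) x - b n x) - (\<phi> (n-2) x - c n x)"

text \<open>The first bound uses that \<open>\<phi>\<close> minus its weighted transport is of order
  \<open>dt\<close>, the second only that the transport is bounded. At \<open>n = 2\<close> the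
  first one contains \<open>g 0\<close>: admissible in (ii), where the initial gradient is part of
  the data, but not in (i).\<close>

lemma err_estimates:
  assumes n: "2 \<le> n" "n \<le> N"
  shows "sq_integrable M (err n)"
    "nrm M (err n) \<le> L * dt * ((p (n-1) + p (n-2)) + (g (n-1) + g (n-2)))"
    "nrm M (err n) \<le> L * (p (n-1) + p (n-2))"
    "ip M (\<lambda>x. 3 * \<phi> n x - 4 * b n x + c n x) \<psi> = ip M (\<lambda>x. (3 * \<phi> n x - 4 * \<phi> (n-1) x + \<phi> (n-2) x) + err n x) \<psi>"
proof -
  note be = b_estimates[of n] and ce = c_estimates[of n]
  have sq: "sq_integrable M (\<phi> (n-1))" "sq_integrable M (\<phi> (n-2))"
    using V_sq(1) \<phi>V n by auto
  have sq1: "sq_integrable M (\<lambda>x. \<phi> (n-1) x - b n x)" "sq_integrable M (\<lambda>x. \<phi> (n-2) x - c n x)"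
    using sq be ce n by (auto intro: sq_integrable_diff)
  show "sq_integrable M (err n)" unfolding err_def[abs_def]
    by (rule sq_integrable_diff[OF sq_integrable_cmult[OF sq1(1)] sq1(2)])
  have tri: "nrm M (err n) \<le> 4 * nrm M (\<lambda>x. \<phi> (n-1) x - b n x) + nrm M (\<lambda>x. \<phi> (n-2) x - c n x)"
    unfolding err_def[abs_def] using nrm_triangle_diff[OF sq_integrable_cmult[OF sq1(1), of 4] sq1(2), unfolded nrm_cmult] by simp
  have nn: "0 \<le> p j" "0 \<le> g j" for j by (simp_all add: p_def g_def)
  have "4 * nrm M (\<lambda>x. \<phi> (n-1) x - b n x) + nrm M (\<lambda>x. \<phi> (n-2) x - c n x)
      \<le> 4 * (dt * K * (p (n-1) + g (n-1))) + 2 * dt * K * (p (n-2) + g (n-2))"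
    using be(3) ce(3) n by simp
  also have "\<dots> \<le> 5 * dt * (1 + K) * (p (n-1) + g (n-1)) + 5 * dt * (1 + K) * (p (n-2) + g (n-2))"
  proof (rule add_mono)
    show "4 * (dt * K * (p (n-1) + g (n-1))) \<le> 5 * dt * (1 + K) * (p (n-1) + g (n-1))"
      unfolding mult.assoc[symmetric] using nn K_nonneg dt by (intro mult_right_mono) (auto intro!: mult_mono)
    show "2 * dt * K * (p (n-2) + g (n-2)) \<le> 5 * dt * (1 + K) * (p (n-2) + g (n-2))"
      using nn K_nonneg dt by (intro mult_right_mono) (auto intro!: mult_mono)
  qed
  finally show "nrm M (err n) \<le> L * dt * ((p (n-1) + p (n-2)) + (g (n-1) + g (n-2)))"
    using tri by (simp add: L_def algebra_simps)
  have "nrm M (\<lambda>x. \<phi> (n-1) x - b n x) \<le> p (n-1) + K * p (n-1)"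
    using nrm_triangle_diff[OF sq(1) be(1)] be(2) n unfolding p_def by simp
  moreover have "nrm M (\<lambda>x. \<phi> (n-2) x - c n x) \<le> p (n-2) + K * p (n-2)"
    using nrm_triangle_diff[OF sq(2) ce(1)] ce(2) n unfolding p_def by simp
  ultimately have "nrm M (err n) \<le> 4 * ((1 + K) * p (n-1)) + (1 + K) * p (n-2)"
    using tri by (simp add: algebra_simps)
  also have "\<dots> \<le> L * (p (n-1) + p (n-2))"
    using mult_nonneg_nonneg[OF K_nonneg nn(1)[of "n-1"]] mult_nonneg_nonneg[OF K_nonneg nn(1)[of "n-2"]] nn(1)[of "n-1"] nn(1)[of "n-2"]
    unfolding L_def by (simp add: algebra_simps)
  finally show "nrm M (err n) \<le> L * (p (n-1) + p (n-2))" .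
  show "ip M (\<lambda>x. 3 * \<phi> n x - 4 * b n x + c n x) \<psi> = ip M (\<lambda>x. (3 * \<phi> n x - 4 * \<phi> (n-1) x + \<phi> (n-2) x) + err n x) \<psi>"
    by (simp add: err_def algebra_simps)
qed

text \<open>Extended by 0 beyond the time levels, so that it is nonnegative for every index.\<close>

definition dual where "dual n = (if n \<in> {1..N} then dual_norm_h \<Omega> V (Fn n) else 0)"

text \<open>No finite-dimensionality of the finite element space is needed: the scheme itself represents the
  functional, so the supremum defining the dual norm is over a bounded set.\<close>

lemma Fn_bounded: "n \<in> {1..N} \<Longrightarrow> \<exists>C\<ge>0. \<forall>\<psi>\<in>V. \<bar>Fn n \<psi>\<bar> \<le> C * H1norm \<Omega> \<psi>"
proof -
  assume n: "n \<in> {1..N}"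
  \<comment> \<open>Both forms of the scheme are brought to one shape, with \<open>s\<close> equal
    to \<open>dt\<close> or \<open>2 * dt\<close>.\<close>
  have "\<exists>h s. sq_integrable M h \<and> 0 < s \<and> (\<forall>\<psi>\<in>V. ip M h \<psi> + s * \<nu> * ip M (grad (\<phi> n)) (grad \<psi>) = s * Fn n \<psi>)"
  proof (cases "n = 1")
    case True
    have "sq_integrable M (\<lambda>x. \<phi> 1 x - b 1 x)"
      using n True by (intro sq_integrable_diff b_estimates(1) V_sq(1) \<phi>V) auto
    then show ?thesis using True n dt scheme_eq1 by (intro exI[of _ "\<lambda>x. \<phi> 1 x - b 1 x"] exI[of _ dt]) auto
  next
    case False
    then have n2: "2 \<le> n" "n \<le> N" using n by auto
    have "sq_integrable M (\<lambda>x. 3 * \<phi> n x - 4 * b n x + c n x)"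
      using n2 by (intro sq_integrable_intros b_estimates(1) c_estimates(1) V_sq(1) \<phi>V) auto
    then show ?thesis
      using n2 dt scheme_eq2 by (intro exI[of _ "\<lambda>x. 3 * \<phi> n x - 4 * b n x + c n x"] exI[of _ "2 * dt"]) auto
  qed
  then obtain h s where h: "sq_integrable M h" "0 < s"
    "\<forall>\<psi>\<in>V. ip M h \<psi> + s * \<nu> * ip M (grad (\<phi> n)) (grad \<psi>) = s * Fn n \<psi>" by blast
  have "\<bar>Fn n \<psi>\<bar> \<le> (nrm M h / s + \<nu> * g n) * H1norm \<Omega> \<psi>" if \<psi>: "\<psi> \<in> V" for \<psi>
  proof -
    have "s * \<bar>Fn n \<psi>\<bar> = \<bar>ip M h \<psi> + s * \<nu> * ip M (grad (\<phi> n)) (grad \<psi>)\<bar>"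
      using h \<psi> by (simp add: abs_mult)
    also have "\<dots> \<le> \<bar>ip M h \<psi>\<bar> + s * \<nu> * \<bar>ip M (grad (\<phi> n)) (grad \<psi>)\<bar>"
      using h(2) \<nu> by (rule_tac order_trans[OF abs_triangle_ineq]) (simp add: abs_mult)
    also have "\<dots> \<le> nrm M h * nrm M \<psi> + s * \<nu> * (g n * nrm M (grad \<psi>))"
      unfolding g_def using h(1,2) \<nu> n \<psi>
      by (intro add_mono mult_left_mono ip_Cauchy_Schwarz V_sq[OF \<psi>] V_sq(2)[OF \<phi>V]) auto
    also have "\<dots> \<le> nrm M h * H1norm \<Omega> \<psi> + s * \<nu> * (g n * H1norm \<Omega> \<psi>)"
      using h(2) \<nu> by (intro add_mono mult_left_mono H1norm_facts[OF \<Omega>m]) (auto simp: g_def)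
    also have "\<dots> = s * ((nrm M h / s + \<nu> * g n) * H1norm \<Omega> \<psi>)" using h(2) by (simp add: field_simps)
    finally show ?thesis using h(2) by simp
  qed
  moreover have "0 \<le> nrm M h / s + \<nu> * g n" using h(2) \<nu> by (simp add: g_def)
  ultimately show ?thesis by blast
qed

lemma dual_nonneg: "0 \<le> dual n"
proof (cases "n \<in> {1..N}")
  case True
  from Fn_bounded[OF this] obtain C where "0 \<le> C" "\<And>\<psi>. \<psi> \<in> V \<Longrightarrow> \<bar>Fn n \<psi>\<bar> \<le> C * H1norm \<Omega> \<psi>" by blast
  from dual_norm_h_bounds(1)[OF this(2) \<Omega>m this(1)] show ?thesis using True by (simp add: dual_def)
qed (auto simp: dual_def)

lemma dual_bound:
  assumes n: "n \<in> {1..N}" and \<psi>: "\<psi> \<in> V"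
  shows "Fn n \<psi> \<le> dual n * (nrm M \<psi> + nrm M (grad \<psi>))"
proof -
  from Fn_bounded[OF n] obtain C where C: "0 \<le> C" "\<And>\<psi>. \<psi> \<in> V \<Longrightarrow> \<bar>Fn n \<psi>\<bar> \<le> C * H1norm \<Omega> \<psi>" by blast
  have "\<bar>Fn n \<psi>\<bar> \<le> dual n * H1norm \<Omega> \<psi>"
    using dual_norm_h_bounds(3)[OF C(2) \<Omega>m C(1) \<psi>] n by (simp add: dual_def)
  also have "\<dots> \<le> dual n * (nrm M \<psi> + nrm M (grad \<psi>))"
    by (intro mult_left_mono H1norm_facts(4)[OF \<Omega>m] dual_nonneg)
  finally show ?thesis by simp
qed

definition q where "q n = nrm M (\<lambda>x. 2 *\<^sub>R \<phi> n x - \<phi> (n-1) x)"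
definition r where "r n = nrm M (\<lambda>x. \<phi> n x - 2 *\<^sub>R \<phi> (n-1) x + \<phi> (n-2) x)"

text \<open>In the first two steps the transported functions are not compared with the undisplaced
  ones but bounded directly by \<open>K\<close>. The loss of a fixed factor is harmless for two
  steps, and no gradient of \<open>\<phi> 0\<close> appears.\<close>

lemma energy_first:
  assumes N: "1 \<le> N"
  shows "(p 1)\<^sup>2 + dt * \<nu> * (g 1)\<^sup>2 \<le> K * p 0 * p 1 + dt * dual 1 * (p 1 + g 1)"
proof -
  have V1: "\<phi> 1 \<in> V" using \<phi>V N by simp
  note be = b_estimates[of 1, OF order_refl N]
  have "ip M (b 1) (\<phi> 1) \<le> K * p 0 * p 1"
    using ip_le[OF be(1) V_sq(1)[OF V1]] mult_right_mono[OF be(2), of "p 1"] by (simp add: p_def)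
  moreover have "ip M (\<lambda>x. \<phi> 1 x - b 1 x) (\<phi> 1) = (p 1)\<^sup>2 - ip M (b 1) (\<phi> 1)"
    by (subst ip_diff_left[OF V_sq(1)[OF V1] be(1) V_sq(1)[OF V1]]) (simp add: ip_self p_def)
  moreover have "dt * Fn 1 (\<phi> 1) \<le> dt * (dual 1 * (p 1 + g 1))"
    using dual_bound[of 1, OF _ V1] N dt unfolding p_def g_def by (intro mult_left_mono) auto
  ultimately show ?thesis using scheme_eq1[OF N V1] by (simp add: ip_self g_def[symmetric] mult.assoc)
qed

lemma energy_second:
  assumes N: "2 \<le> N"
  shows "3 * (p 2)\<^sup>2 + 2 * dt * \<nu> * (g 2)\<^sup>2 \<le> K * (4 * p 1 + p 0) * p 2 + 2 * dt * dual 2 * (p 2 + g 2)"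
proof -
  have V2: "\<phi> 2 \<in> V" using \<phi>V N by simp
  note be = b_estimates[of 2, OF _ N, simplified] and ce = c_estimates[of 2, OF order_refl N, simplified]
  note sq = V_sq(1)[OF V2]
  have "ip M (b 2) (\<phi> 2) \<le> K * p 1 * p 2"
    using ip_le[OF be(1) sq] mult_right_mono[OF be(2), of "p 2"] by (simp add: p_def)
  moreover have "- (K * p 0 * p 2) \<le> ip M (c 2) (\<phi> 2)"
    using ip_Cauchy_Schwarz[OF ce(1) sq] mult_right_mono[OF ce(2), of "p 2"] by (simp add: p_def)
  moreover have "ip M (\<lambda>x. 3 * \<phi> 2 x - 4 * b 2 x + c 2 x) (\<phi> 2) = 3 * (p 2)\<^sup>2 - 4 * ip M (b 2) (\<phi> 2) + ip M (c 2) (\<phi> 2)"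
    by (subst ip_add_left ip_diff_left, (intro sq_integrable_intros sq be(1) ce(1))+)+
      (simp add: ip_cmult_left ip_self p_def)
  moreover have "2 * dt * Fn 2 (\<phi> 2) \<le> 2 * dt * (dual 2 * (p 2 + g 2))"
    using dual_bound[of 2, OF _ V2] N dt unfolding p_def g_def by (intro mult_left_mono) auto
  ultimately show ?thesis
    using scheme_eq2[OF order_refl N V2] by (simp add: ip_self g_def[symmetric] algebra_simps)
qed

text \<open>Testing with \<open>\<phi> n\<close> and applying \<open>BDF2_identity\<close>. The
  bound on \<open>p n\<close> writes \<open>\<phi> n\<close> as second difference plus the
  extrapolation \<open>2 \<phi> (n-1) - \<phi> (n-2)\<close>, the splitting on which
  \<open>energy_step\<close> rests.\<close>

lemma energy_later:
  assumes n: "2 \<le> n" "n \<le> N"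
  shows "(p n)\<^sup>2 + (q n)\<^sup>2 + (r n)\<^sup>2 + 4 * dt * \<nu> * (g n)\<^sup>2
      \<le> (p (n-1))\<^sup>2 + (q (n-1))\<^sup>2 + 4 * dt * dual n * (p n + g n) + 2 * nrm M (err n) * p n"
    and "p n \<le> r n + q (n-1)" "q n \<le> 2 * p n + p (n-1)" "p (n-1) \<le> 2 * p n + q n"
proof -
  have Vn: "\<phi> n \<in> V" "\<phi> (n-1) \<in> V" "\<phi> (n-2) \<in> V" using \<phi>V n by auto
  note sq = V_sq(1)[OF Vn(1)] V_sq(1)[OF Vn(2)] V_sq(1)[OF Vn(3)]
  have n2: "n - 1 - 1 = n - 2" by simp
  have bdf: "2 * ip M (\<lambda>x. 3 * \<phi> n x - 4 * \<phi> (n-1) x + \<phi> (n-2) x) (\<phi> n) =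
      (p n)\<^sup>2 + (q n)\<^sup>2 - ((p (n-1))\<^sup>2 + (q (n-1))\<^sup>2) + (r n)\<^sup>2"
    using BDF2_identity[OF sq] unfolding p_def q_def r_def n2 by simp
  have "ip M (\<lambda>x. (3 * \<phi> n x - 4 * \<phi> (n-1) x + \<phi> (n-2) x) + err n x) (\<phi> n) =
      ip M (\<lambda>x. 3 * \<phi> n x - 4 * \<phi> (n-1) x + \<phi> (n-2) x) (\<phi> n) + ip M (err n) (\<phi> n)"
    by (rule ip_add_left) (intro sq_integrable_intros sq err_estimates(1)[OF n])+
  moreover have "- (nrm M (err n) * p n) \<le> ip M (err n) (\<phi> n)"
    using ip_Cauchy_Schwarz[OF err_estimates(1)[OF n] sq(1)] by (simp add: p_def)
  moreover have "2 * dt * Fn n (\<phi> n) \<le> 2 * dt * (dual n * (p n + g n))"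
    using dual_bound[of n, OF _ Vn(1)] n dt unfolding p_def g_def by (intro mult_left_mono) auto
  ultimately show "(p n)\<^sup>2 + (q n)\<^sup>2 + (r n)\<^sup>2 + 4 * dt * \<nu> * (g n)\<^sup>2
      \<le> (p (n-1))\<^sup>2 + (q (n-1))\<^sup>2 + 4 * dt * dual n * (p n + g n) + 2 * nrm M (err n) * p n"
    using scheme_eq2[OF n Vn(1)] bdf unfolding err_estimates(4)[OF n] by (simp add: ip_self g_def[symmetric] algebra_simps)
  have "\<phi> n = (\<lambda>x. (\<phi> n x - 2 *\<^sub>R \<phi> (n-1) x + \<phi> (n-2) x) + (2 *\<^sub>R \<phi> (n-1) x - \<phi> (n-2) x))" by auto
  then have "p n = nrm M (\<lambda>x. (\<phi> n x - 2 *\<^sub>R \<phi> (n-1) x + \<phi> (n-2) x) + (2 *\<^sub>R \<phi> (n-1) x - \<phi> (n-2) x))"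
    unfolding p_def by (rule arg_cong)
  also have "\<dots> \<le> r n + q (n-1)"
    unfolding r_def q_def n2 by (intro nrm_triangle sq_integrable_intros sq)
  finally show "p n \<le> r n + q (n-1)" .
  show "q n \<le> 2 * p n + p (n-1)"
    using nrm_triangle_diff[OF sq_integrable_scaleR[OF sq(1), of 2] sq(2)] unfolding q_def p_def nrm_scaleR by simp
  have "\<phi> (n-1) = (\<lambda>x. 2 *\<^sub>R \<phi> n x - (2 *\<^sub>R \<phi> n x - \<phi> (n-1) x))" by auto
  then have "p (n-1) = nrm M (\<lambda>x. 2 *\<^sub>R \<phi> n x - (2 *\<^sub>R \<phi> n x - \<phi> (n-1) x))"
    unfolding p_def by (rule arg_cong)
  also have "\<dots> \<le> nrm M (\<lambda>x. 2 *\<^sub>R \<phi> n x) + q n"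
    unfolding q_def by (intro nrm_triangle_diff sq_integrable_intros sq)
  finally show "p (n-1) \<le> 2 * p n + q n" unfolding nrm_scaleR by (simp add: p_def)
qed

lemma L2_stability:
  defines "D \<equiv> (p 0)\<^sup>2 + dt * (\<Sum>n=1..N. (dual n)\<^sup>2)"
  shows "\<And>n. n \<in> {1..N} \<Longrightarrow> (p n)\<^sup>2 \<le> stability_const K L T \<nu> * D"
    and "dt * \<nu> * (\<Sum>n=1..N. (g n)\<^sup>2) \<le> stability_const K L T \<nu> * D"
proof -
  have nn: "0 \<le> p n" "0 \<le> g n" "0 \<le> q n" "0 \<le> r n" "0 \<le> nrm M (err n)" for n
    by (simp_all add: p_def g_def q_def r_def)
  have time: "real N * dt \<le> T" by (rule N_T_time[OF dt(1) T order_refl])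
  have L0: "0 \<le> L" using K_nonneg by (simp add: L_def)
  have later: "2 \<le> n" if "3 \<le> n" for n :: nat using that by simp
  have q: "q n \<le> 2 * p n + p (n-1) \<and> p (n-1) \<le> 2 * p n + q n" if "2 \<le> n" "n \<le> N" for n
    using energy_later(3,4)[OF that] by simp
  note ds = discrete_stability[where p = p and g = g and q = q and F = dual and r = r and w = "\<lambda>n. nrm M (err n)",
      OF dt time \<nu>(1) K_nonneg L0 nn(1-3) dual_nonneg energy_first energy_second nn(4,5)
      energy_later(1)[OF later] energy_later(2)[OF later] err_estimates(2)[OF later] err_estimates(3)[OF later] q]
  show "(p n)\<^sup>2 \<le> stability_const K L T \<nu> * D" if "n \<in> {1..N}" for n
    unfolding stability_const_def Let_def D_def using ds(1) that by simp
  show "dt * \<nu> * (\<Sum>n=1..N. (g n)\<^sup>2) \<le> stability_const K L T \<nu> * D"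
    unfolding stability_const_def Let_def D_def using ds(2) by simp
qed

text \<open>Each of the two norms on the left is bounded by the same square root, whence the factor
  2.\<close>

lemma L2_stability_norms:
  "linf1 N p + sqrt \<nu> * l21 dt N g \<le> 2 * sqrt (stability_const K L T \<nu>) * (p 0 + l21 dt N dual)"
proof -
  let ?S = "stability_const K L T \<nu>" and ?X = "dt * (\<Sum>n=1..N. (dual n)\<^sup>2)"
  have S: "0 \<le> ?S" by (rule stability_const_nonneg[OF \<nu>(1)])
  have X: "0 \<le> ?X" using dt by (simp add: sum_nonneg)
  have p0: "0 \<le> p 0" by (simp add: p_def)
  have "sqrt (?S * ((p 0)\<^sup>2 + ?X)) = sqrt ?S * sqrt ((p 0)\<^sup>2 + ?X)" by (rule real_sqrt_mult)
  also have "\<dots> \<le> sqrt ?S * (sqrt ((p 0)\<^sup>2) + sqrt ?X)"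
    by (rule mult_left_mono[OF sqrt_add_le_add_sqrt]) (use S X in auto)
  finally have "sqrt (?S * ((p 0)\<^sup>2 + ?X)) \<le> sqrt ?S * (sqrt ((p 0)\<^sup>2) + sqrt ?X)" .
  then have R: "sqrt (?S * ((p 0)\<^sup>2 + ?X)) \<le> sqrt ?S * (p 0 + l21 dt N dual)"
    using p0 by (simp add: l21_def)
  have "p n \<le> sqrt (?S * ((p 0)\<^sup>2 + ?X))" if "n \<in> {1..N}" for n
    by (rule real_le_rsqrt) (rule L2_stability(1)[OF that])
  then have "linf1 N p \<le> sqrt (?S * ((p 0)\<^sup>2 + ?X))"
    using S X unfolding linf1_def by (intro Max.boundedI) auto
  moreover have "sqrt \<nu> * l21 dt N g \<le> sqrt (?S * ((p 0)\<^sup>2 + ?X))"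
    unfolding l21_def real_sqrt_mult[symmetric] using L2_stability(2)
    by (intro real_sqrt_le_mono) (simp add: mult_ac)
  ultimately show ?thesis using R by (simp add: algebra_simps)
qed

section \<open>Testing with the discrete time derivative\<close>

lemma Dbar_in_V:
  assumes n: "n \<in> {1..N}"
  shows "Dbar dt \<phi> n \<in> V"
proof (cases "n = 1")
  case True
  have "(\<lambda>x. (1/dt) * \<phi> 1 x + (-1/dt) * \<phi> 0 x) \<in> V"
    using \<phi>V n by (intro Psi_h_linear_combination) auto
  moreover have "(\<lambda>x. (1/dt) * \<phi> 1 x + (-1/dt) * \<phi> 0 x) = Dbar dt \<phi> n"
    using True dt by (auto simp: Dbar_def field_simps)
  ultimately show ?thesis by simp
next
  case False
  have "(\<lambda>x. 1 * ((3/(2*dt)) * \<phi> n x + (-4/(2*dt)) * \<phi> (n-1) x) + (1/(2*dt)) * \<phi> (n-2) x) \<in> V"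
    using \<phi>V n by (intro Psi_h_linear_combination) auto
  moreover have "(\<lambda>x. 1 * ((3/(2*dt)) * \<phi> n x + (-4/(2*dt)) * \<phi> (n-1) x) + (1/(2*dt)) * \<phi> (n-2) x) = Dbar dt \<phi> n"
    using False dt by (auto simp: Dbar_def field_simps)
  ultimately show ?thesis by simp
qed

lemma grad_Dbar_first:
  assumes N: "1 \<le> N"
  shows "AE x in M. grad (Dbar dt \<phi> 1) x = (1/dt) *\<^sub>R (grad (\<phi> 1) x - grad (\<phi> 0) x)"
proof -
  have "(\<lambda>x. (1/dt) * \<phi> 1 x + (-1/dt) * \<phi> 0 x) = Dbar dt \<phi> 1"
    using dt by (auto simp: Dbar_def field_simps)
  with grad_linear_combination[OF P \<phi>V[OF N] \<phi>0, of "1/dt" "-1/dt"] show ?thesis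
    by (simp add: scaleR_diff_right)
qed

lemma grad_Dbar_later:
  assumes n: "2 \<le> n" "n \<le> N"
  shows "AE x in M. grad (Dbar dt \<phi> n) x = (1/(2*dt)) *\<^sub>R (3 *\<^sub>R grad (\<phi> n) x - 4 *\<^sub>R grad (\<phi> (n-1)) x + grad (\<phi> (n-2)) x)"
proof -
  have Vn: "\<phi> n \<in> V" "\<phi> (n-1) \<in> V" "\<phi> (n-2) \<in> V" using \<phi>V n by auto
  let ?A = "\<lambda>x. 3 * \<phi> n x + (-4) * \<phi> (n-1) x"
  have A: "?A \<in> V" by (intro Psi_h_linear_combination Vn)
  have eq: "(\<lambda>x. (1/(2*dt)) * ?A x + (1/(2*dt)) * \<phi> (n-2) x) = Dbar dt \<phi> n"
    using n dt by (auto simp: Dbar_def field_simps)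
  from grad_linear_combination[OF P Vn(1,2), of 3 "-4"] grad_linear_combination[OF P A Vn(3), of "1/(2*dt)" "1/(2*dt)"]
  show ?thesis unfolding eq by eventually_elim (simp add: scaleR_add_right scaleR_diff_right)
qed

end

locale scheme_solution_L2 = scheme_solution \<Omega> Th k \<nu> T dt u "\<lambda>n \<psi>. L2ip \<Omega> (f n) \<psi>" \<phi>
  for \<Omega> :: "(real^'d) set" and Th k \<nu> T dt u and f :: "nat \<Rightarrow> real^'d \<Rightarrow> real" and \<phi> +
  assumes f_sq: "n \<in> {1..N} \<Longrightarrow> sq_integrable M (f n)"
begin

definition F where "F n = (if n \<in> {1..N} then nrm M (f n) else 0)"
definition d where "d n = nrm M (Dbar dt \<phi> n)"
definition Gq where "Gq n = nrm M (\<lambda>x. 2 *\<^sub>R grad (\<phi> n) x - grad (\<phi> (n-1)) x)"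

lemma F_nonneg: "0 \<le> F n" by (simp add: F_def)

text \<open>Lets the estimates of part (i), stated with dual norms, be used with the stronger data
  norm of part (ii).\<close>

lemma dual_le_F: "dual n \<le> F n"
proof (cases "n \<in> {1..N}")
  case True
  have "\<bar>L2ip \<Omega> (f n) \<psi>\<bar> \<le> nrm M (f n) * H1norm \<Omega> \<psi>" if "\<psi> \<in> V" for \<psi>
    unfolding L2_eq[OF \<Omega>m] using ip_Cauchy_Schwarz[OF f_sq[OF True] V_sq(1)[OF that]]
    by (rule order_trans) (intro mult_left_mono H1norm_facts(2)[OF \<Omega>m] nrm_nonneg)
  then have "dual_norm_h \<Omega> V (\<lambda>\<psi>. L2ip \<Omega> (f n) \<psi>) \<le> nrm M (f n)"
    by (rule dual_norm_h_bounds(2)[OF _ \<Omega>m]) auto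
  then show ?thesis using True by (simp add: dual_def F_def)
qed (auto simp: dual_def F_def)

lemma data_bound: "n \<in> {1..N} \<Longrightarrow> \<psi> \<in> V \<Longrightarrow> L2ip \<Omega> (f n) \<psi> \<le> F n * nrm M \<psi>"
  unfolding L2_eq[OF \<Omega>m] F_def using ip_le[OF f_sq V_sq(1)] by simp

text \<open>The gradient term comes from \<open>2 (A, A - B) = |A|^2 - |B|^2 + |A - B|^2\<close> for
  the gradients of \<open>\<phi> 1\<close> and \<open>\<phi> 0\<close>. The square of
  \<open>z\<close> is kept because it controls \<open>Gq 1\<close>, the second half of the gradient
  energy at which the BDF2 recursion starts.\<close>

lemma gradient_first:
  assumes N: "1 \<le> N"
  defines "z \<equiv> nrm M (\<lambda>x. grad (\<phi> 1) x - grad (\<phi> 0) x)"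
  shows "2 * dt * (d 1)\<^sup>2 + \<nu> * ((g 1)\<^sup>2 - (g 0)\<^sup>2 + z\<^sup>2) \<le> 2 * dt * (F 1 + K * (p 0 + g 0)) * d 1"
    and "Gq 1 \<le> g 1 + z"
proof -
  let ?D = "Dbar dt \<phi> 1"
  have V1: "\<phi> 1 \<in> V" using \<phi>V N by simp
  have DV: "?D \<in> V" using Dbar_in_V N by simp
  note sq = V_sq(1)[OF V1] V_sq(1)[OF \<phi>0] V_sq(1)[OF DV] and gsq = V_sq(2)[OF V1] V_sq(2)[OF \<phi>0] V_sq(2)[OF DV]
  note be = b_estimates[of 1, OF order_refl N, simplified]
  have bsq: "sq_integrable M (\<lambda>x. \<phi> 0 x - b 1 x)" by (rule sq_integrable_diff[OF sq(2)]) (use be in simp)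
  have "(\<lambda>x. \<phi> 1 x - b 1 x) = (\<lambda>x. dt * ?D x + (\<phi> 0 x - b 1 x))" using dt by (auto simp: Dbar_def)
  then have "ip M (\<lambda>x. \<phi> 1 x - b 1 x) ?D = dt * (d 1)\<^sup>2 + ip M (\<lambda>x. \<phi> 0 x - b 1 x) ?D"
    by (simp only: ip_add_left[OF sq_integrable_cmult[OF sq(3)] bsq sq(3)] ip_cmult_left ip_self d_def)
  moreover have "- (dt * K * (p 0 + g 0) * d 1) \<le> ip M (\<lambda>x. \<phi> 0 x - b 1 x) ?D"
    using ip_Cauchy_Schwarz[OF bsq sq(3)] mult_right_mono[OF be(3), of "d 1"] by (simp add: d_def)
  moreover have "dt * L2ip \<Omega> (f 1) ?D \<le> dt * (F 1 * d 1)"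
    unfolding d_def using data_bound[of 1, OF _ DV] N dt by (intro mult_left_mono) auto
  moreover have "\<nu> * ((g 1)\<^sup>2 - (g 0)\<^sup>2 + z\<^sup>2) = 2 * (dt * \<nu> * ip M (grad (\<phi> 1)) (grad ?D))"
  proof -
    have "ip M (grad ?D) (grad (\<phi> 1)) = ip M (\<lambda>x. (1/dt) *\<^sub>R (grad (\<phi> 1) x - grad (\<phi> 0) x)) (grad (\<phi> 1))"
      by (intro ip_cong_AE grad_Dbar_first[OF N] gsq[THEN sq_integrableD(1)]
          sq_integrableD(1)[OF sq_integrable_scaleR[OF sq_integrable_diff[OF gsq(1,2)]]])
    also have "\<dots> = (1/dt) * ((g 1)\<^sup>2 - ip M (grad (\<phi> 0)) (grad (\<phi> 1)))"
      by (simp only: ip_scaleR_left ip_diff_left[OF gsq(1,2,1)] ip_self g_def)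
    finally have "dt * ip M (grad (\<phi> 1)) (grad ?D) = dt * ((1/dt) * ((g 1)\<^sup>2 - ip M (grad (\<phi> 0)) (grad (\<phi> 1))))"
      by (simp only: ip_commute[of M "grad (\<phi> 1)" "grad ?D"])
    then have "dt * ip M (grad (\<phi> 1)) (grad ?D) = (g 1)\<^sup>2 - ip M (grad (\<phi> 0)) (grad (\<phi> 1))"
      using dt by simp
    moreover have "z\<^sup>2 = (g 1)\<^sup>2 - 2 * ip M (grad (\<phi> 0)) (grad (\<phi> 1)) + (g 0)\<^sup>2"
      unfolding z_def g_def ip_commute[of M "grad (\<phi> 0)" "grad (\<phi> 1)"]
      by (rule nrm_diff_power2[OF gsq(1,2)])
    ultimately have "(g 1)\<^sup>2 - (g 0)\<^sup>2 + z\<^sup>2 = 2 * (dt * ip M (grad (\<phi> 1)) (grad ?D))" by simp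
    then show ?thesis by simp
  qed
  moreover have "2 * dt * (F 1 + K * (p 0 + g 0)) * d 1 = 2 * (dt * (F 1 * d 1)) + 2 * (dt * K * (p 0 + g 0) * d 1)"
    by (simp add: algebra_simps)
  ultimately show "2 * dt * (d 1)\<^sup>2 + \<nu> * ((g 1)\<^sup>2 - (g 0)\<^sup>2 + z\<^sup>2) \<le> 2 * dt * (F 1 + K * (p 0 + g 0)) * d 1"
    using scheme_eq1[OF N DV] by linarith
  have "(\<lambda>x. 2 *\<^sub>R grad (\<phi> 1) x - grad (\<phi> 0) x) = (\<lambda>x. grad (\<phi> 1) x + (grad (\<phi> 1) x - grad (\<phi> 0) x))"
    by (simp add: scaleR_2)
  then show "Gq 1 \<le> g 1 + z"
    using nrm_triangle[OF gsq(1) sq_integrable_diff[OF gsq(1,2)]] unfolding Gq_def g_def z_def by simp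
qed

text \<open>Up to the factor \<open>1 / (2 * dt)\<close> the gradient of the test function is the
  BDF2 difference of gradients, so \<open>BDF2_identity\<close> applies to them; its dissipation
  square is dropped.\<close>

lemma gradient_later:
  assumes n: "2 \<le> n" "n \<le> N"
  shows "4 * dt * (d n)\<^sup>2 + \<nu> * ((g n)\<^sup>2 + (Gq n)\<^sup>2 - ((g (n-1))\<^sup>2 + (Gq (n-1))\<^sup>2))
      \<le> dt * (4 * F n + 2 * L * ((p (n-1) + p (n-2)) + (g (n-1) + g (n-2)))) * d n"
proof -
  let ?D = "Dbar dt \<phi> n" and ?e = "(p (n-1) + p (n-2)) + (g (n-1) + g (n-2))"
  have Vn: "\<phi> n \<in> V" "\<phi> (n-1) \<in> V" "\<phi> (n-2) \<in> V" using \<phi>V n by auto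
  have DV: "?D \<in> V" using Dbar_in_V n by simp
  note sq = V_sq(1)[OF DV] and gsq = V_sq(2)[OF Vn(1)] V_sq(2)[OF Vn(2)] V_sq(2)[OF Vn(3)] V_sq(2)[OF DV]
  note err = err_estimates[OF n]
  have n2: "n - 1 - 1 = n - 2" by simp
  have "(\<lambda>x. (3 * \<phi> n x - 4 * \<phi> (n-1) x + \<phi> (n-2) x) + err n x) = (\<lambda>x. (2 * dt) * ?D x + err n x)"
    using dt n by (auto simp: Dbar_def)
  then have "ip M (\<lambda>x. (3 * \<phi> n x - 4 * \<phi> (n-1) x + \<phi> (n-2) x) + err n x) ?D = 2 * dt * (d n)\<^sup>2 + ip M (err n) ?D"
    by (simp only: ip_add_left[OF sq_integrable_cmult[OF sq] err(1) sq] ip_cmult_left ip_self d_def)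
  moreover have "- (L * dt * ?e * d n) \<le> ip M (err n) ?D"
    using ip_Cauchy_Schwarz[OF err(1) sq] mult_right_mono[OF err(2), of "d n"] by (simp add: d_def)
  moreover have "2 * dt * L2ip \<Omega> (f n) ?D \<le> 2 * dt * (F n * d n)"
    unfolding d_def using data_bound[of n, OF _ DV] n dt by (intro mult_left_mono) auto
  moreover have "(g n)\<^sup>2 + (Gq n)\<^sup>2 - ((g (n-1))\<^sup>2 + (Gq (n-1))\<^sup>2) \<le> 2 * (2 * dt * ip M (grad (\<phi> n)) (grad ?D))"
  proof -
    let ?B = "\<lambda>x. 3 *\<^sub>R grad (\<phi> n) x - 4 *\<^sub>R grad (\<phi> (n-1)) x + grad (\<phi> (n-2)) x"
    have Bsq: "sq_integrable M ?B" by (intro sq_integrable_intros gsq)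
    have "ip M (grad ?D) (grad (\<phi> n)) = ip M (\<lambda>x. (1/(2*dt)) *\<^sub>R ?B x) (grad (\<phi> n))"
      by (intro ip_cong_AE grad_Dbar_later[OF n] gsq[THEN sq_integrableD(1)]
          sq_integrableD(1)[OF sq_integrable_scaleR[OF Bsq]])
    also have "\<dots> = (1/(2*dt)) * ip M ?B (grad (\<phi> n))" by (rule ip_scaleR_left)
    finally have "2 * (2 * dt * ip M (grad (\<phi> n)) (grad ?D)) = 2 * (2 * dt * ((1/(2*dt)) * ip M ?B (grad (\<phi> n))))"
      by (simp only: ip_commute[of M "grad (\<phi> n)" "grad ?D"])
    also have "\<dots> = 2 * ip M ?B (grad (\<phi> n))" using dt by simp
    also have "\<dots> \<ge> (g n)\<^sup>2 + (Gq n)\<^sup>2 - ((g (n-1))\<^sup>2 + (Gq (n-1))\<^sup>2)"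
      unfolding BDF2_identity[OF gsq(1-3)] g_def Gq_def n2 by simp
    finally show ?thesis .
  qed
  then have "\<nu> * ((g n)\<^sup>2 + (Gq n)\<^sup>2 - ((g (n-1))\<^sup>2 + (Gq (n-1))\<^sup>2)) \<le> \<nu> * (2 * (2 * dt * ip M (grad (\<phi> n)) (grad ?D)))"
    using \<nu> by (intro mult_left_mono) auto
  moreover have "\<nu> * (2 * (2 * dt * ip M (grad (\<phi> n)) (grad ?D))) = 2 * (2 * dt * \<nu> * ip M (grad (\<phi> n)) (grad ?D))"
    by simp
  moreover have "dt * (4 * F n + 2 * L * ?e) * d n = 2 * (2 * dt * (F n * d n)) + 2 * (L * dt * ?e * d n)"
    by (simp add: algebra_simps)
  ultimately show ?thesis
    using scheme_eq2[OF n DV] unfolding err(4) by linarith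
qed

lemma gradient_stability:
  defines "D \<equiv> (p 0)\<^sup>2 + (g 0)\<^sup>2 + dt * (\<Sum>n=1..N. (F n)\<^sup>2)"
  shows "\<And>n. n \<in> {1..N} \<Longrightarrow> \<nu> * (g n)\<^sup>2 \<le> gradient_stability_const K L T \<nu> * D"
    and "dt * (\<Sum>n=1..N. (d n)\<^sup>2) \<le> gradient_stability_const K L T \<nu> * D"
proof -
  let ?c = "stability_const K L T \<nu>"
  have nn: "0 \<le> p n" "0 \<le> g n" "0 \<le> d n" "0 \<le> Gq 1" for n
    by (simp_all add: p_def g_def d_def Gq_def)
  have time: "real N * dt \<le> T" by (rule N_T_time[OF dt(1) T order_refl])
  have L0: "0 \<le> L" using K_nonneg by (simp add: L_def)
  have c0: "0 \<le> ?c" by (rule stability_const_nonneg[OF \<nu>(1)])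
  have "(\<Sum>n=1..N. (dual n)\<^sup>2) \<le> (\<Sum>n=1..N. (F n)\<^sup>2)"
    by (intro sum_mono power_mono dual_le_F dual_nonneg)
  then have "?c * ((p 0)\<^sup>2 + dt * (\<Sum>n=1..N. (dual n)\<^sup>2)) \<le> ?c * ((p 0)\<^sup>2 + dt * (\<Sum>n=1..N. (F n)\<^sup>2))"
    using c0 dt by (intro mult_left_mono add_left_mono) auto
  then have pb: "n \<in> {1..N} \<Longrightarrow> (p n)\<^sup>2 \<le> ?c * ((p 0)\<^sup>2 + dt * (\<Sum>n=1..N. (F n)\<^sup>2))"
    and gb: "dt * \<nu> * (\<Sum>n=1..N. (g n)\<^sup>2) \<le> ?c * ((p 0)\<^sup>2 + dt * (\<Sum>n=1..N. (F n)\<^sup>2))" for n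
    using L2_stability(1)[of n] L2_stability(2) by linarith+
  note ds = discrete_stability_gradient[where p = p and g = g and F = F and d = d and Gq = Gq,
      OF dt time \<nu> K_nonneg L0 less_imp_le[OF T] nn(1,2) F_nonneg nn(3,4) c0 gradient_first gradient_later pb gb]
  show "\<nu> * (g n)\<^sup>2 \<le> gradient_stability_const K L T \<nu> * D" if "n \<in> {1..N}" for n
    unfolding gradient_stability_const_def Let_def D_def using ds(1) that by simp
  show "dt * (\<Sum>n=1..N. (d n)\<^sup>2) \<le> gradient_stability_const K L T \<nu> * D"
    unfolding gradient_stability_const_def Let_def D_def using ds(2) by simp
qed

lemma gradient_stability_norms:
  "sqrt \<nu> * linf1 N g + l21 dt N d \<le> 2 * sqrt (gradient_stability_const K L T \<nu>) * (H1norm \<Omega> (\<phi> 0) + l21 dt N F)"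
proof -
  let ?S = "gradient_stability_const K L T \<nu>" and ?X = "dt * (\<Sum>n=1..N. (F n)\<^sup>2)"
  let ?R = "sqrt (?S * ((p 0)\<^sup>2 + (g 0)\<^sup>2 + ?X))"
  have S: "0 \<le> ?S" by (rule gradient_stability_const_nonneg[OF \<nu>(1) less_imp_le[OF T]])
  have X: "0 \<le> ?X" using dt by (simp add: sum_nonneg)
  have "?R = sqrt ?S * sqrt ((p 0)\<^sup>2 + (g 0)\<^sup>2 + ?X)" by (rule real_sqrt_mult)
  also have "\<dots> \<le> sqrt ?S * (sqrt ((p 0)\<^sup>2 + (g 0)\<^sup>2) + sqrt ?X)"
    by (rule mult_left_mono[OF sqrt_add_le_add_sqrt]) (use S X in auto)
  finally have R: "?R \<le> sqrt ?S * (H1norm \<Omega> (\<phi> 0) + l21 dt N F)"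
    by (simp add: l21_def H1norm_def L2_eq[OF \<Omega>m] p_def g_def)
  have R0: "0 \<le> ?R" using S X by simp
  have "sqrt \<nu> * g n \<le> ?R" if "n \<in> {1..N}" for n
    by (rule real_le_rsqrt) (use gradient_stability(1)[OF that] \<nu> in \<open>simp add: power_mult_distrib\<close>)
  then have "g n \<le> ?R / sqrt \<nu>" if "n \<in> {1..N}" for n
    using that \<nu> by (simp add: pos_le_divide_eq mult.commute)
  then have "linf1 N g \<le> ?R / sqrt \<nu>"
    using R0 \<nu> unfolding linf1_def by (intro Max.boundedI) auto
  then have "sqrt \<nu> * linf1 N g \<le> ?R" using \<nu> by (simp add: pos_le_divide_eq mult.commute)
  moreover have "l21 dt N d \<le> ?R"
    unfolding l21_def by (intro real_sqrt_le_mono gradient_stability(2))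
  ultimately show ?thesis using R by (simp add: algebra_simps)
qed

end

section \<open>The constants as functions of the data, and the conclusion\<close>

text \<open>The argument \<open>i\<close> stands for \<open>1/\<nu>\<close>, so \<open>\<nu>\<close>
  is recovered as \<open>1/i\<close>. The absolute value and the summand 1 make the constant
  positive for all real arguments, including meaningless ones, as the theorem demands.\<close>

definition stability_bound :: "'d::finite itself \<Rightarrow> real \<Rightarrow> real \<Rightarrow> real \<Rightarrow> real" where
  "stability_bound d a T i =
    2 * sqrt \<bar>stability_const (flow_const d a) (5 * (1 + flow_const d a)) T (1/i)\<bar> + 1"

definition gradient_stability_bound :: "'d::finite itself \<Rightarrow> real \<Rightarrow> real \<Rightarrow> real \<Rightarrow> real" where
  "gradient_stability_bound d a T i =
    2 * sqrt \<bar>gradient_stability_const (flow_const d a) (5 * (1 + flow_const d a)) T (1/i)\<bar> + 1"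

lemma stability_bounds_pos: "0 < stability_bound d a T i" "0 < gradient_stability_bound d a T i"
  unfolding stability_bound_def gradient_stability_bound_def by (intro add_nonneg_pos; simp)+

lemma (in scheme_solution) stability_estimate:
  "linf1 N (\<lambda>n. L2norm \<Omega> (\<phi> n)) + sqrt \<nu> * l21 dt N (\<lambda>n. grad_L2norm \<Omega> (\<phi> n))
    \<le> stability_bound TYPE('d) (real_of_ereal (C_W1inf_norm \<Omega> T u)) T (1/\<nu>) *
      (L2norm \<Omega> (\<phi> 0) + l21 dt N (\<lambda>n. dual_norm_h \<Omega> V (Fn n)))"
proof -
  have eq: "(\<lambda>n. L2norm \<Omega> (\<phi> n)) = p" "(\<lambda>n. grad_L2norm \<Omega> (\<phi> n)) = g" "L2norm \<Omega> (\<phi> 0) = p 0"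
    by (simp_all add: L2_eq[OF \<Omega>m] p_def[abs_def] g_def[abs_def])
  have l21: "l21 dt N (\<lambda>n. dual_norm_h \<Omega> V (Fn n)) = l21 dt N dual"
    by (simp add: l21_def dual_def)
  have "0 \<le> p 0 + l21 dt N dual" using dt by (simp add: p_def l21_def sum_nonneg)
  then have "2 * sqrt (stability_const K L T \<nu>) * (p 0 + l21 dt N dual)
      \<le> stability_bound TYPE('d) a T (1/\<nu>) * (p 0 + l21 dt N dual)"
    using stability_const_nonneg[OF \<nu>(1), of K L T]
    by (intro mult_right_mono) (simp_all add: stability_bound_def K_def L_def)
  with L2_stability_norms show ?thesis unfolding eq l21 a_def by linarith
qed

lemma (in scheme_solution_L2) gradient_stability_estimate:
  "sqrt \<nu> * linf1 N (\<lambda>n. grad_L2norm \<Omega> (\<phi> n)) + l21 dt N (\<lambda>n. L2norm \<Omega> (Dbar dt \<phi> n))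
    \<le> gradient_stability_bound TYPE('d) (real_of_ereal (C_W1inf_norm \<Omega> T u)) T (1/\<nu>) *
      (H1norm \<Omega> (\<phi> 0) + l21 dt N (\<lambda>n. L2norm \<Omega> (f n)))"
proof -
  have eq: "(\<lambda>n. grad_L2norm \<Omega> (\<phi> n)) = g" "(\<lambda>n. L2norm \<Omega> (Dbar dt \<phi> n)) = d"
    by (simp_all add: L2_eq[OF \<Omega>m] d_def[abs_def] g_def[abs_def])
  have l21: "l21 dt N (\<lambda>n. L2norm \<Omega> (f n)) = l21 dt N F"
    by (simp add: l21_def F_def L2_eq[OF \<Omega>m])
  have "0 \<le> H1norm \<Omega> (\<phi> 0) + l21 dt N F"
    using dt H1norm_facts(1)[OF \<Omega>m] by (simp add: l21_def sum_nonneg)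
  then have "2 * sqrt (gradient_stability_const K L T \<nu>) * (H1norm \<Omega> (\<phi> 0) + l21 dt N F)
      \<le> gradient_stability_bound TYPE('d) a T (1/\<nu>) * (H1norm \<Omega> (\<phi> 0) + l21 dt N F)"
    using gradient_stability_const_nonneg[OF \<nu>(1) less_imp_le[OF T], of K L]
    by (intro mult_right_mono) (simp_all add: gradient_stability_bound_def K_def L_def)
  with gradient_stability_norms show ?thesis unfolding eq l21 a_def by linarith
qed

text \<open>The constants are functions chosen before the domain, the mesh, the degree and the time
  step, which is how independence of \<open>h\<close> and \<open>dt\<close> is expressed. The data
  enter through their values at the time levels: functionals on the discrete space in (i),
  square-integrable functions in (ii).\<close>

theorem theorem3:
  assumes "CARD('d) \<in> {1, 2, 3}"
  shows
  "(\<exists>C :: real \<Rightarrow> real \<Rightarrow> real \<Rightarrow> real. (\<forall>a b c. C a b c > 0) \<and>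
     (\<forall>(\<Omega> :: (real^'d) set) Th (k::nat) (\<nu>::real) (T::real) u (dt::real) Fn \<phi>.
        poly_domain_triang \<Omega> Th \<and> 1 \<le> k \<and> 0 < \<nu> \<and> \<nu> \<le> 1 \<and> 0 < T \<and>
        velocity_field \<Omega> T u \<and>
        ereal dt * C_W1inf_semi \<Omega> T u \<le> ereal (1/8) \<and> 0 < dt \<and> dt < 1 \<and>
        (\<forall>n\<in>{1..N_T T dt}. linear_on (Psi_h \<Omega> Th k) (Fn n)) \<and>
        \<phi> 0 \<in> Psi_h \<Omega> Th k \<and>
        solves_scheme \<Omega> (Psi_h \<Omega> Th k) \<nu> u dt (N_T T dt) Fn \<phi>
      \<longrightarrow>
        linf1 (N_T T dt) (\<lambda>n. L2norm \<Omega> (\<phi> n))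
          + sqrt \<nu> * l21 dt (N_T T dt) (\<lambda>n. grad_L2norm \<Omega> (\<phi> n))
        \<le> C (real_of_ereal (C_W1inf_norm \<Omega> T u)) T (1/\<nu>) *
           (L2norm \<Omega> (\<phi> 0) + l21 dt (N_T T dt) (\<lambda>n. dual_norm_h \<Omega> (Psi_h \<Omega> Th k) (Fn n)))))
   \<and>
   (\<exists>C :: real \<Rightarrow> real \<Rightarrow> real \<Rightarrow> real. (\<forall>a b c. C a b c > 0) \<and>
     (\<forall>(\<Omega> :: (real^'d) set) Th (k::nat) (\<nu>::real) (T::real) u (dt::real) (f :: nat \<Rightarrow> real^'d \<Rightarrow> real) \<phi>.
        poly_domain_triang \<Omega> Th \<and> 1 \<le> k \<and> 0 < \<nu> \<and> \<nu> \<le> 1 \<and> 0 < T \<and>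
        velocity_field \<Omega> T u \<and>
        ereal dt * C_W1inf_semi \<Omega> T u \<le> ereal (1/8) \<and> 0 < dt \<and> dt < 1 \<and>
        (\<forall>n\<in>{1..N_T T dt}. f n \<in> borel_measurable lebesgue \<and>
            set_integrable lebesgue \<Omega> (\<lambda>x. (f n x)\<^sup>2)) \<and>
        \<phi> 0 \<in> Psi_h \<Omega> Th k \<and>
        solves_scheme \<Omega> (Psi_h \<Omega> Th k) \<nu> u dt (N_T T dt) (\<lambda>n \<psi>. L2ip \<Omega> (f n) \<psi>) \<phi>
      \<longrightarrow>
        sqrt \<nu> * linf1 (N_T T dt) (\<lambda>n. grad_L2norm \<Omega> (\<phi> n))
          + l21 dt (N_T T dt) (\<lambda>n. L2norm \<Omega> (Dbar dt \<phi> n))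
        \<le> C (real_of_ereal (C_W1inf_norm \<Omega> T u)) T (1/\<nu>) *
           (H1norm \<Omega> (\<phi> 0) + l21 dt (N_T T dt) (\<lambda>n. L2norm \<Omega> (f n)))))"
proof (rule conjI, goal_cases)
  have d3: "CARD('d) \<le> 3" using assms by auto
  case 1
  show ?case
  proof (rule exI[of _ "stability_bound TYPE('d)"], intro conjI allI impI, rule stability_bounds_pos,
      elim conjE, rule scheme_solution.stability_estimate)
    fix \<Omega> :: "(real^'d) set" and Th k \<nu> T u dt Fn \<phi>
    assume "poly_domain_triang \<Omega> Th" "0 < \<nu>" "\<nu> \<le> 1" "0 < T" "velocity_field \<Omega> T u"
      "ereal dt * C_W1inf_semi \<Omega> T u \<le> ereal (1/8)" "0 < dt" "dt < 1" "\<phi> 0 \<in> Psi_h \<Omega> Th k"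
      "solves_scheme \<Omega> (Psi_h \<Omega> Th k) \<nu> u dt (N_T T dt) Fn \<phi>"
    then show "scheme_solution \<Omega> Th k \<nu> T dt u Fn \<phi>"
      by (intro scheme_solution.intro d3)
  qed
next
  have d3: "CARD('d) \<le> 3" using assms by auto
  case 2
  show ?case
  proof (rule exI[of _ "gradient_stability_bound TYPE('d)"], intro conjI allI impI, rule stability_bounds_pos,
      elim conjE, rule scheme_solution_L2.gradient_stability_estimate)
    fix \<Omega> :: "(real^'d) set" and Th k \<nu> T u dt and f :: "nat \<Rightarrow> real^'d \<Rightarrow> real" and \<phi>
    assume H: "poly_domain_triang \<Omega> Th" "0 < \<nu>" "\<nu> \<le> 1" "0 < T" "velocity_field \<Omega> T u"
      "ereal dt * C_W1inf_semi \<Omega> T u \<le> ereal (1/8)" "0 < dt" "dt < 1" "\<phi> 0 \<in> Psi_h \<Omega> Th k"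
      "solves_scheme \<Omega> (Psi_h \<Omega> Th k) \<nu> u dt (N_T T dt) (\<lambda>n \<psi>. L2ip \<Omega> (f n) \<psi>) \<phi>"
      and f: "\<forall>n\<in>{1..N_T T dt}. f n \<in> borel_measurable lebesgue \<and> set_integrable lebesgue \<Omega> (\<lambda>x. (f n x)\<^sup>2)"
    have \<Omega>: "\<Omega> \<in> sets lebesgue" by (rule finite_measure_lebesgue_on_domain(1)[OF H(1)])
    have "sq_integrable (lebesgue_on \<Omega>) (f n)" if "n \<in> {1..N_T T dt}" for n
      using f that \<Omega>
      by (auto simp: sq_integrable_def set_integrable_def integrable_restrict_space intro: measurable_restrict_space1)
    then show "scheme_solution_L2 \<Omega> Th k \<nu> T dt u f \<phi>"
      by (intro scheme_solution_L2.intro scheme_solution_L2_axioms.intro scheme_solution.intro d3 H)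
  qed
qed

end
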